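(* Consider the Poisson model $P_\theta=\mathrm{Poi}(\theta)$, $\theta\in\mathbb R_+$. (i) Let $h>0$ and let $\mathcal P([0,h])$ be the set of all probability distributions supported on $[0,h]$. There exist constants $c_1=c_1(h)>0$, $c_2=c_2(h)>0$ and $n_0$ such that for all $n\ge n_0$, $$c_1\left(\frac{\log n}{\log\log n}\right)^2\ \le\ \mathsf{TotRegret}_n(\mathcal P([0,h]))\ \le\ c_2\left(\frac{\log n}{\log\log n}\right)^2 .$$ (ii) Let $s>0$ and let $\mathsf{SubE}(s)=\{G:\ G([t,\infty))\le 2e^{-t/s}\ \ \forall t>0\}$ denote the set of all $s$-subexponential probability distributions on $\mathbb R_+$. There exist constants $c_3=c_3(s)>0$, $c_4=c_4(s)>0$ and $n_0$ such that for all $n\ge n_0$, $$c_3\log^3 n\ \le\ \mathsf{TotRegret}_n(\mathsf{SubE}(s))\ \le\ c_4\log^3 n .$$ Furthermore, in both (i) and (ii) the upper bound is achieved by the Robbins estimator $\tilde\theta^n=(\tilde\theta_1,\dots,\tilde\theta_n)$, that is, $\sup_{G\in\mathcal G}\{\mathbb E_G[\|\tilde\theta^n-\theta^n\|^2]-n\cdot\mathrm{mmse}(G)\}$ is at most the stated upper bound, with $\mathcal G=\mathcal P([0,h])$ in (i) and $\mathcal G=\mathsf{SubE}(s)$ in (ii).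
   Context: Empirical Bayes setting: given a prior $G$ on $\mathbb R_+$, let $\theta^n=(\theta_1,\dots,\theta_n)$ be i.i.d. from $G$, and conditionally on $\theta^n$ let $Y_1,\dots,Y_n$ be independent with $Y_i\sim P_{\theta_i}$. $\mathbb E_G$ denotes expectation over the joint law of $(\theta^n,Y^n)$. The Bayes risk is $\mathrm{mmse}(G)=\inf_{\hat\theta}\mathbb E_G[(\hat\theta(Y)-\theta)^2]$, where $\theta\sim G$, $Y\mid\theta\sim P_\theta$ is a single observation and the infimum is over all measurable functions $\hat\theta$. For a collection of priors $\mathcal G$, the total regret is $$\mathsf{TotRegret}_n(\mathcal G)=\inf_{\hat\theta^n}\sup_{G\in\mathcal G}\left\{\mathbb E_G\left[\|\hat\theta^n(Y_1,\dots,Y_n)-\theta^n\|^2\right]-n\cdot\mathrm{mmse}(G)\right\},$$ where $\|\cdot\|$ is the Euclidean norm and the infimum is over all estimators $\hat\theta^n$ (measurable $\mathbb R^n$-valued functions of $Y_1,\dots,Y_n$). The Robbins estimator is $$\tilde\theta_j=(Y_j+1)\frac{N(Y_j+1)}{N(Y_j)},\qquad N(y)=|\{i\in\{1,\dots,n\}:Y_i=y\}|.$$ *)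

theory Defs
  imports "HOL-Probability.Probability"
begin

text \<open>
  Joint law of \<open>(x, y)\<close> when \<open>x\<close> has law \<open>M\<close> and, conditionally on \<open>x\<close>, \<open>y\<close> has law \<open>K x\<close>
  on the measurable space \<open>N\<close>.
\<close>

definition joint_law :: "'a measure \<Rightarrow> 'b measure \<Rightarrow> ('a \<Rightarrow> 'b measure) \<Rightarrow> ('a \<times> 'b) measure" where
  "joint_law M N K = M \<bind> (\<lambda>x. distr (K x) (M \<Otimes>\<^sub>M N) (Pair x))"

lemma joint_law_kernel_measurable:
  assumes "K \<in> M \<rightarrow>\<^sub>M prob_algebra N"
  shows "(\<lambda>x. distr (K x) (M \<Otimes>\<^sub>M N) (Pair x)) \<in> M \<rightarrow>\<^sub>M prob_algebra (M \<Otimes>\<^sub>M N)"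
proof -
  have "(\<lambda>x. distr (K x) (M \<Otimes>\<^sub>M N) (Pair x)) \<in> M \<rightarrow>\<^sub>M subprob_algebra (M \<Otimes>\<^sub>M N)"
    using assms by (intro measurable_distr2 measurable_prob_algebraD) auto
  moreover have "prob_space (distr (K x) (M \<Otimes>\<^sub>M N) (Pair x))" if "x \<in> space M" for x
  proof -
    have "K x \<in> space (prob_algebra N)"
      using assms that by (rule measurable_space)
    then interpret prob_space "K x"
      by (simp add: space_prob_algebra)
    have "sets (K x) = sets N"
      using \<open>K x \<in> space (prob_algebra N)\<close> by (simp add: space_prob_algebra)
    then have "Pair x \<in> K x \<rightarrow>\<^sub>M M \<Otimes>\<^sub>M N"
      using that measurable_Pair1' by (auto cong: measurable_cong_sets)
    then show ?thesis
      by (rule prob_space_distr)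
  qed
  ultimately show ?thesis
    by (auto simp: prob_algebra_def measurable_restrict_space2_iff)
qed

lemma
  assumes "prob_space M" "K \<in> M \<rightarrow>\<^sub>M prob_algebra N"
  shows prob_space_joint_law: "prob_space (joint_law M N K)"
    and sets_joint_law: "sets (joint_law M N K) = sets (M \<Otimes>\<^sub>M N)"
proof -
  have "M \<in> space (prob_algebra M)"
    using assms(1) by (simp add: space_prob_algebra)
  note this joint_law_kernel_measurable[OF assms(2)]
  then show "prob_space (joint_law M N K)" "sets (joint_law M N K) = sets (M \<Otimes>\<^sub>M N)"
    unfolding joint_law_def by (rule prob_space_bind', rule sets_bind')
qed

lemma nn_integral_joint_law:
  assumes K: "K \<in> M \<rightarrow>\<^sub>M prob_algebra N" and f: "f \<in> borel_measurable (M \<Otimes>\<^sub>M N)"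
  shows "(\<integral>\<^sup>+p. f p \<partial>joint_law M N K) = (\<integral>\<^sup>+x. \<integral>\<^sup>+y. f (x, y) \<partial>K x \<partial>M)"
proof -
  have "(\<integral>\<^sup>+p. f p \<partial>joint_law M N K)
      = (\<integral>\<^sup>+x. \<integral>\<^sup>+p. f p \<partial>distr (K x) (M \<Otimes>\<^sub>M N) (Pair x) \<partial>M)"
    unfolding joint_law_def
    by (rule nn_integral_bind[OF f measurable_prob_algebraD[OF joint_law_kernel_measurable[OF K]]])
  also have "\<dots> = (\<integral>\<^sup>+x. \<integral>\<^sup>+y. f (x, y) \<partial>K x \<partial>M)"
  proof (rule nn_integral_cong)
    fix x assume x: "x \<in> space M"
    have "sets (K x) = sets N"
      using measurable_space[OF K x] by (simp add: space_prob_algebra)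
    then have "Pair x \<in> K x \<rightarrow>\<^sub>M M \<Otimes>\<^sub>M N"
      using x measurable_Pair1' by (auto cong: measurable_cong_sets)
    then show "(\<integral>\<^sup>+p. f p \<partial>distr (K x) (M \<Otimes>\<^sub>M N) (Pair x)) = (\<integral>\<^sup>+y. f (x, y) \<partial>K x)"
      using f by (simp add: nn_integral_distr)
  qed
  finally show ?thesis .
qed

text \<open>
  The library's \<^const>\<open>poisson_pmf\<close> is specified for positive rates only, so \<open>Poi(0)\<close>, the point
  mass at 0, is added. Negative arguments never matter: priors live on \<open>[0, \<infinity>)\<close>.
\<close>

definition Poi :: "real \<Rightarrow> nat measure" where
  "Poi \<theta> = measure_pmf (if 0 < \<theta> then poisson_pmf \<theta> else return_pmf 0)"

text \<open>Prior laws are Borel measures on \<open>real\<close>, with \<open>\<real>\<^sub>+ = {0..}\<close>.\<close>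

definition bounded_priors :: "real \<Rightarrow> real measure set" where
  "bounded_priors h = {G. prob_space G \<and> sets G = sets borel \<and> measure G {0..h} = 1}"

definition SubE :: "real \<Rightarrow> real measure set" where
  "SubE s = {G. prob_space G \<and> sets G = sets borel \<and> measure G {0..} = 1 \<and>
                (\<forall>t>0. measure G {t..} \<le> 2 * exp (- t / s))}"

text \<open>
  Sequences of length \<open>n\<close> are functions on the index set \<open>{..<n}\<close>: parameter vectors live in
  \<open>PiM {..<n} (\<lambda>_. borel)\<close> and data vectors in \<open>obs_space n\<close>.
\<close>

abbreviation obs_space :: "nat \<Rightarrow> (nat \<Rightarrow> nat) measure" where
  "obs_space n \<equiv> PiM {..<n} (\<lambda>_. count_space UNIV)"

definition single_law :: "real measure \<Rightarrow> (real \<times> nat) measure" where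
  "single_law G = joint_law G (count_space UNIV) Poi"

definition sample_law :: "nat \<Rightarrow> real measure \<Rightarrow> ((nat \<Rightarrow> real) \<times> (nat \<Rightarrow> nat)) measure" where
  "sample_law n G = joint_law (PiM {..<n} (\<lambda>_. G)) (obs_space n) (\<lambda>\<theta>. PiM {..<n} (\<lambda>i. Poi (\<theta> i)))"

lemma sets_Poi [simp, measurable_cong]: "sets (Poi \<theta>) = UNIV"
  and space_Poi [simp]: "space (Poi \<theta>) = UNIV"
  and prob_space_Poi: "prob_space (Poi \<theta>)"
  by (simp_all add: Poi_def measure_pmf.prob_space_axioms)

lemma measurable_Poi: "Poi \<in> borel \<rightarrow>\<^sub>M prob_algebra (count_space UNIV)"
proof (rule measurable_prob_algebraI)
  show "prob_space (Poi \<theta>)" for \<theta> by (rule prob_space_Poi)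
  show "Poi \<in> borel \<rightarrow>\<^sub>M subprob_algebra (count_space UNIV)"
  proof (rule measurable_subprob_algebra)
    fix A :: "nat set"
    have "emeasure (Poi \<theta>) A = (\<Sum>k. ennreal (if 0 < \<theta> then \<theta> ^ k / fact k * exp (- \<theta>)
        else if k = 0 then 1 else 0) * indicator A k)" for \<theta>
      by (subst nn_integral_indicator[symmetric], simp)
         (auto simp: Poi_def nn_integral_measure_pmf nn_integral_count_space_nat indicator_def
               intro!: suminf_cong)
    then show "(\<lambda>\<theta>. emeasure (Poi \<theta>) A) \<in> borel_measurable borel"
      by simp
  qed (auto intro: prob_space_Poi prob_space_imp_subprob_space)
qed

lemma measurable_PiM_Poi:
  "(\<lambda>\<theta>. PiM {..<n} (\<lambda>i. Poi (\<theta> i))) \<in> PiM {..<n} (\<lambda>_. borel) \<rightarrow>\<^sub>M prob_algebra (obs_space n)"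
proof (rule measurable_prob_algebra_generated[OF sets_PiM Int_stable_prod_algebra prod_algebra_sets_into_space])
  fix \<theta> :: "nat \<Rightarrow> real"
  show "prob_space (PiM {..<n} (\<lambda>i. Poi (\<theta> i)))"
    by (intro prob_space_PiM prob_space_Poi)
  show "sets (PiM {..<n} (\<lambda>i. Poi (\<theta> i))) = sets (obs_space n)"
    by (intro sets_PiM_cong) auto
next
  fix A assume "A \<in> prod_algebra {..<n} (\<lambda>_. count_space (UNIV :: nat set))"
  then obtain E where A: "A = PiE {..<n} E"
    by (auto simp: prod_algebra_eq_finite)
  have "emeasure (PiM {..<n} (\<lambda>i. Poi (\<theta> i))) A = (\<Prod>i<n. emeasure (Poi (\<theta> i)) (E i))" for \<theta>
  proof -
    interpret product_prob_space "\<lambda>i. Poi (\<theta> i)" "{..<n}"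
      by (intro product_prob_spaceI prob_space_Poi)
    show ?thesis
      unfolding A by (rule emeasure_PiM) auto
  qed
  moreover have "(\<lambda>\<theta>. emeasure (Poi \<theta>) B) \<in> borel_measurable borel" for B
    using measurable_emeasure_kernel[OF measurable_prob_algebraD[OF measurable_Poi], of B] by simp
  ultimately show "(\<lambda>\<theta>. emeasure (PiM {..<n} (\<lambda>i. Poi (\<theta> i))) A)
      \<in> borel_measurable (PiM {..<n} (\<lambda>_. borel))"
    by (auto intro!: borel_measurable_prod_ennreal measurable_compose[OF measurable_component_singleton])
qed

text \<open>
  Risks are taken in \<open>[0, \<infinity>]\<close>, so that estimators with infinite risk are included, and the
  regret in the extended reals. The Bayes risk of every prior in the classes above is finite, so
  no \<open>\<infinity> - \<infinity>\<close> arises.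
\<close>

definition mmse :: "real measure \<Rightarrow> ennreal" where
  "mmse G = (INF T \<in> count_space UNIV \<rightarrow>\<^sub>M borel.
     \<integral>\<^sup>+(\<theta>, y). ennreal ((T y - \<theta>)\<^sup>2) \<partial>single_law G)"

definition estimators :: "nat \<Rightarrow> ((nat \<Rightarrow> nat) \<Rightarrow> (nat \<Rightarrow> real)) set" where
  "estimators n = obs_space n \<rightarrow>\<^sub>M PiM {..<n} (\<lambda>_. borel)"

definition risk :: "nat \<Rightarrow> real measure \<Rightarrow> ((nat \<Rightarrow> nat) \<Rightarrow> (nat \<Rightarrow> real)) \<Rightarrow> ennreal" where
  "risk n G T = (\<integral>\<^sup>+(\<theta>, y). ennreal ((L2_set (\<lambda>i. T y i - \<theta> i) {..<n})\<^sup>2) \<partial>sample_law n G)"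

definition max_regret ::
    "nat \<Rightarrow> real measure set \<Rightarrow> ((nat \<Rightarrow> nat) \<Rightarrow> (nat \<Rightarrow> real)) \<Rightarrow> ereal" where
  "max_regret n \<G> T =
     (SUP G \<in> \<G>. enn2ereal (risk n G T) - ereal (real n) * enn2ereal (mmse G))"

definition TotRegret :: "nat \<Rightarrow> real measure set \<Rightarrow> ereal" where
  "TotRegret n \<G> = (INF T \<in> estimators n. max_regret n \<G> T)"

definition occurrences :: "nat \<Rightarrow> (nat \<Rightarrow> nat) \<Rightarrow> nat \<Rightarrow> nat" where
  "occurrences n Y y = card {i \<in> {..<n}. Y i = y}"

definition robbins :: "nat \<Rightarrow> (nat \<Rightarrow> nat) \<Rightarrow> (nat \<Rightarrow> real)" where
  "robbins n Y = (\<lambda>j\<in>{..<n}.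
     (real (Y j) + 1) * real (occurrences n Y (Y j + 1)) / real (occurrences n Y (Y j)))"

lemma robbins_in_estimators: "robbins n \<in> estimators n"
proof -
  have "(\<lambda>Y. (real (Y j) + 1) * real (occurrences n Y (Y j + 1)) / real (occurrences n Y (Y j)))
      \<in> borel_measurable (obs_space n)" if [simp]: "j < n" for j
  proof -
    have [measurable]: "(\<lambda>Y. Y i) \<in> obs_space n \<rightarrow>\<^sub>M count_space UNIV" if "i < n" for i
      using that by simp
    have occ: "real (occurrences n Y y) = (\<Sum>i<n. if Y i = y then 1 else 0)" for Y y
      by (simp add: occurrences_def sum.If_cases Int_def)
    show ?thesis
      unfolding occ by measurable
  qed
  then show ?thesis
    unfolding estimators_def robbins_def by (intro measurable_restrict) auto
qed

end

theory Submission
  imports Defs "HOL-Real_Asymp.Real_Asymp"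
begin

text \<open>
  Write \<open>f y\<close> for the mass that the marginal law of one observation gives to \<open>y\<close>. The posterior mean is
  \<open>b y = (y + 1) f (y + 1) / f y\<close>, and orthogonality of conditional expectation turns the regret of an
  estimator under a prior into the expected sum of \<open>(T\<^sub>j - b (Y\<^sub>j))\<^sup>2\<close> (lemmas \<open>risk_eq\<close> and \<open>excess_risk\<close>).
  Everything is therefore about estimating ratios of neighbouring masses of a Poisson mixture
  from \<open>n\<close> samples.
  
  Upper bounds. Given \<open>Y\<^sub>j = y\<close>, the Robbins estimator is \<open>(y + 1) N / (M + 1)\<close>, where \<open>(M, N)\<close> counts how
  often \<open>y\<close> and \<open>y + 1\<close> occur among the other observations. Negative moments of these trinomial
  counts are explicit, and they show that the cell \<open>y\<close> contributes at most \<open>2 (y + 1) b y + 5 (b y)\<^sup>2\<close> to the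
  regret, whatever \<open>f y\<close> is (\<open>robbins_cell_le\<close>). An exponential moment of the prior makes
  all cells beyond some \<open>y0\<close> negligible (\<open>regret_robbins_le\<close>). On \<open>[0, h]\<close> one has \<open>b y \<le> h\<close> and
  \<open>y0\<close> of order \<open>log n / log log n\<close>, which gives the square of this quantity. For subexponential
  priors both \<open>y0\<close> and, in all cells with non-negligible mass, \<open>b y\<close> are of order \<open>log n\<close>, which gives \<open>log\<^sup>3 n\<close>.
  
  Lower bounds. The priors are the vertices of a hypercube around one discrete prior \<open>G\<^sub>0\<close>. An atom
  at \<open>H\<close> dominates the mixture mass of \<open>G\<^sub>0\<close> at all \<open>y \<ge> H\<close>, and a fine grid of \<open>2 m\<close> small
  atoms carries the perturbations. Lagrange interpolation yields signed weights on the grid whose Poisson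
  mixture is \<open>1\<close> at a given \<open>i \<le> m\<close>, vanishes at all other points of \<open>{1..2 m}\<close> and is tiny beyond
  (\<open>ex_localized_direction\<close>). Switching such a perturbation on, with an amplitude that keeps the \<open>n\<close>-sample laws
  statistically close, moves \<open>f i\<close> but not \<open>f (i - 1)\<close>, hence moves \<open>b (i - 1)\<close>. The two-point bound
  (\<open>two_point\<close>) charges a regret of order \<open>i H\<close> for this; averaging over the hypercube
  (\<open>hypercube_average\<close>) adds up the charges for \<open>m / 2 < i \<le> m\<close>, of total order \<open>m\<^sup>2 H\<close>
  (\<open>regret_lower_bound\<close>). The weights must not make the prior negative, which requires
  \<open>(C m / H)\<^sup>m \<le> n\<^sup>c\<close> for constants \<open>C\<close> and \<open>c\<close>. For priors on \<open>[0, h]\<close> this allows \<open>H = h\<close> and \<open>m\<close> of order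
  \<open>log n / log log n\<close>; for subexponential priors it allows \<open>H = m / 6\<close> and \<open>m\<close> of order \<open>log n\<close>.
\<close>

section \<open>Poisson likelihoods and data vectors\<close>

text \<open>
  The mass function of \<open>Poi\<close>. Rates \<open>\<theta> < 0\<close> get the point mass at \<open>0\<close>, so that the
  function is a probability mass function, with values in \<open>[0, 1]\<close>, for every real \<open>\<theta>\<close>.
\<close>

definition likelihood :: "real \<Rightarrow> nat \<Rightarrow> real" where
  "likelihood \<theta> y = pmf (if 0 < \<theta> then poisson_pmf \<theta> else return_pmf 0) y"

lemma likelihood_nonneg [simp]: "0 \<le> likelihood \<theta> y"
  and likelihood_le_1: "likelihood \<theta> y \<le> 1"
  by (simp_all add: likelihood_def pmf_le_1)

lemma likelihood_eq: "0 \<le> \<theta> \<Longrightarrow> likelihood \<theta> y = \<theta> ^ y / fact y * exp (- \<theta>)"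
  by (cases "\<theta> = 0"; cases y) (auto simp: likelihood_def)

lemma measurable_likelihood [measurable]: "(\<lambda>\<theta>. likelihood \<theta> y) \<in> borel_measurable borel"
proof -
  have "(\<lambda>\<theta>. likelihood \<theta> y) =
      (\<lambda>\<theta>. if 0 < \<theta> then \<theta> ^ y / fact y * exp (- \<theta>) else if y = 0 then 1 else 0)"
    by (auto simp: likelihood_def fun_eq_iff)
  then show ?thesis by simp
qed

text \<open>
  This identity is what makes the Poisson model special: it trades a factor \<open>\<theta>\<close> for a shift in \<open>y\<close>, and so
  expresses posterior moments by the marginal masses alone.
\<close>

lemma mult_likelihood: "0 \<le> \<theta> \<Longrightarrow> \<theta> * likelihood \<theta> y = real (Suc y) * likelihood \<theta> (Suc y)"
  by (simp add: likelihood_eq field_simps del: of_nat_Suc)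

lemma nn_integral_Poi:
  "(\<integral>\<^sup>+y. g y \<partial>Poi \<theta>) = (\<integral>\<^sup>+y. ennreal (likelihood \<theta> y) * g y \<partial>count_space UNIV)"
  unfolding Poi_def likelihood_def by (rule nn_integral_measure_pmf)

lemma nn_integral_likelihood: "(\<integral>\<^sup>+y. ennreal (likelihood \<theta> y) \<partial>count_space UNIV) = 1"
  unfolding likelihood_def by (rule nn_integral_pmf_eq_1)

text \<open>
  Data vectors form a countable discrete space. Integrals over the observations are thus sums weighted by
  products of likelihoods, which can be exchanged with the integral over \<open>\<theta>\<close> and factorized.
\<close>

lemma obs_space_eq_count_space: "obs_space n = count_space (PiE {..<n} (\<lambda>_. UNIV))"
  by (rule count_space_PiM_finite) auto

lemma countable_obs: "countable (PiE {..<n::nat} (\<lambda>_. UNIV :: nat set))"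
  by (intro countable_PiE) auto

lemma nn_integral_obs_prod:
  "(\<integral>\<^sup>+Y. (\<Prod>i<n. g i (Y i)) \<partial>obs_space n) = (\<Prod>i<n. \<integral>\<^sup>+y. g i y \<partial>count_space UNIV)"
proof -
  interpret product_sigma_finite "\<lambda>_. count_space (UNIV :: nat set)"
    by (intro product_sigma_finite.intro sigma_finite_measure_count_space)
  show ?thesis by (rule product_nn_integral_prod) auto
qed

lemma nn_integral_PiM_Poi:
  "(\<integral>\<^sup>+Y. g Y \<partial>PiM {..<n} (\<lambda>i. Poi (\<theta> i)))
    = (\<integral>\<^sup>+Y. ennreal (\<Prod>i<n. likelihood (\<theta> i) (Y i)) * g Y \<partial>obs_space n)"
proof -
  let ?P = "PiM {..<n} (\<lambda>i. Poi (\<theta> i))" and ?\<Omega> = "PiE {..<n} (\<lambda>_. UNIV :: nat set)"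
  let ?d = "\<lambda>Y. ennreal (\<Prod>i<n. likelihood (\<theta> i) (Y i))"
  interpret product_prob_space "\<lambda>i. Poi (\<theta> i)" "{..<n}"
    by (intro product_prob_spaceI prob_space_Poi)
  have sets_P: "sets ?P = sets (obs_space n)"
    by (intro sets_PiM_cong) auto
  have "?P = density (obs_space n) ?d"
  proof (rule measure_eqI_countable[OF _ _ countable_obs])
    show "sets ?P = Pow ?\<Omega>"
      unfolding sets_P obs_space_eq_count_space by simp
    show "sets (density (obs_space n) ?d) = Pow ?\<Omega>"
      unfolding obs_space_eq_count_space by simp
  next
    fix Y assume Y: "Y \<in> ?\<Omega>"
    have "{Y} = PiE {..<n} (\<lambda>i. {Y i})"
      using Y by (simp add: PiE_iff PiE_singleton)
    then have "emeasure ?P {Y} = (\<Prod>i<n. emeasure (Poi (\<theta> i)) {Y i})"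
      by (metis emeasure_PiM finite_lessThan sets_Poi UNIV_I sets_Poi Pow_UNIV)
    also have "\<dots> = ?d Y"
      by (simp add: Poi_def emeasure_pmf_single likelihood_def prod_ennreal)
    also have "\<dots> = emeasure (density (obs_space n) ?d) {Y}"
      unfolding obs_space_eq_count_space using Y
      by (subst emeasure_density) (auto simp: nn_integral_count_space_indicator
          simp flip: nn_integral_count_space_indicator)
    finally show "emeasure ?P {Y} = emeasure (density (obs_space n) ?d) {Y}" .
  qed
  then show ?thesis
    by (simp add: nn_integral_density obs_space_eq_count_space)
qed

lemma power_over_fact_le_exp:
  fixes x :: real
  assumes "0 \<le> x"
  shows "x ^ n / fact n \<le> exp x"
  using likelihood_le_1[of x n] assms
  by (simp add: likelihood_eq exp_minus divide_simps mult.commute)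

text \<open>
  Chernoff's bound: multiply by \<open>b\<^sup>z\<close> and compare one term of the exponential series with its sum.
\<close>

lemma likelihood_chernoff:
  assumes "0 \<le> \<theta>" "0 < b"
  shows "likelihood \<theta> z \<le> exp (\<theta> * (b - 1)) / b ^ z"
proof -
  have "(\<theta> * b) ^ z / fact z \<le> exp (\<theta> * b)"
    using assms by (intro power_over_fact_le_exp) auto
  then have "\<theta> ^ z / fact z * b ^ z * exp (- \<theta>) \<le> exp (\<theta> * b) * exp (- \<theta>)"
    by (intro mult_right_mono) (auto simp: power_mult_distrib)
  also have "exp (\<theta> * b) * exp (- \<theta>) = exp (\<theta> * (b - 1))"
    by (simp add: exp_add[symmetric] right_diff_distrib)
  finally have "likelihood \<theta> z * b ^ z \<le> exp (\<theta> * (b - 1))"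
    using assms by (simp add: likelihood_eq mult_ac)
  then show ?thesis
    using assms by (simp add: pos_le_divide_eq)
qed

text \<open>
  As a function of the rate, the likelihood of \<open>y\<close> increases up to \<open>y\<close>. Hence among atoms in \<open>[0, H]\<close>
  the one at \<open>H\<close> explains every observation \<open>y \<ge> H\<close> best.
\<close>

lemma likelihood_mono_below:
  assumes "0 \<le> x" "x \<le> H" "H \<le> real y" "0 < H"
  shows "likelihood x y \<le> likelihood H y"
proof -
  have "x / H \<le> exp (- ((H - x) / H))"
    using exp_ge_add_one_self[of "- ((H - x) / H)"] assms by (simp add: field_simps)
  then have "(x / H) ^ y \<le> exp (- ((H - x) / H)) ^ y"
    using assms by (intro power_mono) auto
  also have "\<dots> = exp (real y * (- ((H - x) / H)))"
    by (rule exp_of_nat_mult[symmetric])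
  also have "\<dots> \<le> exp (x - H)"
  proof -
    have "H * (H - x) \<le> real y * (H - x)" using assms by (intro mult_right_mono) auto
    then have "H - x \<le> real y * ((H - x) / H)" using assms by (simp add: field_simps)
    then show ?thesis by simp
  qed
  finally have "x ^ y \<le> H ^ y * (exp x / exp H)"
    using assms by (simp add: power_divide exp_diff field_simps)
  then have "x ^ y * exp (- x) \<le> H ^ y * exp (- H)"
    by (simp add: exp_minus field_simps)
  then show ?thesis
    using assms by (simp add: likelihood_eq divide_right_mono)
qed

lemma power_le_fact:
  assumes "0 \<le> x" "3 * x \<le> real y"
  shows "x ^ y \<le> fact y"
proof -
  have "(3 * x) ^ y / fact y \<le> real y ^ y / fact y"
    using assms by (intro divide_right_mono power_mono) auto
  also have "\<dots> \<le> exp (real y)"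
    by (rule power_over_fact_le_exp) simp
  also have "\<dots> = exp 1 ^ y"
    by (simp add: exp_of_nat_mult[symmetric])
  also have "\<dots> \<le> 3 ^ y"
    using exp_le by (intro power_mono) auto
  finally show ?thesis
    by (simp add: power_mult_distrib field_simps)
qed

lemma sums_likelihood: "(\<lambda>y. likelihood \<theta> y) sums 1"
proof -
  have "(\<integral>\<^sup>+y. ennreal (likelihood \<theta> y) \<partial>count_space UNIV) = (\<Sum>y. ennreal (likelihood \<theta> y))"
    by (rule nn_integral_count_space_nat)
  then have eq: "(\<Sum>y. ennreal (likelihood \<theta> y)) = ennreal 1"
    using nn_integral_likelihood[of \<theta>] by simp
  then have "summable (\<lambda>y. likelihood \<theta> y)"
    by (intro summable_suminf_not_top) auto
  moreover from this eq have "(\<Sum>y. likelihood \<theta> y) = 1"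
    by (subst (asm) suminf_ennreal2) (auto intro!: suminf_nonneg)
  ultimately show ?thesis by (simp add: sums_iff)
qed

lemma sq_dist_expand:
  fixes t \<theta> l :: real
  shows "(t - \<theta>)\<^sup>2 * l = t\<^sup>2 * l - 2 * t * (\<theta> * l) + \<theta>\<^sup>2 * l"
  by (simp add: power2_eq_square algebra_simps)

section \<open>Bayes risk and regret under a prior\<close>

locale poisson_prior = prob_space G for G :: "real measure" +
  assumes sets_G [measurable_cong, simp]: "sets G = sets borel"
    and nonneg: "AE \<theta> in G. 0 \<le> \<theta>"
begin

definition mixture :: "nat \<Rightarrow> real" where
  "mixture y = (\<integral>\<theta>. likelihood \<theta> y \<partial>G)"

definition posterior_mean :: "nat \<Rightarrow> real" where
  "posterior_mean y = real (Suc y) * mixture (Suc y) / mixture y"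

definition residual :: "nat \<Rightarrow> real" where
  "residual y = (\<integral>\<theta>. (posterior_mean y - \<theta>)\<^sup>2 * likelihood \<theta> y \<partial>G)"

lemma space_G [simp]: "space G = UNIV"
  using sets_eq_imp_space_eq[OF sets_G] by simp

lemma integrable_likelihood [simp]: "integrable G (\<lambda>\<theta>. likelihood \<theta> y)"
  by (rule integrable_const_bound[where B = 1]) (auto intro: likelihood_le_1)

lemma
  shows integrable_mult_likelihood [simp]: "integrable G (\<lambda>\<theta>. \<theta> * likelihood \<theta> y)"
    and integral_mult_likelihood: "(\<integral>\<theta>. \<theta> * likelihood \<theta> y \<partial>G) = real (Suc y) * mixture (Suc y)"
proof -
  have ae: "AE \<theta> in G. \<theta> * likelihood \<theta> y = real (Suc y) * likelihood \<theta> (Suc y)"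
    using nonneg by eventually_elim (rule mult_likelihood)
  show "integrable G (\<lambda>\<theta>. \<theta> * likelihood \<theta> y)"
    by (subst integrable_cong_AE[OF _ _ ae]) auto
  show "(\<integral>\<theta>. \<theta> * likelihood \<theta> y \<partial>G) = real (Suc y) * mixture (Suc y)"
    unfolding mixture_def by (subst integral_cong_AE[OF _ _ ae]) auto
qed

lemma
  shows integrable_sq_likelihood [simp]: "integrable G (\<lambda>\<theta>. \<theta>\<^sup>2 * likelihood \<theta> y)"
    and integral_sq_likelihood: "(\<integral>\<theta>. \<theta>\<^sup>2 * likelihood \<theta> y \<partial>G) =
      real (Suc y) * (real (Suc (Suc y)) * mixture (Suc (Suc y)))"
proof -
  have ae: "AE \<theta> in G. \<theta>\<^sup>2 * likelihood \<theta> y = real (Suc y) * (\<theta> * likelihood \<theta> (Suc y))"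
    using nonneg
  proof eventually_elim
    fix \<theta> :: real assume "0 \<le> \<theta>"
    have "\<theta>\<^sup>2 * likelihood \<theta> y = \<theta> * (\<theta> * likelihood \<theta> y)" by (simp add: power2_eq_square)
    then show "\<theta>\<^sup>2 * likelihood \<theta> y = real (Suc y) * (\<theta> * likelihood \<theta> (Suc y))"
      unfolding mult_likelihood[OF \<open>0 \<le> \<theta>\<close>, of y] by (simp only: mult.left_commute)
  qed
  show "integrable G (\<lambda>\<theta>. \<theta>\<^sup>2 * likelihood \<theta> y)"
    by (subst integrable_cong_AE[OF _ _ ae]) auto
  show "(\<integral>\<theta>. \<theta>\<^sup>2 * likelihood \<theta> y \<partial>G) =
      real (Suc y) * (real (Suc (Suc y)) * mixture (Suc (Suc y)))"
    by (subst integral_cong_AE[OF _ _ ae]) (auto simp: integral_mult_likelihood simp del: of_nat_Suc)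
qed

lemma integrable_sq_dist [simp]: "integrable G (\<lambda>\<theta>. (t - \<theta>)\<^sup>2 * likelihood \<theta> y)"
  unfolding sq_dist_expand by auto

lemma integral_sq_dist:
  "(\<integral>\<theta>. (t - \<theta>)\<^sup>2 * likelihood \<theta> y \<partial>G) =
    t\<^sup>2 * mixture y - 2 * t * (real (Suc y) * mixture (Suc y)) + (\<integral>\<theta>. \<theta>\<^sup>2 * likelihood \<theta> y \<partial>G)"
  unfolding sq_dist_expand by (simp add: integral_mult_likelihood mixture_def del: of_nat_Suc)

lemma mixture_nonneg [simp]: "0 \<le> mixture y"
  unfolding mixture_def by (rule Bochner_Integration.integral_nonneg) simp

lemma posterior_mean_nonneg [simp]: "0 \<le> posterior_mean y"
  by (simp add: posterior_mean_def)

lemma residual_nonneg [simp]: "0 \<le> residual y"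
  unfolding residual_def by (rule Bochner_Integration.integral_nonneg) simp

text \<open>
  Needed for the convention \<open>x / 0 = 0\<close>: with it, \<open>posterior_mean_mult\<close> holds in cells of mass zero as well.
\<close>

lemma mixture_Suc_eq_0:
  assumes "mixture y = 0"
  shows "mixture (Suc y) = 0"
proof -
  have "AE \<theta> in G. likelihood \<theta> y = 0"
    using assms unfolding mixture_def by (subst (asm) integral_nonneg_eq_0_iff_AE) auto
  then have "AE \<theta> in G. \<theta> * likelihood \<theta> y = 0"
    by eventually_elim simp
  then have "(\<integral>\<theta>. \<theta> * likelihood \<theta> y \<partial>G) = 0"
    by (rule integral_eq_zero_AE)
  then show ?thesis
    by (simp add: integral_mult_likelihood)
qed

lemma posterior_mean_mult: "posterior_mean y * mixture y = real (Suc y) * mixture (Suc y)"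
  using mixture_Suc_eq_0[of y] by (cases "mixture y = 0") (auto simp: posterior_mean_def)

lemma bias_variance:
  "(\<integral>\<theta>. (t - \<theta>)\<^sup>2 * likelihood \<theta> y \<partial>G) = (t - posterior_mean y)\<^sup>2 * mixture y + residual y"
  unfolding residual_def integral_sq_dist posterior_mean_mult[symmetric]
  by (simp add: power2_eq_square algebra_simps)

lemma posterior_mean_sq_le:
  "(posterior_mean y)\<^sup>2 * mixture y \<le> (\<integral>\<theta>. \<theta>\<^sup>2 * likelihood \<theta> y \<partial>G)"
  using bias_variance[of 0 y] by simp

lemma nn_integral_mixture: "(\<integral>\<^sup>+\<theta>. ennreal (likelihood \<theta> y) \<partial>G) = ennreal (mixture y)"
  unfolding mixture_def by (rule nn_integral_eq_integral) auto

lemma nn_integral_sq_dist: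
  "(\<integral>\<^sup>+\<theta>. ennreal ((t - \<theta>)\<^sup>2 * likelihood \<theta> y) \<partial>G)
    = ennreal ((t - posterior_mean y)\<^sup>2 * mixture y) + ennreal (residual y)"
  by (subst nn_integral_eq_integral) (auto simp: bias_variance simp flip: ennreal_plus)

lemma mixture_total: "(\<integral>\<^sup>+y. ennreal (mixture y) \<partial>count_space UNIV) = 1"
proof -
  have "(\<integral>\<^sup>+y. ennreal (mixture y) \<partial>count_space UNIV)
      = (\<integral>\<^sup>+\<theta>. \<integral>\<^sup>+y. ennreal (likelihood \<theta> y) \<partial>count_space UNIV \<partial>G)"
    unfolding nn_integral_mixture[symmetric]
    by (rule nn_integral_count_space_nn_integral[symmetric]) auto
  also have "\<dots> = 1" by (simp add: nn_integral_likelihood emeasure_space_1[simplified])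
  finally show ?thesis .
qed

text \<open>
  The pointwise decomposition \<open>nn_integral_sq_dist\<close> is minimized in all cells simultaneously by the posterior mean.
\<close>

lemma mmse_eq: "mmse G = (\<integral>\<^sup>+y. ennreal (residual y) \<partial>count_space UNIV)"
proof -
  have loss: "(\<integral>\<^sup>+(\<theta>, y). ennreal ((T y - \<theta>)\<^sup>2) \<partial>single_law G)
    = (\<integral>\<^sup>+y. ennreal ((T y - posterior_mean y)\<^sup>2 * mixture y) + ennreal (residual y) \<partial>count_space UNIV)"
    for T :: "nat \<Rightarrow> real"
  proof -
    have Poi: "Poi \<in> G \<rightarrow>\<^sub>M prob_algebra (count_space UNIV)"
      using measurable_Poi by simp
    have "(\<integral>\<^sup>+(\<theta>, y). ennreal ((T y - \<theta>)\<^sup>2) \<partial>single_law G)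
        = (\<integral>\<^sup>+\<theta>. \<integral>\<^sup>+y. ennreal ((T y - \<theta>)\<^sup>2) \<partial>Poi \<theta> \<partial>G)"
      unfolding single_law_def by (subst nn_integral_joint_law[OF Poi]) auto
    also have "\<dots> = (\<integral>\<^sup>+\<theta>. \<integral>\<^sup>+y. ennreal ((T y - \<theta>)\<^sup>2 * likelihood \<theta> y) \<partial>count_space UNIV \<partial>G)"
      by (simp add: nn_integral_Poi ennreal_mult mult.commute)
    also have "\<dots> = (\<integral>\<^sup>+y. \<integral>\<^sup>+\<theta>. ennreal ((T y - \<theta>)\<^sup>2 * likelihood \<theta> y) \<partial>G \<partial>count_space UNIV)"
      by (rule nn_integral_count_space_nn_integral) auto
    finally show ?thesis by (simp add: nn_integral_sq_dist)
  qed
  show ?thesis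
    unfolding mmse_def
  proof (rule antisym)
    show "(INF T \<in> count_space UNIV \<rightarrow>\<^sub>M borel. \<integral>\<^sup>+(\<theta>, y). ennreal ((T y - \<theta>)\<^sup>2) \<partial>single_law G)
        \<le> (\<integral>\<^sup>+y. ennreal (residual y) \<partial>count_space UNIV)"
      by (rule INF_lower2[of posterior_mean]) (auto simp: loss)
    show "(\<integral>\<^sup>+y. ennreal (residual y) \<partial>count_space UNIV) \<le>
        (INF T \<in> count_space UNIV \<rightarrow>\<^sub>M borel. \<integral>\<^sup>+(\<theta>, y). ennreal ((T y - \<theta>)\<^sup>2) \<partial>single_law G)"
      unfolding loss by (intro INF_greatest nn_integral_mono) auto
  qed
qed

definition regret :: "nat \<Rightarrow> ((nat \<Rightarrow> nat) \<Rightarrow> (nat \<Rightarrow> real)) \<Rightarrow> ennreal" where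
  "regret n T = (\<Sum>j<n. \<integral>\<^sup>+Y. ennreal ((T Y j - posterior_mean (Y j))\<^sup>2 * (\<Prod>i<n. mixture (Y i))) \<partial>obs_space n)"

text \<open>
  The coordinate \<open>\<theta>\<^sub>j\<close> meets the data only through the factor of \<open>Y\<^sub>j\<close>, so integrating out \<open>\<theta>\<close> leaves the product of
  the marginal masses, with the factor of \<open>Y\<^sub>j\<close> replaced by a conditional squared error. Its
  residual part integrates to the Bayes risk, since the remaining factors have total mass 1. The identity
  is one in \<open>[0, \<infinity>]\<close> and covers estimators of infinite risk.
\<close>

lemma risk_eq:
  assumes T: "T \<in> estimators n"
  shows "risk n G T = of_nat n * mmse G + regret n T"
proof -
  note [measurable] = T[unfolded estimators_def]
  let ?c = "count_space (PiE {..<n} (\<lambda>_. UNIV :: nat set))"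
  interpret P: product_prob_space "\<lambda>_. G" "{..<n}"
    by (intro product_prob_spaceI prob_space_axioms)
  have K: "(\<lambda>\<theta>. PiM {..<n} (\<lambda>i. Poi (\<theta> i))) \<in> PiM {..<n} (\<lambda>_. G) \<rightarrow>\<^sub>M prob_algebra (obs_space n)"
    using measurable_PiM_Poi by (simp cong: measurable_cong_sets sets_PiM_cong)
  have sq: "ennreal ((L2_set (\<lambda>i. T Y i - \<theta> i) {..<n})\<^sup>2) = (\<Sum>j<n. ennreal ((T Y j - \<theta> j)\<^sup>2))" for Y \<theta>
    by (simp add: L2_set_def sum_nonneg sum_ennreal)
  have meas [measurable]: "(\<lambda>x. T (snd x) j - fst x j) \<in> borel_measurable (PiM {..<n} (\<lambda>_. G) \<Otimes>\<^sub>M obs_space n)"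
    if [simp]: "j < n" for j
  proof -
    have [measurable]: "(\<lambda>Y. T Y j) \<in> borel_measurable (obs_space n)"
      by (rule measurable_compose[OF _ measurable_component_singleton]) (auto intro: T[unfolded estimators_def])
    show ?thesis by measurable
  qed
  have coord: "(\<integral>\<^sup>+\<theta>. \<integral>\<^sup>+Y. ennreal ((T Y j - \<theta> j)\<^sup>2) \<partial>PiM {..<n} (\<lambda>i. Poi (\<theta> i)) \<partial>PiM {..<n} (\<lambda>_. G))
      = mmse G + (\<integral>\<^sup>+Y. ennreal ((T Y j - posterior_mean (Y j))\<^sup>2 * (\<Prod>i<n. mixture (Y i))) \<partial>obs_space n)"
    if j: "j < n" for j
  proof -
    have "j \<in> {..<n}" using j by simp
    note split_j = prod.remove[OF finite_lessThan this]
    have "(\<integral>\<^sup>+\<theta>. \<integral>\<^sup>+Y. ennreal ((T Y j - \<theta> j)\<^sup>2) \<partial>PiM {..<n} (\<lambda>i. Poi (\<theta> i)) \<partial>PiM {..<n} (\<lambda>_. G))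
      = (\<integral>\<^sup>+\<theta>. \<integral>\<^sup>+Y. (\<Prod>i<n. ennreal ((if i = j then (T Y j - \<theta> i)\<^sup>2 else 1) * likelihood (\<theta> i) (Y i)))
            \<partial>?c \<partial>PiM {..<n} (\<lambda>_. G))"
      unfolding nn_integral_PiM_Poi obs_space_eq_count_space
      using j by (intro nn_integral_cong)
         (simp add: prod_ennreal prod.distrib prod.delta prod_nonneg ennreal_mult' mult.commute)
    also have "\<dots> = (\<integral>\<^sup>+Y. \<integral>\<^sup>+\<theta>. (\<Prod>i<n. ennreal ((if i = j then (T Y j - \<theta> i)\<^sup>2 else 1) * likelihood (\<theta> i) (Y i)))
            \<partial>PiM {..<n} (\<lambda>_. G) \<partial>?c)"
      by (rule nn_integral_count_space_nn_integral[OF countable_obs]) measurable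
    also have "\<dots> = (\<integral>\<^sup>+Y. (\<Prod>i<n. \<integral>\<^sup>+\<theta>. ennreal ((if i = j then (T Y j - \<theta>)\<^sup>2 else 1) * likelihood \<theta> (Y i)) \<partial>G) \<partial>?c)"
      by (intro nn_integral_cong P.product_nn_integral_prod) auto
    also have "\<dots> = (\<integral>\<^sup>+Y. (\<Prod>i<n. ennreal (if i = j then residual (Y i) else mixture (Y i)))
        + ennreal ((T Y j - posterior_mean (Y j))\<^sup>2 * (\<Prod>i<n. mixture (Y i))) \<partial>?c)"
      by (intro nn_integral_cong)
         (simp add: split_j nn_integral_sq_dist nn_integral_mixture prod_ennreal prod_nonneg distrib_right
           add.commute mult.assoc flip: ennreal_mult' ennreal_mult'')
    also have "\<dots> = (\<integral>\<^sup>+Y. (\<Prod>i<n. ennreal (if i = j then residual (Y i) else mixture (Y i))) \<partial>obs_space n)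
        + (\<integral>\<^sup>+Y. ennreal ((T Y j - posterior_mean (Y j))\<^sup>2 * (\<Prod>i<n. mixture (Y i))) \<partial>obs_space n)"
      unfolding obs_space_eq_count_space by (rule nn_integral_add) auto
    also have "(\<integral>\<^sup>+Y. (\<Prod>i<n. ennreal (if i = j then residual (Y i) else mixture (Y i))) \<partial>obs_space n) = mmse G"
      unfolding nn_integral_obs_prod[where g = "\<lambda>i y. ennreal (if i = j then residual y else mixture y)"]
      by (simp add: split_j mixture_total mmse_eq)
    finally show ?thesis .
  qed
  have "risk n G T = (\<integral>\<^sup>+\<theta>. \<integral>\<^sup>+Y. (\<Sum>j<n. ennreal ((T Y j - \<theta> j)\<^sup>2)) \<partial>PiM {..<n} (\<lambda>i. Poi (\<theta> i)) \<partial>PiM {..<n} (\<lambda>_. G))"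
    unfolding risk_def sample_law_def sq
    by (subst nn_integral_joint_law[OF K]) (auto simp: case_prod_beta)
  also have "\<dots> = (\<Sum>j<n. \<integral>\<^sup>+\<theta>. \<integral>\<^sup>+Y. ennreal ((T Y j - \<theta> j)\<^sup>2) \<partial>PiM {..<n} (\<lambda>i. Poi (\<theta> i)) \<partial>PiM {..<n} (\<lambda>_. G))"
  proof -
    have 1: "(\<integral>\<^sup>+Y. (\<Sum>j<n. ennreal ((T Y j - \<theta> j)\<^sup>2)) \<partial>PiM {..<n} (\<lambda>i. Poi (\<theta> i)))
      = (\<Sum>j<n. \<integral>\<^sup>+Y. ennreal ((T Y j - \<theta> j)\<^sup>2) \<partial>PiM {..<n} (\<lambda>i. Poi (\<theta> i)))" for \<theta>
      unfolding nn_integral_PiM_Poi obs_space_eq_count_space sum_distrib_left by (rule nn_integral_sum) auto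
    have 2: "(\<lambda>\<theta>. \<integral>\<^sup>+Y. ennreal ((T Y j - \<theta> j)\<^sup>2) \<partial>PiM {..<n} (\<lambda>i. Poi (\<theta> i)))
        \<in> borel_measurable (PiM {..<n} (\<lambda>_. G))" if "j < n" for j
    proof (rule nn_integral_measurable_subprob_algebra2)
      show "(\<lambda>\<theta>. PiM {..<n} (\<lambda>i. Poi (\<theta> i))) \<in> PiM {..<n} (\<lambda>_. G) \<rightarrow>\<^sub>M subprob_algebra (obs_space n)"
        by (rule measurable_prob_algebraD[OF K])
      show "(\<lambda>(\<theta>, Y). ennreal ((T Y j - \<theta> j)\<^sup>2)) \<in> borel_measurable (PiM {..<n} (\<lambda>_. G) \<Otimes>\<^sub>M obs_space n)"
        using meas[OF that] by (simp add: case_prod_beta)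
    qed
    show ?thesis
      unfolding 1 by (rule nn_integral_sum) (use 2 in auto)
  qed
  also have "\<dots> = of_nat n * mmse G + regret n T"
    by (simp add: coord regret_def sum.distrib)
  finally show ?thesis .
qed

lemma mmse_le_second_moment: "mmse G \<le> (\<integral>\<^sup>+\<theta>. ennreal (\<theta>\<^sup>2) \<partial>G)"
proof -
  have "residual y \<le> (\<integral>\<theta>. \<theta>\<^sup>2 * likelihood \<theta> y \<partial>G)" for y
    using bias_variance[of 0 y] by simp
  then have "mmse G \<le> (\<integral>\<^sup>+y. ennreal (\<integral>\<theta>. \<theta>\<^sup>2 * likelihood \<theta> y \<partial>G) \<partial>count_space UNIV)"
    unfolding mmse_eq by (intro nn_integral_mono ennreal_leI)
  also have "\<dots> = (\<integral>\<^sup>+y. \<integral>\<^sup>+\<theta>. ennreal (\<theta>\<^sup>2) * ennreal (likelihood \<theta> y) \<partial>G \<partial>count_space UNIV)"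
    by (intro nn_integral_cong, subst nn_integral_eq_integral[symmetric]) (auto simp: ennreal_mult)
  also have "\<dots> = (\<integral>\<^sup>+\<theta>. \<integral>\<^sup>+y. ennreal (\<theta>\<^sup>2) * ennreal (likelihood \<theta> y) \<partial>count_space UNIV \<partial>G)"
    by (rule nn_integral_count_space_nn_integral[symmetric]) auto
  also have "\<dots> = (\<integral>\<^sup>+\<theta>. ennreal (\<theta>\<^sup>2) \<partial>G)"
    by (simp add: nn_integral_cmult nn_integral_likelihood)
  finally show ?thesis .
qed

lemma excess_risk:
  assumes "T \<in> estimators n" "mmse G < \<top>"
  shows "enn2ereal (risk n G T) - ereal (real n) * enn2ereal (mmse G) = enn2ereal (regret n T)"
proof -
  obtain c where c: "mmse G = ennreal c" "0 \<le> c"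
    using assms(2) by (cases "mmse G") auto
  have "of_nat n * mmse G = ennreal (real n * c)"
    using c by (simp add: ennreal_mult ennreal_of_nat_eq_real_of_nat)
  then have "enn2ereal (risk n G T) = ereal (real n * c) + enn2ereal (regret n T)"
    using c unfolding risk_eq[OF assms(1)] by (simp add: plus_ennreal.rep_eq)
  then show ?thesis
    using c by (cases "enn2ereal (regret n T)") auto
qed

end

lemma max_regret_le:
  assumes T: "T \<in> estimators n"
    and prior: "\<And>G. G \<in> \<G> \<Longrightarrow> poisson_prior G" "\<And>G. G \<in> \<G> \<Longrightarrow> mmse G < \<top>"
    and le: "\<And>G. G \<in> \<G> \<Longrightarrow> poisson_prior.regret G n T \<le> ennreal c" and "0 \<le> c"
  shows "max_regret n \<G> T \<le> ereal c"
  unfolding max_regret_def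
proof (rule SUP_least)
  fix G assume G: "G \<in> \<G>"
  interpret poisson_prior G by (rule prior(1)[OF G])
  have "enn2ereal (regret n T) \<le> enn2ereal (ennreal c)"
    using le[OF G] by (simp add: less_eq_ennreal.rep_eq)
  then show "enn2ereal (risk n G T) - ereal (real n) * enn2ereal (mmse G) \<le> ereal c"
    unfolding excess_risk[OF T prior(2)[OF G]] using \<open>0 \<le> c\<close> by simp
qed

lemma TotRegret_le_robbins: "TotRegret n \<G> \<le> max_regret n \<G> (robbins n)"
  unfolding TotRegret_def by (rule INF_lower[OF robbins_in_estimators])

section \<open>Moments of trinomial counts\<close>

text \<open>
  The expectation of \<open>1 / (M + 1)\<^sup>2\<close> for a binomial \<open>M\<close> has no closed form, but those of
  \<open>1 / ((M + 1) (M + 2))\<close> and \<open>1 / ((M + 1) (M + 2) (M + 3))\<close> nearly do. The first bound is crude; the second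
  has the sharp leading term, which must cancel in \<open>trinomial_ratio\<close>.
\<close>

lemma inverse_square_le:
  fixes x :: real assumes "1 \<le> x"
  shows "1 / x\<^sup>2 \<le> 2 * (1 / (x * (x + 1)))"
    and "1 / x\<^sup>2 \<le> 1 / (x * (x + 1)) + 3 * (1 / (x * (x + 1) * (x + 2)))"
proof -
  have eq: "1 / x\<^sup>2 - 1 / (x * (x + 1)) = 1 / (x\<^sup>2 * (x + 1))"
    using assms by (simp add: divide_simps power2_eq_square)
  have "1 / (x\<^sup>2 * (x + 1)) \<le> 1 / (x * (x + 1))"
    using assms by (intro divide_left_mono) (auto simp: power2_eq_square)
  with eq show "1 / x\<^sup>2 \<le> 2 * (1 / (x * (x + 1)))" by linarith
  have "1 / (x\<^sup>2 * (x + 1)) \<le> 3 / (x * (x + 1) * (x + 2))"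
    using assms by (simp add: divide_simps power2_eq_square)
  with eq show "1 / x\<^sup>2 \<le> 1 / (x * (x + 1)) + 3 * (1 / (x * (x + 1) * (x + 2)))" by simp
qed

text \<open>
  The expectation of \<open>\<psi> M N\<close> when \<open>m\<close> independent trials fall into a first class with probability
  \<open>p\<close> and into a second with probability \<open>q\<close>, and \<open>M\<close> and \<open>N\<close> count them. The recursion conditions on the last trial.
\<close>

primrec trinomial_expectation :: "real \<Rightarrow> real \<Rightarrow> nat \<Rightarrow> (nat \<Rightarrow> nat \<Rightarrow> real) \<Rightarrow> real" where
  "trinomial_expectation p q 0 \<psi> = \<psi> 0 0"
| "trinomial_expectation p q (Suc m) \<psi> =
     p * trinomial_expectation p q m (\<lambda>a b. \<psi> (Suc a) b)
     + q * trinomial_expectation p q m (\<lambda>a b. \<psi> a (Suc b))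
     + (1 - p - q) * trinomial_expectation p q m \<psi>"

context
  fixes p q :: real
begin

abbreviation "avg \<equiv> trinomial_expectation p q"

lemma trinomial_add: "avg m (\<lambda>a b. \<phi> a b + \<psi> a b) = avg m \<phi> + avg m \<psi>"
  by (induction m arbitrary: \<phi> \<psi>) (simp_all add: algebra_simps)

lemma trinomial_cmult: "avg m (\<lambda>a b. c * \<psi> a b) = c * avg m \<psi>"
  by (induction m arbitrary: \<psi>) (simp_all add: algebra_simps)

lemma trinomial_const: "avg m (\<lambda>a b. c) = c"
  by (induction m) (simp_all add: algebra_simps)

text \<open>
  Size biasing: weighting by the number of trials in a class amounts to fixing one trial in this class,
  chosen in \<open>m\<close> ways. All moments below come from this rule and its analogue for the second class.
\<close>

lemma trinomial_mult_fst:
  "avg (Suc m) (\<lambda>a b. real a * \<psi> a b) = real (Suc m) * p * avg m (\<lambda>a b. \<psi> (Suc a) b)"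
proof (induction m arbitrary: \<psi>)
  case (Suc m)
  have "avg (Suc m) (\<lambda>a b. real (Suc a) * \<psi> (Suc a) b)
      = avg (Suc m) (\<lambda>a b. real a * \<psi> (Suc a) b) + avg (Suc m) (\<lambda>a b. \<psi> (Suc a) b)"
    unfolding trinomial_add[symmetric] by (simp only: of_nat_Suc distrib_right mult_1 add.commute)
  then have "avg (Suc (Suc m)) (\<lambda>a b. real a * \<psi> a b)
      = (1 + real (Suc m)) * p * avg (Suc m) (\<lambda>a b. \<psi> (Suc a) b)"
    unfolding trinomial_expectation.simps(2)[of p q "Suc m"] Suc.IH
      trinomial_expectation.simps(2)[of p q m "\<lambda>a b. \<psi> (Suc a) b"] by algebra
  then show ?case by (simp only: of_nat_Suc)
qed simp

lemma trinomial_mult_snd: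
  "avg (Suc m) (\<lambda>a b. real b * \<psi> a b) = real (Suc m) * q * avg m (\<lambda>a b. \<psi> a (Suc b))"
proof (induction m arbitrary: \<psi>)
  case (Suc m)
  have "avg (Suc m) (\<lambda>a b. real (Suc b) * \<psi> a (Suc b))
      = avg (Suc m) (\<lambda>a b. real b * \<psi> a (Suc b)) + avg (Suc m) (\<lambda>a b. \<psi> a (Suc b))"
    unfolding trinomial_add[symmetric] by (simp only: of_nat_Suc distrib_right mult_1 add.commute)
  then have "avg (Suc (Suc m)) (\<lambda>a b. real b * \<psi> a b)
      = (1 + real (Suc m)) * q * avg (Suc m) (\<lambda>a b. \<psi> a (Suc b))"
    unfolding trinomial_expectation.simps(2)[of p q "Suc m"] Suc.IH
      trinomial_expectation.simps(2)[of p q m "\<lambda>a b. \<psi> a (Suc b)"] by algebra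
  then show ?case by (simp only: of_nat_Suc)
qed simp

lemma trinomial_fst_eq_0: "avg m (\<lambda>a b. if a = 0 then 1 else 0) = (1 - p) ^ m"
proof (induction m)
  case (Suc m)
  have "avg m (\<lambda>a b. 0) = 0" by (rule trinomial_const)
  with Suc show ?case by (simp add: algebra_simps)
qed simp

declare trinomial_expectation.simps(2) [simp del]

context
  assumes pq: "0 \<le> p" "0 \<le> q" "p + q \<le> 1"
begin

lemma trinomial_mono:
  assumes "\<And>a b. \<phi> a b \<le> \<psi> a b"
  shows "avg m \<phi> \<le> avg m \<psi>"
  using assms
proof (induction m arbitrary: \<phi> \<psi>)
  case (Suc m)
  then show ?case
    unfolding trinomial_expectation.simps(2) using pq by (auto intro!: add_mono mult_left_mono)
qed simp

lemma trinomial_nonneg: "(\<And>a b. 0 \<le> \<psi> a b) \<Longrightarrow> 0 \<le> avg m \<psi>"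
  using trinomial_mono[of "\<lambda>_ _. 0" \<psi> m] by (simp add: trinomial_const)

lemma trinomial_inverse:
  "real (Suc m) * p * avg m (\<lambda>a b. 1 / real (Suc a)) = 1 - (1 - p) ^ Suc m"
proof -
  have "real (Suc m) * p * avg m (\<lambda>a b. 1 / real (Suc a))
      = avg (Suc m) (\<lambda>a b. 1 + (- 1) * (if a = 0 then 1 else 0))"
    by (subst trinomial_mult_fst[symmetric])
       (rule arg_cong[where f = "avg (Suc m)"], auto simp: fun_eq_iff)
  also have "\<dots> = 1 - (1 - p) ^ Suc m"
    unfolding trinomial_add trinomial_cmult trinomial_const trinomial_fst_eq_0 by simp
  finally show ?thesis .
qed

lemma trinomial_inverse2:
  "real (Suc m) * real (Suc (Suc m)) * p\<^sup>2 * avg m (\<lambda>a b. 1 / (real (Suc a) * real (Suc (Suc a)))) \<le> 1"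
proof -
  have "real (Suc m) * p * avg m (\<lambda>a b. 1 / (real (Suc a) * real (Suc (Suc a))))
      = avg (Suc m) (\<lambda>a b. real a * (1 / (real a * real (Suc a))))"
    by (rule trinomial_mult_fst[symmetric])
  also have "\<dots> \<le> avg (Suc m) (\<lambda>a b. 1 / real (Suc a))"
    by (rule trinomial_mono) (auto simp: field_simps)
  finally have "real (Suc (Suc m)) * p * (real (Suc m) * p * avg m (\<lambda>a b. 1 / (real (Suc a) * real (Suc (Suc a)))))
      \<le> real (Suc (Suc m)) * p * avg (Suc m) (\<lambda>a b. 1 / real (Suc a))"
    using pq by (intro mult_left_mono) auto
  also have "\<dots> \<le> 1"
    unfolding trinomial_inverse using pq by simp
  finally show ?thesis
    by (simp add: power2_eq_square mult_ac)
qed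

lemma trinomial_inverse3:
  "real (Suc m) * real (Suc (Suc m)) * real (Suc (Suc (Suc m))) * p ^ 3
     * avg m (\<lambda>a b. 1 / (real (Suc a) * real (Suc (Suc a)) * real (Suc (Suc (Suc a))))) \<le> 1"
proof -
  have "real (Suc m) * p * avg m (\<lambda>a b. 1 / (real (Suc a) * real (Suc (Suc a)) * real (Suc (Suc (Suc a)))))
      = avg (Suc m) (\<lambda>a b. real a * (1 / (real a * real (Suc a) * real (Suc (Suc a)))))"
    by (rule trinomial_mult_fst[symmetric])
  also have "\<dots> \<le> avg (Suc m) (\<lambda>a b. 1 / (real (Suc a) * real (Suc (Suc a))))"
    by (rule trinomial_mono) auto
  finally have "real (Suc (Suc m)) * real (Suc (Suc (Suc m))) * p\<^sup>2
       * (real (Suc m) * p * avg m (\<lambda>a b. 1 / (real (Suc a) * real (Suc (Suc a)) * real (Suc (Suc (Suc a))))))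
      \<le> real (Suc (Suc m)) * real (Suc (Suc (Suc m))) * p\<^sup>2
       * avg (Suc m) (\<lambda>a b. 1 / (real (Suc a) * real (Suc (Suc a))))"
    using pq by (intro mult_left_mono) auto
  also have "\<dots> \<le> 1"
    by (rule trinomial_inverse2)
  finally show ?thesis
    by (simp add: power2_eq_square power3_eq_cube mult_ac)
qed

lemma trinomial_inverse_square:
  assumes "0 < p"
  shows "avg m (\<lambda>a b. 1 / (real a + 1)\<^sup>2) \<le> 2 / (real (Suc m) * real (Suc (Suc m)) * p\<^sup>2)"
    and "avg m (\<lambda>a b. 1 / (real a + 1)\<^sup>2) \<le> 1 / (real (Suc m) * real (Suc (Suc m)) * p\<^sup>2)
      + 3 / (real (Suc m) * real (Suc (Suc m)) * real (Suc (Suc (Suc m))) * p ^ 3)"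
proof -
  let ?E2 = "avg m (\<lambda>a b. 1 / (real (Suc a) * real (Suc (Suc a))))"
  let ?E3 = "avg m (\<lambda>a b. 1 / (real (Suc a) * real (Suc (Suc a)) * real (Suc (Suc (Suc a)))))"
  have E2: "?E2 \<le> 1 / (real (Suc m) * real (Suc (Suc m)) * p\<^sup>2)"
    using trinomial_inverse2[of m] assms by (simp add: pos_le_divide_eq mult_ac)
  have E3: "?E3 \<le> 1 / (real (Suc m) * real (Suc (Suc m)) * real (Suc (Suc (Suc m))) * p ^ 3)"
    using trinomial_inverse3[of m] assms by (simp add: pos_le_divide_eq mult_ac)
  have "avg m (\<lambda>a b. 1 / (real a + 1)\<^sup>2) \<le> avg m (\<lambda>a b. 2 * (1 / (real (Suc a) * real (Suc (Suc a)))))"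
    using inverse_square_le(1)[of "1 + real _"] by (intro trinomial_mono) (simp add: add_ac)
  with E2 show "avg m (\<lambda>a b. 1 / (real a + 1)\<^sup>2) \<le> 2 / (real (Suc m) * real (Suc (Suc m)) * p\<^sup>2)"
    unfolding trinomial_cmult by simp
  have "avg m (\<lambda>a b. 1 / (real a + 1)\<^sup>2) \<le> avg m (\<lambda>a b. 1 / (real (Suc a) * real (Suc (Suc a)))
      + 3 * (1 / (real (Suc a) * real (Suc (Suc a)) * real (Suc (Suc (Suc a))))))"
    using inverse_square_le(2)[of "1 + real _"] by (intro trinomial_mono) (simp add: add_ac)
  with E2 E3 show "avg m (\<lambda>a b. 1 / (real a + 1)\<^sup>2) \<le> 1 / (real (Suc m) * real (Suc (Suc m)) * p\<^sup>2)
      + 3 / (real (Suc m) * real (Suc (Suc m)) * real (Suc (Suc (Suc m))) * p ^ 3)"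
    unfolding trinomial_add trinomial_cmult by simp
qed

text \<open>
  For \<open>r = q / p\<close>, expanding the square and size biasing twice in the second count leaves
  \<open>r\<^sup>2 - 2 r\<^sup>2 + r\<^sup>2 = 0\<close> as leading terms, so that only the variance of \<open>N\<close> and lower-order terms of
  size \<open>r\<^sup>2 / ((k + 3) p)\<close> remain. The error of the mean of \<open>1 / (M + 1)\<close> is controlled by
  \<open>(k + 3) p (1 - p)\<^sup>k\<^sup>+\<^sup>2\<close>, the probability of exactly one success in \<open>k + 3\<close> trials.
\<close>

lemma trinomial_ratio:
  assumes "0 < p"
  shows "real (k + 3) * p * avg (k + 2) (\<lambda>a b. (real b / (real a + 1) - q / p)\<^sup>2) \<le> 2 * (q / p) + 5 * (q / p)\<^sup>2"
proof -
  define r where "r = q / p"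
  have r: "0 \<le> r" and q: "q = r * p" using pq assms by (auto simp: r_def)
  define S1 where "S1 = avg (Suc k) (\<lambda>a b. 1 / (real a + 1)\<^sup>2)"
  define S2 where "S2 = avg k (\<lambda>a b. 1 / (real a + 1)\<^sup>2)"
  define N where "N = real (k + 3)"
  have ab: "avg (k + 2) (\<lambda>a b. real b * (1 / (real a + 1))) = r * (1 - (1 - p) ^ (k + 2))"
  proof -
    have "avg (k + 2) (\<lambda>a b. real b * (1 / (real a + 1)))
        = r * (real (Suc (Suc k)) * p * avg (Suc k) (\<lambda>a b. 1 / real (Suc a)))"
      unfolding add_2_eq_Suc' trinomial_mult_snd by (simp add: q mult_ac add.commute)
    then show ?thesis unfolding trinomial_inverse by simp
  qed
  have bb: "avg (k + 2) (\<lambda>a b. real b * (real b * (1 / (real a + 1)\<^sup>2)))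
      = real (k + 2) * q * (S1 + real (k + 1) * q * S2)"
  proof -
    have "avg (Suc k) (\<lambda>a b. real (Suc b) * (1 / (real a + 1)\<^sup>2))
        = avg (Suc k) (\<lambda>a b. real b * (1 / (real a + 1)\<^sup>2)) + S1"
      unfolding S1_def trinomial_add[symmetric] by (simp only: of_nat_Suc distrib_right mult_1 add.commute)
    also have "avg (Suc k) (\<lambda>a b. real b * (1 / (real a + 1)\<^sup>2)) = real (Suc k) * q * S2"
      unfolding trinomial_mult_snd S2_def ..
    finally show ?thesis
      unfolding add_2_eq_Suc' trinomial_mult_snd by simp
  qed
  have "avg (k + 2) (\<lambda>a b. (real b / (real a + 1) - r)\<^sup>2)
      = avg (k + 2) (\<lambda>a b. real b * (real b * (1 / (real a + 1)\<^sup>2)) + ((- 2 * r) * (real b * (1 / (real a + 1))) + r\<^sup>2))"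
    by (rule arg_cong[where f = "avg (k + 2)"]) (simp add: fun_eq_iff power2_eq_square algebra_simps)
  also have "\<dots> = real (k + 2) * q * (S1 + real (k + 1) * q * S2) - 2 * r\<^sup>2 * (1 - (1 - p) ^ (k + 2)) + r\<^sup>2"
    unfolding trinomial_add trinomial_cmult[of _ "- 2 * r"] trinomial_const ab bb
    by (simp add: power2_eq_square)
  finally have eq: "avg (k + 2) (\<lambda>a b. (real b / (real a + 1) - r)\<^sup>2)
     = real (k + 2) * q * (S1 + real (k + 1) * q * S2) - 2 * r\<^sup>2 * (1 - (1 - p) ^ (k + 2)) + r\<^sup>2" .
  have N: "N > 0" by (simp add: N_def)
  have S1: "S1 \<le> 2 / (real (k + 2) * N * p\<^sup>2)"
    using trinomial_inverse_square(1)[OF assms, of "Suc k"] by (simp add: S1_def N_def add_ac)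
  have S2: "S2 \<le> 1 / (real (k + 1) * real (k + 2) * p\<^sup>2) + 3 / (real (k + 1) * real (k + 2) * N * p ^ 3)"
    using trinomial_inverse_square(2)[OF assms, of k] by (simp add: S2_def N_def add_ac)
  have "real (k + 2) * q * (S1 + real (k + 1) * q * S2)
      \<le> real (k + 2) * q * (2 / (real (k + 2) * N * p\<^sup>2) + real (k + 1) * q *
         (1 / (real (k + 1) * real (k + 2) * p\<^sup>2) + 3 / (real (k + 1) * real (k + 2) * N * p ^ 3)))"
    using pq S1 S2 by (intro mult_left_mono add_mono) auto
  also have "\<dots> = 2 * r / (N * p) + (r\<^sup>2 + 3 * r\<^sup>2 / (N * p))"
  proof -
    have "b * (r * p) * (2 / (b * N * p\<^sup>2) + a * (r * p) * (1 / (a * b * p\<^sup>2) + 3 / (a * b * N * p ^ 3)))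
        = 2 * r / (N * p) + (r\<^sup>2 + 3 * r\<^sup>2 / (N * p))" if "0 < a" "0 < b" for a b :: real
      using that assms N by (simp add: field_simps power2_eq_square power3_eq_cube)
    from this[of "real (k + 1)" "real (k + 2)"] show ?thesis by (simp only: q)
  qed
  finally have "avg (k + 2) (\<lambda>a b. (real b / (real a + 1) - r)\<^sup>2)
     \<le> 2 * r / (N * p) + 3 * r\<^sup>2 / (N * p) + 2 * r\<^sup>2 * (1 - p) ^ (k + 2)"
    unfolding eq by (simp add: algebra_simps)
  then have "N * p * avg (k + 2) (\<lambda>a b. (real b / (real a + 1) - r)\<^sup>2)
     \<le> N * p * (2 * r / (N * p) + 3 * r\<^sup>2 / (N * p) + 2 * r\<^sup>2 * (1 - p) ^ (k + 2))"
    using assms N by (intro mult_left_mono) auto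
  also have "\<dots> = 2 * r + 3 * r\<^sup>2 + 2 * r\<^sup>2 * (N * p * (1 - p) ^ (k + 2))"
    using assms N by (simp add: field_simps)
  also have "N * p * (1 - p) ^ (k + 2) \<le> 1"
  proof -
    have "N * p * (1 - p) ^ (k + 2) = avg (Suc (k + 2)) (\<lambda>a b. real a * (if a = 1 then 1 else 0))"
      unfolding trinomial_mult_fst using trinomial_fst_eq_0[of "k + 2"] by (simp add: N_def)
    also have "\<dots> \<le> avg (Suc (k + 2)) (\<lambda>a b. 1)"
      by (rule trinomial_mono) auto
    finally show ?thesis by (simp only: trinomial_const)
  qed
  finally show ?thesis
    unfolding N_def r_def by (simp add: mult_left_mono)
qed

lemma trinomial_snd_square: "avg m (\<lambda>a b. (real b)\<^sup>2) \<le> (real m)\<^sup>2 * q"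
proof (cases m)
  case (Suc k)
  have "avg k (\<lambda>a b. real (Suc b)) \<le> real (Suc k)"
  proof (cases k)
    case (Suc l)
    have "avg (Suc l) (\<lambda>a b. real b * 1) = real (Suc l) * q"
      unfolding trinomial_mult_snd trinomial_const by simp
    moreover have "real (Suc l) * q \<le> real (Suc l) * 1"
      using pq by (intro mult_left_mono) auto
    moreover have "avg (Suc l) (\<lambda>a b. real (Suc b)) = avg (Suc l) (\<lambda>a b. real b * 1) + 1"
      using trinomial_add[of "Suc l" "\<lambda>a b. real b * 1" "\<lambda>a b. 1"] by (simp only: trinomial_const) (simp add: add_ac)
    ultimately show ?thesis unfolding Suc by simp
  qed simp
  then have "real (Suc k) * q * avg k (\<lambda>a b. real (Suc b)) \<le> real (Suc k) * q * real (Suc k)"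
    using pq by (intro mult_left_mono) auto
  then show ?thesis
    unfolding Suc power2_eq_square trinomial_mult_snd by (simp add: mult_ac)
qed simp

end

end

section \<open>Regret of the Robbins estimator\<close>

context poisson_prior
begin

lemma mixture_pair_le_1: "mixture y + mixture (Suc y) \<le> 1"
  and nn_integral_mixture_rest:
    "(\<integral>\<^sup>+z. ennreal (mixture z) * indicator (- {y, Suc y}) z \<partial>count_space UNIV)
       = ennreal (1 - mixture y - mixture (Suc y))"
proof -
  let ?rest = "\<integral>\<^sup>+z. ennreal (mixture z) * indicator (- {y, Suc y}) z \<partial>count_space UNIV"
  have "1 = (\<integral>\<^sup>+z. ennreal (mixture z) * indicator {y, Suc y} z
      + ennreal (mixture z) * indicator (- {y, Suc y}) z \<partial>count_space UNIV)"
    unfolding mixture_total[symmetric] by (intro nn_integral_cong) (auto simp: indicator_def)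
  also have "\<dots> = (\<integral>\<^sup>+z. ennreal (mixture z) * indicator {y, Suc y} z \<partial>count_space UNIV) + ?rest"
    by (rule nn_integral_add) auto
  also have "(\<integral>\<^sup>+z. ennreal (mixture z) * indicator {y, Suc y} z \<partial>count_space UNIV)
      = ennreal (mixture y + mixture (Suc y))"
    by (simp add: nn_integral_count_space_finite nn_integral_count_space_indicator[symmetric] ennreal_plus)
  finally have eq: "1 = ennreal (mixture y + mixture (Suc y)) + ?rest" .
  then have "ennreal (mixture y + mixture (Suc y)) \<le> 1"
    by (metis le_iff_add)
  then show le: "mixture y + mixture (Suc y) \<le> 1"
    by (simp del: ennreal_plus)
  have "?rest = 1 - ennreal (mixture y + mixture (Suc y))"
    by (metis eq ennreal_add_diff_cancel_left ennreal_neq_top)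
  also have "\<dots> = ennreal (1 - (mixture y + mixture (Suc y)))"
    by (subst ennreal_1[symmetric], subst ennreal_minus) (auto simp: add_nonneg_nonneg)
  finally show "?rest = ennreal (1 - mixture y - mixture (Suc y))"
    by (simp add: algebra_simps)
qed

lemma mixture_le_1: "mixture y \<le> 1"
  using mixture_pair_le_1[of y] mixture_nonneg[of "Suc y"] by linarith

abbreviation "counts_expectation y \<equiv> trinomial_expectation (mixture y) (mixture (Suc y))"

lemma counts_nonneg: "(\<And>a b. 0 \<le> \<psi> a b) \<Longrightarrow> 0 \<le> counts_expectation y m \<psi>"
  by (rule trinomial_nonneg) (auto simp: mixture_pair_le_1)

text \<open>
  Adding one observation to \<open>J\<close> raises the first count, the second count or neither, exactly as in the
  recursion of \<open>trinomial_expectation\<close>.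
\<close>

lemma nn_integral_counts:
  assumes "finite J" "\<And>a b. 0 \<le> \<psi> a b"
  shows "(\<integral>\<^sup>+X. ennreal (\<psi> (card {i\<in>J. X i = y}) (card {i\<in>J. X i = Suc y})) * (\<Prod>i\<in>J. ennreal (mixture (X i)))
      \<partial>PiM J (\<lambda>_. count_space UNIV)) = ennreal (counts_expectation y (card J) \<psi>)"
  using assms
proof (induction J arbitrary: \<psi> rule: finite_induct)
  case empty
  then show ?case by (simp add: PiM_empty nn_integral_count_space_finite)
next
  case (insert i J)
  interpret product_sigma_finite "\<lambda>_. count_space (UNIV :: nat set)"
    by (intro product_sigma_finite.intro sigma_finite_measure_count_space)
  let ?m = "card J"
  let ?F = "\<lambda>z a b. \<psi> (a + (if z = y then 1 else 0)) (b + (if z = Suc y then 1 else 0))"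
  let ?c = "\<lambda>J X v. card {i\<in>J. X i = (v::nat)}"
  have meas: "f \<in> borel_measurable (PiM I (\<lambda>_. count_space (UNIV :: nat set)))" if "finite I" for I and f :: "_ \<Rightarrow> ennreal"
    using that by (simp add: count_space_PiM_finite)
  have c: "?c (insert i J) (X(i := z)) v = ?c J X v + (if z = v then 1 else 0)" for X z v
  proof -
    have "{k \<in> insert i J. (X(i := z)) k = v} = (if z = v then insert i {k\<in>J. X k = v} else {k\<in>J. X k = v})"
      using insert.hyps by auto
    then show ?thesis using insert.hyps by simp
  qed
  have pr: "(\<Prod>k\<in>insert i J. ennreal (mixture ((X(i := z)) k))) = ennreal (mixture z) * (\<Prod>k\<in>J. ennreal (mixture (X k)))" for X z
    using insert.hyps by (simp add: prod.insert) (auto intro!: arg_cong2[where f = "(*)"] prod.cong)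
  have IH: "(\<integral>\<^sup>+X. ennreal (?F z (?c J X y) (?c J X (Suc y))) * (\<Prod>i\<in>J. ennreal (mixture (X i)))
      \<partial>PiM J (\<lambda>_. count_space UNIV)) = ennreal (counts_expectation y ?m (?F z))" for z
    by (rule insert.IH) (rule insert.prems)
  have "(\<integral>\<^sup>+X. ennreal (\<psi> (?c (insert i J) X y) (?c (insert i J) X (Suc y))) * (\<Prod>i\<in>insert i J. ennreal (mixture (X i)))
      \<partial>PiM (insert i J) (\<lambda>_. count_space UNIV))
    = (\<integral>\<^sup>+z. \<integral>\<^sup>+X. ennreal (mixture z) * (ennreal (?F z (?c J X y) (?c J X (Suc y))) * (\<Prod>i\<in>J. ennreal (mixture (X i))))
      \<partial>PiM J (\<lambda>_. count_space UNIV) \<partial>count_space UNIV)"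
    unfolding product_nn_integral_insert_rev[OF insert.hyps(1,2) meas[OF finite.insertI[OF insert.hyps(1)]]] c pr
    by (intro nn_integral_cong) (simp only: mult_ac)
  also have "\<dots> = (\<integral>\<^sup>+z. ennreal (mixture z) * ennreal (counts_expectation y ?m (?F z)) \<partial>count_space UNIV)"
    using insert.prems by (intro nn_integral_cong, subst nn_integral_cmult)
      (auto simp only: meas insert.hyps IH)
  also have "\<dots> = (\<integral>\<^sup>+z. ennreal (mixture y * counts_expectation y ?m (\<lambda>a b. \<psi> (Suc a) b)) * indicator {y} z
      + (ennreal (mixture (Suc y) * counts_expectation y ?m (\<lambda>a b. \<psi> a (Suc b))) * indicator {Suc y} z
      + ennreal (counts_expectation y ?m \<psi>) * (ennreal (mixture z) * indicator (- {y, Suc y}) z)) \<partial>count_space UNIV)"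
    using insert.prems by (intro nn_integral_cong)
      (auto simp: indicator_def ennreal_mult counts_nonneg mult.commute)
  also have "\<dots> = ennreal (mixture y * counts_expectation y ?m (\<lambda>a b. \<psi> (Suc a) b))
      + (ennreal (mixture (Suc y) * counts_expectation y ?m (\<lambda>a b. \<psi> a (Suc b)))
      + ennreal (counts_expectation y ?m \<psi>) * ennreal (1 - mixture y - mixture (Suc y)))"
    by (simp add: nn_integral_add nn_integral_cmult nn_integral_mixture_rest)
  also have "\<dots> = ennreal (counts_expectation y (Suc ?m) \<psi>)"
    using insert.prems mixture_pair_le_1[of y]
    by (simp add: trinomial_expectation.simps(2) counts_nonneg ennreal_plus ennreal_mult mult.commute add.assoc)
  finally show ?case
    using insert.hyps by simp
qed

text \<open>
  The squared error of the Robbins estimator at an observation \<open>y\<close>, as a function of how often \<open>y\<close> and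
  \<open>y + 1\<close> occur among the other observations; the observation itself accounts for the \<open>+ 1\<close>.
\<close>

definition robbins_loss :: "nat \<Rightarrow> nat \<Rightarrow> nat \<Rightarrow> real" where
  "robbins_loss y a b = (real (Suc y) * real b / (real a + 1) - posterior_mean y)\<^sup>2"

lemma robbins_loss_nonneg [simp]: "0 \<le> robbins_loss y a b"
  by (simp add: robbins_loss_def)

lemma regret_robbins_eq:
  "regret n (robbins n)
    = (\<integral>\<^sup>+y. ennreal (real n * (mixture y * counts_expectation y (n - 1) (robbins_loss y))) \<partial>count_space UNIV)"
proof -
  interpret product_sigma_finite "\<lambda>_. count_space (UNIV :: nat set)"
    by (intro product_sigma_finite.intro sigma_finite_measure_count_space)
  have meas: "f \<in> borel_measurable (PiM I (\<lambda>_. count_space (UNIV :: nat set)))"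
    if "finite I" for I :: "nat set" and f :: "_ \<Rightarrow> ennreal"
    using that by (simp add: count_space_PiM_finite)
  have coord: "(\<integral>\<^sup>+Y. ennreal ((robbins n Y j - posterior_mean (Y j))\<^sup>2 * (\<Prod>i<n. mixture (Y i))) \<partial>obs_space n)
      = (\<integral>\<^sup>+y. ennreal (mixture y * counts_expectation y (n - 1) (robbins_loss y)) \<partial>count_space UNIV)"
    if j: "j < n" for j
  proof -
    define J where "J = {..<n} - {j}"
    have J: "{..<n} = insert j J" "j \<notin> J" "finite J" "card J = n - 1"
      using j by (auto simp: J_def)
    have occ: "occurrences n (X(j := y)) v = card {i\<in>J. X i = v} + (if v = y then 1 else 0)" for X y v
    proof -
      have "{i \<in> {..<n}. (X(j := y)) i = v} = (if v = y then insert j {i\<in>J. X i = v} else {i\<in>J. X i = v})"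
        using J(2) unfolding J(1) by auto
      then show ?thesis unfolding occurrences_def using J by simp
    qed
    have loss: "(robbins n (X(j := y)) j - posterior_mean ((X(j := y)) j))\<^sup>2
        = robbins_loss y (card {i\<in>J. X i = y}) (card {i\<in>J. X i = Suc y})" for X y
      using j by (simp add: robbins_def occ robbins_loss_def add_ac)
    have pr: "(\<Prod>i<n. mixture ((X(j := y)) i)) = mixture y * (\<Prod>i\<in>J. mixture (X i))" for X y
      unfolding J(1) using J(2,3) by (auto intro!: arg_cong2[where f = "(*)"] prod.cong)
    have "(\<integral>\<^sup>+Y. ennreal ((robbins n Y j - posterior_mean (Y j))\<^sup>2 * (\<Prod>i<n. mixture (Y i))) \<partial>obs_space n)
      = (\<integral>\<^sup>+y. \<integral>\<^sup>+X. ennreal ((robbins n (X(j := y)) j - posterior_mean ((X(j := y)) j))\<^sup>2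
            * (\<Prod>i<n. mixture ((X(j := y)) i))) \<partial>PiM J (\<lambda>_. count_space UNIV) \<partial>count_space UNIV)"
      unfolding J(1) by (rule product_nn_integral_insert_rev[OF J(3,2) meas]) (simp add: J)
    also have "\<dots> = (\<integral>\<^sup>+y. \<integral>\<^sup>+X. ennreal (mixture y) * (ennreal (robbins_loss y (card {i\<in>J. X i = y}) (card {i\<in>J. X i = Suc y}))
            * (\<Prod>i\<in>J. ennreal (mixture (X i)))) \<partial>PiM J (\<lambda>_. count_space UNIV) \<partial>count_space UNIV)"
      unfolding loss pr by (intro nn_integral_cong)
        (simp add: prod_ennreal ennreal_mult prod_nonneg mult_ac)
    also have "\<dots> = (\<integral>\<^sup>+y. ennreal (mixture y) * ennreal (counts_expectation y (n - 1) (robbins_loss y)) \<partial>count_space UNIV)"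
      by (intro nn_integral_cong, subst nn_integral_cmult)
         (auto simp: meas J nn_integral_counts)
    finally show ?thesis
      by (simp add: ennreal_mult counts_nonneg)
  qed
  show ?thesis
    unfolding regret_def
    by (simp add: coord nn_integral_cmult ennreal_mult counts_nonneg ennreal_of_nat_eq_real_of_nat)
qed

text \<open>
  The bound does not deteriorate with the mass of the cell: in a rare cell the estimate is poor, but it is rarely
  charged for.
\<close>

lemma robbins_cell_le:
  assumes n: "3 \<le> n"
  shows "real n * (mixture y * counts_expectation y (n - 1) (robbins_loss y))
      \<le> 2 * (real (Suc y) * posterior_mean y) + 5 * (posterior_mean y)\<^sup>2" (is "?L \<le> ?R")
proof (cases "mixture y = 0")
  case False
  then have pos: "0 < mixture y" using mixture_nonneg[of y] by linarith
  obtain k where k: "n = k + 3" using n by (metis le_add_diff_inverse2)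
  let ?r = "mixture (Suc y) / mixture y"
  have "robbins_loss y = (\<lambda>a b. (real (Suc y))\<^sup>2 * (real b / (real a + 1) - ?r)\<^sup>2)"
    by (simp add: robbins_loss_def posterior_mean_def fun_eq_iff power_mult_distrib[symmetric] right_diff_distrib)
  then have "?L = (real (Suc y))\<^sup>2 * (real (k + 3) * mixture y * counts_expectation y (k + 2) (\<lambda>a b. (real b / (real a + 1) - ?r)\<^sup>2))"
    by (simp add: trinomial_cmult k)
  also have "\<dots> \<le> (real (Suc y))\<^sup>2 * (2 * ?r + 5 * ?r\<^sup>2)"
    using mixture_pair_le_1[of y] pos by (intro mult_left_mono trinomial_ratio) auto
  also have "\<dots> = ?R"
    using pos by (simp add: posterior_mean_def power2_eq_square field_simps)
  finally show ?thesis .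
qed simp

text \<open>
  Discarding the denominator \<open>M + 1\<close> loses powers of \<open>n\<close>, but both terms keep the factor \<open>mixture y\<close>, so
  the bound is small in cells of very small mass.
\<close>

lemma robbins_cell_le_crude:
  "real n * (mixture y * counts_expectation y (n - 1) (robbins_loss y))
     \<le> real n ^ 3 * ((real (Suc y))\<^sup>2 * (mixture (Suc y) * mixture y)) + real n * ((posterior_mean y)\<^sup>2 * mixture y)"
proof -
  have "counts_expectation y (n - 1) (robbins_loss y)
      \<le> counts_expectation y (n - 1) (\<lambda>a b. (real (Suc y))\<^sup>2 * (real b)\<^sup>2 + (posterior_mean y)\<^sup>2)"
  proof (rule trinomial_mono)
    fix a b
    let ?x = "real (Suc y) * real b / (real a + 1)"
    have "?x \<le> real (Suc y) * real b / 1"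
      by (intro divide_left_mono mult_nonneg_nonneg) auto
    then have x: "0 \<le> ?x" "?x \<le> real (Suc y) * real b"
      by auto
    have "robbins_loss y a b \<le> ?x\<^sup>2 + (posterior_mean y)\<^sup>2"
      using mult_nonneg_nonneg[OF x(1) posterior_mean_nonneg[of y]]
      unfolding robbins_loss_def power2_diff by linarith
    also have "?x\<^sup>2 \<le> (real (Suc y) * real b)\<^sup>2"
      using x by (intro power_mono)
    finally show "robbins_loss y a b \<le> (real (Suc y))\<^sup>2 * (real b)\<^sup>2 + (posterior_mean y)\<^sup>2"
      by (simp add: power_mult_distrib)
  qed (auto simp: mixture_pair_le_1)
  also have "\<dots> = (real (Suc y))\<^sup>2 * counts_expectation y (n - 1) (\<lambda>a b. (real b)\<^sup>2) + (posterior_mean y)\<^sup>2"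
    by (simp add: trinomial_add trinomial_cmult trinomial_const del: of_nat_Suc)
  also have "\<dots> \<le> (real (Suc y))\<^sup>2 * ((real n)\<^sup>2 * mixture (Suc y)) + (posterior_mean y)\<^sup>2"
  proof (intro add_right_mono mult_left_mono)
    have "counts_expectation y (n - 1) (\<lambda>a b. (real b)\<^sup>2) \<le> (real (n - 1))\<^sup>2 * mixture (Suc y)"
      by (rule trinomial_snd_square) (auto simp: mixture_pair_le_1)
    also have "\<dots> \<le> (real n)\<^sup>2 * mixture (Suc y)"
      by (intro mult_right_mono power_mono) auto
    finally show "counts_expectation y (n - 1) (\<lambda>a b. (real b)\<^sup>2) \<le> (real n)\<^sup>2 * mixture (Suc y)" .
  qed auto
  finally have "real n * (mixture y * counts_expectation y (n - 1) (robbins_loss y))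
     \<le> real n * (mixture y * ((real (Suc y))\<^sup>2 * ((real n)\<^sup>2 * mixture (Suc y)) + (posterior_mean y)\<^sup>2))"
    by (intro mult_left_mono) auto
  then show ?thesis
    by (simp add: algebra_simps power2_eq_square power3_eq_cube)
qed

text \<open>
  Cells from \<open>y0\<close> on are handled by the crude bound. Their masses decay like \<open>\<beta>\<^sup>-\<^sup>2\<^sup>y\<close>: one factor
  \<open>\<beta>\<^sup>-\<^sup>y\<close> pays for the polynomial in \<open>y\<close>, the other for \<open>n\<^sup>3 A\<close> and for convergence. The lower bound
  \<open>\<beta>0\<close> on \<open>\<beta>\<close> keeps the remainder uniform when \<open>\<beta>\<close> grows with \<open>n\<close>.
\<close>

lemma regret_robbins_le:
  assumes n: "1 \<le> n" and B: "0 \<le> B"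
    and head: "\<And>y. y < y0 \<Longrightarrow> real n * (mixture y * counts_expectation y (n - 1) (robbins_loss y)) \<le> B"
    and tail: "\<And>y. mixture y \<le> A / \<beta> ^ (2 * y)"
    and \<beta>: "1 < \<beta>0" "\<beta>0 \<le> \<beta>" and C: "\<And>y. (real (y + 2))\<^sup>2 \<le> C * \<beta>0 ^ y"
    and y0: "real n ^ 3 * A \<le> \<beta> ^ y0"
  shows "regret n (robbins n) \<le> ennreal (real y0 * B + 2 * C / (1 - 1 / \<beta>0))"
proof -
  let ?R = "\<lambda>y. real n * (mixture y * counts_expectation y (n - 1) (robbins_loss y))"
  define D where "D y = (if y < y0 then B else 2 * C * (1 / \<beta>0) ^ (y - y0))" for y
  have C0: "0 \<le> C"
    using C[of 0] by simp
  have A0: "0 \<le> A"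
    using order_trans[OF mixture_nonneg tail[of 0]] by simp
  have "?R y \<le> D y" for y
  proof (cases "y < y0")
    case False
    have small: "mixture (y + k) \<le> A / \<beta> ^ (2 * y)" for k
    proof -
      have "A / \<beta> ^ (2 * (y + k)) \<le> A / \<beta> ^ (2 * y)"
        using \<beta> A0 by (intro divide_left_mono power_increasing mult_pos_pos zero_less_power) auto
      with tail[of "y + k"] show ?thesis by simp
    qed
    have "(posterior_mean y)\<^sup>2 * mixture y \<le> real (y + 1) * (real (y + 2) * mixture (y + 2))"
      using posterior_mean_sq_le[of y] unfolding integral_sq_likelihood by (simp add: add_ac)
    also have "\<dots> \<le> real (y + 2) * (real (y + 2) * (A / \<beta> ^ (2 * y)))"
      using small[of 2] by (intro mult_mono) auto
    finally have 1: "(posterior_mean y)\<^sup>2 * mixture y \<le> (real (y + 2))\<^sup>2 * (A / \<beta> ^ (2 * y))"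
      unfolding power2_eq_square mult.assoc .
    have 2: "(real (Suc y))\<^sup>2 * (mixture (Suc y) * mixture y) \<le> (real (y + 2))\<^sup>2 * ((A / \<beta> ^ (2 * y)) * 1)"
      using small[of 1] mixture_le_1[of y] A0 \<beta> by (intro mult_mono power_mono) auto
    have "?R y \<le> real n ^ 3 * ((real (y + 2))\<^sup>2 * (A / \<beta> ^ (2 * y))) + real n ^ 3 * ((real (y + 2))\<^sup>2 * (A / \<beta> ^ (2 * y)))"
    proof (rule order_trans[OF robbins_cell_le_crude], rule add_mono)
      show "real n ^ 3 * ((real (Suc y))\<^sup>2 * (mixture (Suc y) * mixture y)) \<le> real n ^ 3 * ((real (y + 2))\<^sup>2 * (A / \<beta> ^ (2 * y)))"
        using 2 by (intro mult_left_mono) auto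
      have "real n * 1 \<le> real n * (real n)\<^sup>2"
        using n by (intro mult_left_mono) auto
      then show "real n * ((posterior_mean y)\<^sup>2 * mixture y) \<le> real n ^ 3 * ((real (y + 2))\<^sup>2 * (A / \<beta> ^ (2 * y)))"
        using mult_mono[OF _ 1, of "real n" "real n ^ 3"]
        by (simp add: power2_eq_square power3_eq_cube mult.assoc)
    qed
    also have "\<dots> = 2 * (real (y + 2))\<^sup>2 * (real n ^ 3 * A) / \<beta> ^ (2 * y)"
      by simp
    also have "\<dots> \<le> 2 * (C * \<beta> ^ y) * \<beta> ^ y0 / \<beta> ^ (2 * y)"
    proof (rule divide_right_mono, rule mult_mono)
      have "C * \<beta>0 ^ y \<le> C * \<beta> ^ y"
        using \<beta> C0 by (intro mult_left_mono power_mono) auto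
      with C[of y] show "2 * (real (y + 2))\<^sup>2 \<le> 2 * (C * \<beta> ^ y)" by simp
    qed (use \<beta> C0 A0 y0 n in \<open>auto intro!: mult_nonneg_nonneg\<close>)
    also have "\<dots> = 2 * C * (1 / \<beta>) ^ (y - y0)"
    proof -
      obtain k where k: "y = y0 + k" using False by (metis not_less le_iff_add)
      have "2 * (C * (b * c)) * b / (b * c * (b * c)) = 2 * C * (1 / c)" if "0 < b" "0 < c" for b c :: real
        using that by (simp add: divide_simps)
      from this[of "\<beta> ^ y0" "\<beta> ^ k"] \<beta> show ?thesis
        unfolding k mult_2[of "y0 + k"] by (simp add: power_add power_one_over mult_ac)
    qed
    also have "\<dots> \<le> 2 * C * (1 / \<beta>0) ^ (y - y0)"
      using \<beta> C0 by (intro mult_left_mono power_mono) (auto intro: divide_left_mono)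
    finally show ?thesis using False by (simp add: D_def)
  qed (use head in \<open>simp add: D_def\<close>)
  then have "regret n (robbins n) \<le> (\<integral>\<^sup>+y. ennreal (D y) \<partial>count_space UNIV)"
    unfolding regret_robbins_eq by (intro nn_integral_mono ennreal_leI)
  also have "\<dots> = ennreal (real y0 * B + 2 * C / (1 - 1 / \<beta>0))"
  proof -
    have "(\<lambda>k. D (k + y0)) sums (2 * C * (1 / (1 - 1 / \<beta>0)))"
      using \<beta> sums_mult[OF geometric_sums[of "1 / \<beta>0"], of "2 * C"] by (simp add: D_def)
    then have *: "D sums (2 * C * (1 / (1 - 1 / \<beta>0)) + (\<Sum>y<y0. D y))"
      by (rule iffD1[OF sums_iff_shift])
    moreover have "(\<Sum>y<y0. D y) = real y0 * B"
      by (simp add: D_def)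
    ultimately have "D sums (real y0 * B + 2 * C / (1 - 1 / \<beta>0))"
      by (simp add: add.commute)
    moreover have "0 \<le> D y" for y
      using B C0 \<beta> by (simp add: D_def)
    ultimately show "(\<integral>\<^sup>+y. ennreal (D y) \<partial>count_space UNIV) = ennreal (real y0 * B + 2 * C / (1 - 1 / \<beta>0))"
      unfolding nn_integral_count_space_nat by (intro suminf_ennreal_eq)
  qed
  finally show ?thesis .
qed

end

section \<open>Two-point and hypercube bounds\<close>

text \<open>
  With \<open>x = sqrt P\<close> and \<open>z = sqrt Q\<close>, the difference of the two sides is the sum of the squares of
  \<open>x (t - a) - \<gamma> z (b - a)\<close> and \<open>z (b - t) - \<gamma> x (b - a)\<close>. Integrated with the best \<open>\<gamma>\<close>, it plays the role of the
  Cauchy-Schwarz inequality between testing error and Hellinger affinity.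
\<close>

lemma two_point_pointwise:
  fixes P Q t a b \<gamma> :: real
  assumes "0 \<le> P" "0 \<le> Q"
  shows "2 * \<gamma> * (a - b)\<^sup>2 * sqrt (P * Q)
    \<le> (t - a)\<^sup>2 * P + (t - b)\<^sup>2 * Q + \<gamma>\<^sup>2 * (a - b)\<^sup>2 * (P + Q)"
proof -
  define x z where "x = sqrt P" and "z = sqrt Q"
  have PQ: "P = x\<^sup>2" "Q = z\<^sup>2" "sqrt (P * Q) = x * z"
    using assms by (auto simp: x_def z_def real_sqrt_mult)
  have "0 \<le> (x * (t - a) - \<gamma> * z * (b - a))\<^sup>2 + (z * (b - t) - \<gamma> * x * (b - a))\<^sup>2"
    by simp
  then show ?thesis
    unfolding PQ(3) unfolding PQ(1,2) by (simp add: power2_eq_square algebra_simps)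
qed

text \<open>
  Summed over the sample space, this bounds the Hellinger affinity below by one minus half a symmetrized
  chi-square distance.
\<close>

lemma affinity_pointwise:
  fixes p q :: real
  assumes "0 \<le> p" "0 \<le> q"
  shows "p + q \<le> 2 * sqrt (p * q) + (p - q)\<^sup>2 / (p + q)"
proof (cases "p + q = 0")
  case False
  then have pos: "0 < p + q" using assms by linarith
  define x z where "x = sqrt p" and "z = sqrt q"
  have pq: "p = x\<^sup>2" "q = z\<^sup>2" "sqrt (p * q) = x * z" "0 \<le> x" "0 \<le> z"
    using assms by (auto simp: x_def z_def real_sqrt_mult)
  have "(p + q - 2 * sqrt (p * q)) * (p + q) = (x - z)\<^sup>2 * (x\<^sup>2 + z\<^sup>2)"
    unfolding pq(3) unfolding pq(1,2) by (simp add: power2_eq_square algebra_simps)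
  also have "\<dots> \<le> (x - z)\<^sup>2 * (x + z)\<^sup>2"
    using pq by (intro mult_left_mono) (auto simp: power2_sum)
  also have "\<dots> = (p - q)\<^sup>2"
    unfolding pq by (simp add: power2_eq_square algebra_simps)
  finally have "p + q - 2 * sqrt (p * q) \<le> (p - q)\<^sup>2 / (p + q)"
    using pos by (simp add: pos_le_divide_eq)
  then show ?thesis by (simp only: diff_le_eq add.commute)
qed (use assms in auto)

lemma ennreal_le_of_add_le:
  assumes "ennreal c \<le> X + ennreal b" "0 \<le> b"
  shows "ennreal (c - b) \<le> X"
proof (cases X)
  case (real x)
  with assms have "ennreal c \<le> ennreal (x + b)" by simp
  then have "c \<le> x + b"
    using real assms(2) by (subst (asm) ennreal_le_iff) auto
  then show ?thesis
    using real by (simp add: ennreal_leI)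
qed simp

text \<open>
  Le Cam's two-point bound for the squared error, restricted to the event \<open>Y\<^sub>j = y\<close>. The laws agree on this event
  for the coordinate \<open>j\<close>, so only the other \<open>n - 1\<close> coordinates can distinguish them. Their affinity is a product,
  each factor at least \<open>1 - 1 / (4 n)\<close>, and its square stays above \<open>1 / 2\<close>.
\<close>

lemma two_point:
  fixes p q :: "nat \<Rightarrow> real" and T :: "(nat \<Rightarrow> nat) \<Rightarrow> real"
  assumes nonneg: "\<And>z. 0 \<le> p z" "\<And>z. 0 \<le> q z"
    and total: "(\<integral>\<^sup>+z. ennreal (p z) \<partial>count_space UNIV) = 1" "(\<integral>\<^sup>+z. ennreal (q z) \<partial>count_space UNIV) = 1"
    and eq: "p y = q y"
    and close: "(\<integral>\<^sup>+z. ennreal ((p z - q z)\<^sup>2 / (p z + q z)) \<partial>count_space UNIV) \<le> ennreal (1 / (2 * real n))"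
    and j: "j < n"
  shows "ennreal ((a - b)\<^sup>2 * p y / 4)
    \<le> (\<integral>\<^sup>+Y. ennreal ((T Y - a)\<^sup>2 * (\<Prod>i<n. p (Y i))) * indicator {y} (Y j) \<partial>obs_space n)
    + (\<integral>\<^sup>+Y. ennreal ((T Y - b)\<^sup>2 * (\<Prod>i<n. q (Y i))) * indicator {y} (Y j) \<partial>obs_space n)"
    (is "_ \<le> ?X")
proof -
  define n' where "n' = n - 1"
  have n: "0 < n" and n': "card ({..<n} - {j}) = n'" "n' \<le> n" using j by (auto simp: n'_def)
  define \<rho> where "\<rho> = 1 - 1 / (4 * real n)"
  have \<rho>: "0 \<le> \<rho>" using n by (simp add: \<rho>_def)
  define s where "s = \<rho> ^ n'"
  have s: "0 \<le> s" "1 / 2 \<le> s\<^sup>2"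
  proof -
    have "1 + real (n' * 2) * (- (1 / (4 * real n))) \<le> (1 + (- (1 / (4 * real n)))) ^ (n' * 2)"
      using n by (intro Bernoulli_inequality) (simp add: field_simps)
    moreover have "real (n' * 2) * (1 / (4 * real n)) \<le> real (n * 2) * (1 / (4 * real n))"
      using n' by (intro mult_right_mono) auto
    moreover have "real (n * 2) * (1 / (4 * real n)) = 1 / 2"
      using n by simp
    ultimately have "1 / 2 \<le> (1 + (- (1 / (4 * real n)))) ^ (n' * 2)"
      by linarith
    then show "1 / 2 \<le> s\<^sup>2"
      by (simp add: s_def \<rho>_def flip: power_mult)
  qed (simp add: s_def \<rho>)
  let ?R = "\<integral>\<^sup>+z. ennreal (sqrt (p z * q z)) \<partial>count_space UNIV"
  have aff: "ennreal \<rho> \<le> ?R"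
  proof -
    define h :: real where "h = 1 / 2"
    have h: "0 \<le> h" "h + h = 1" by (simp_all add: h_def)
    have "1 = ennreal h * 1 + ennreal h * 1"
      using h by (simp flip: ennreal_plus)
    also have "\<dots> = (\<integral>\<^sup>+z. ennreal h * ennreal (p z) + ennreal h * ennreal (q z) \<partial>count_space UNIV)"
      by (simp add: nn_integral_add nn_integral_cmult total)
    also have "\<dots> = (\<integral>\<^sup>+z. ennreal (h * p z + h * q z) \<partial>count_space UNIV)"
      using nonneg h by (intro nn_integral_cong) (simp add: ennreal_mult')
    also have "\<dots> \<le> (\<integral>\<^sup>+z. ennreal (sqrt (p z * q z) + h * ((p z - q z)\<^sup>2 / (p z + q z))) \<partial>count_space UNIV)"
    proof (intro nn_integral_mono ennreal_leI)
      have "h * a + h * b \<le> u + h * v" if "a + b \<le> 2 * u + v" for a b u v :: real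
        using that by (simp add: h_def)
      with affinity_pointwise[OF nonneg] show "h * p z + h * q z \<le> sqrt (p z * q z) + h * ((p z - q z)\<^sup>2 / (p z + q z))" for z
        by blast
    qed
    also have "\<dots> = (\<integral>\<^sup>+z. ennreal (sqrt (p z * q z)) + ennreal h * ennreal ((p z - q z)\<^sup>2 / (p z + q z)) \<partial>count_space UNIV)"
      unfolding ennreal_mult'[OF h(1), symmetric] using nonneg h by (intro nn_integral_cong ennreal_plus) auto
    also have "\<dots> = ?R + ennreal h * (\<integral>\<^sup>+z. ennreal ((p z - q z)\<^sup>2 / (p z + q z)) \<partial>count_space UNIV)"
      by (simp add: nn_integral_add nn_integral_cmult)
    also have "\<dots> \<le> ?R + ennreal h * ennreal (1 / (2 * real n))"
      using close by (intro add_left_mono mult_left_mono) auto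
    also have "\<dots> = ?R + ennreal (1 / (4 * real n))"
      unfolding ennreal_mult'[OF h(1), symmetric] by (simp add: h_def)
    finally have "ennreal 1 \<le> ?R + ennreal (1 / (4 * real n))" by simp
    from ennreal_le_of_add_le[OF this] show ?thesis unfolding \<rho>_def by simp
  qed
  (* Weights that force coordinate j to equal y and keep the product structure. *)
  define pin where "pin i z = (if i = j \<and> z \<noteq> y then 0 else 1 :: real)" for i z
  have pinned: "(\<integral>\<^sup>+Y. ennreal (\<Prod>i<n. g (Y i) * pin i (Y i)) \<partial>obs_space n)
      = ennreal (g y) * (\<integral>\<^sup>+z. ennreal (g z) \<partial>count_space UNIV) ^ n'" if "\<And>z. 0 \<le> g z" for g
  proof -
    have "(\<integral>\<^sup>+Y. ennreal (\<Prod>i<n. g (Y i) * pin i (Y i)) \<partial>obs_space n)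
        = (\<integral>\<^sup>+Y. (\<Prod>i<n. ennreal (g (Y i) * pin i (Y i))) \<partial>obs_space n)"
      using that by (intro nn_integral_cong) (simp add: prod_ennreal pin_def)
    also have "\<dots> = (\<Prod>i<n. \<integral>\<^sup>+z. ennreal (g z * pin i z) \<partial>count_space UNIV)"
      by (rule nn_integral_obs_prod)
    also have "\<dots> = (\<integral>\<^sup>+z. ennreal (g z * pin j z) \<partial>count_space UNIV)
        * (\<Prod>i\<in>{..<n} - {j}. \<integral>\<^sup>+z. ennreal (g z * pin i z) \<partial>count_space UNIV)"
      using j by (simp add: prod.remove)
    also have "(\<Prod>i\<in>{..<n} - {j}. \<integral>\<^sup>+z. ennreal (g z * pin i z) \<partial>count_space UNIV)
        = (\<integral>\<^sup>+z. ennreal (g z) \<partial>count_space UNIV) ^ n'"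
      unfolding n'(1)[symmetric] prod_constant[symmetric] by (intro prod.cong) (auto simp: pin_def)
    also have "(\<integral>\<^sup>+z. ennreal (g z * pin j z) \<partial>count_space UNIV)
        = (\<integral>\<^sup>+z. ennreal (g y) * indicator {y} z \<partial>count_space UNIV)"
      by (intro nn_integral_cong) (auto simp: pin_def)
    finally show ?thesis by (simp add: nn_integral_cmult)
  qed
  have prod_pin: "(\<Prod>i<n. g (Y i) * pin i (Y i)) = (\<Prod>i<n. g (Y i)) * indicator {y} (Y j)" for g Y
  proof -
    have "(\<Prod>i<n. pin i (Y i)) = pin j (Y j) * (\<Prod>i\<in>{..<n} - {j}. pin i (Y i))"
      using j by (simp add: prod.remove)
    also have "(\<Prod>i\<in>{..<n} - {j}. pin i (Y i)) = 1"
      by (rule prod.neutral) (auto simp: pin_def)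
    finally show ?thesis by (simp add: prod.distrib pin_def indicator_def)
  qed
  let ?P = "\<lambda>Y. \<Prod>i<n. p (Y i) * pin i (Y i)" and ?Q = "\<lambda>Y. \<Prod>i<n. q (Y i) * pin i (Y i)"
    and ?S = "\<lambda>Y. \<Prod>i<n. sqrt (p (Y i) * q (Y i)) * pin i (Y i)"
  have PQ: "0 \<le> ?P Y" "0 \<le> ?Q Y" "0 \<le> ?S Y" "sqrt (?P Y * ?Q Y) = ?S Y" for Y
  proof -
    show nn: "0 \<le> ?P Y" "0 \<le> ?Q Y" "0 \<le> ?S Y"
      using nonneg by (auto intro!: prod_nonneg simp: pin_def)
    have "(?S Y)\<^sup>2 = ?P Y * ?Q Y"
      unfolding power2_eq_square prod.distrib[symmetric]
    proof (rule prod.cong[OF refl])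
      fix i
      have "sqrt (p (Y i) * q (Y i)) * sqrt (p (Y i) * q (Y i)) = p (Y i) * q (Y i)"
        using nonneg by simp
      then show "sqrt (p (Y i) * q (Y i)) * pin i (Y i) * (sqrt (p (Y i) * q (Y i)) * pin i (Y i))
          = p (Y i) * pin i (Y i) * (q (Y i) * pin i (Y i))"
        by (simp add: mult_ac)
    qed
    then show "sqrt (?P Y * ?Q Y) = ?S Y"
      using nn(3) by (metis real_sqrt_unique)
  qed
  have meas: "f \<in> borel_measurable (obs_space n)" for f :: "_ \<Rightarrow> ennreal"
    by (simp add: obs_space_eq_count_space)
  define \<gamma> where "\<gamma> = s / 2"
  have \<gamma>: "0 \<le> \<gamma>" using s by (simp add: \<gamma>_def)
  have "ennreal (2 * \<gamma> * (a - b)\<^sup>2 * (p y * s)) = ennreal (2 * \<gamma> * (a - b)\<^sup>2) * (ennreal (p y) * ennreal \<rho> ^ n')"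
    using nonneg \<rho> s by (simp add: ennreal_mult' s_def \<gamma>_def ennreal_power)
  also have "\<dots> \<le> ennreal (2 * \<gamma> * (a - b)\<^sup>2) * (ennreal (p y) * ?R ^ n')"
    using aff by (intro mult_left_mono power_mono) auto
  also have "\<dots> = (\<integral>\<^sup>+Y. ennreal (2 * \<gamma> * (a - b)\<^sup>2) * ennreal (?S Y) \<partial>obs_space n)"
    using nonneg eq by (simp add: nn_integral_cmult[OF meas] pinned[where g = "\<lambda>z. sqrt (p z * q z)"])
  also have "\<dots> \<le> (\<integral>\<^sup>+Y. (ennreal ((T Y - a)\<^sup>2 * ?P Y) + ennreal ((T Y - b)\<^sup>2 * ?Q Y))
      + ennreal (\<gamma>\<^sup>2 * (a - b)\<^sup>2) * (ennreal (?P Y) + ennreal (?Q Y)) \<partial>obs_space n)"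
  proof (rule nn_integral_mono)
    fix Y
    have "ennreal (2 * \<gamma> * (a - b)\<^sup>2) * ennreal (?S Y) = ennreal (2 * \<gamma> * (a - b)\<^sup>2 * ?S Y)"
      using \<gamma> by (intro ennreal_mult'[symmetric]) auto
    also have "\<dots> \<le> ennreal ((T Y - a)\<^sup>2 * ?P Y + (T Y - b)\<^sup>2 * ?Q Y + \<gamma>\<^sup>2 * (a - b)\<^sup>2 * (?P Y + ?Q Y))"
      using two_point_pointwise[OF PQ(1,2)[of Y], of \<gamma> a b "T Y"] unfolding PQ(4) by (rule ennreal_leI)
    also have "\<dots> = (ennreal ((T Y - a)\<^sup>2 * ?P Y) + ennreal ((T Y - b)\<^sup>2 * ?Q Y))
        + ennreal (\<gamma>\<^sup>2 * (a - b)\<^sup>2) * (ennreal (?P Y) + ennreal (?Q Y))"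
      using PQ[of Y] by (simp add: ennreal_mult')
    finally show "ennreal (2 * \<gamma> * (a - b)\<^sup>2) * ennreal (?S Y)
        \<le> (ennreal ((T Y - a)\<^sup>2 * ?P Y) + ennreal ((T Y - b)\<^sup>2 * ?Q Y))
        + ennreal (\<gamma>\<^sup>2 * (a - b)\<^sup>2) * (ennreal (?P Y) + ennreal (?Q Y))" .
  qed
  also have "\<dots> = ?X + ennreal (\<gamma>\<^sup>2 * (a - b)\<^sup>2) * (ennreal (p y) + ennreal (q y))"
  proof -
    have "ennreal (c * (\<Prod>i<n. g (Y i) * pin i (Y i))) = ennreal (c * (\<Prod>i<n. g (Y i))) * indicator {y} (Y j)" for c g Y
      unfolding prod_pin by (simp add: indicator_def)
    then show ?thesis
      using nonneg by (simp only: nn_integral_add[OF meas meas] nn_integral_cmult[OF meas] pinned total power_one mult_1_right)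
  qed
  also have "ennreal (\<gamma>\<^sup>2 * (a - b)\<^sup>2) * (ennreal (p y) + ennreal (q y)) = ennreal (\<gamma>\<^sup>2 * (a - b)\<^sup>2 * (2 * p y))"
    using nonneg eq by (simp add: ennreal_mult' flip: ennreal_plus)
  finally have "ennreal (2 * \<gamma> * (a - b)\<^sup>2 * (p y * s) - \<gamma>\<^sup>2 * (a - b)\<^sup>2 * (2 * p y)) \<le> ?X"
    using nonneg by (intro ennreal_le_of_add_le) auto
  also have "2 * \<gamma> * (a - b)\<^sup>2 * (p y * s) - \<gamma>\<^sup>2 * (a - b)\<^sup>2 * (2 * p y) = (a - b)\<^sup>2 * p y * (s\<^sup>2 / 2)"
    by (simp add: \<gamma>_def power2_eq_square)
  finally have le: "ennreal ((a - b)\<^sup>2 * p y * (s\<^sup>2 / 2)) \<le> ?X" .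
  have "(a - b)\<^sup>2 * p y / 4 \<le> (a - b)\<^sup>2 * p y * (s\<^sup>2 / 2)"
  proof -
    have "(a - b)\<^sup>2 * p y * (1 / 4) \<le> (a - b)\<^sup>2 * p y * (s\<^sup>2 / 2)"
      using s nonneg by (intro mult_left_mono) auto
    then show ?thesis by simp
  qed
  then show ?thesis
    by (intro order_trans[OF ennreal_leI le])
qed

text \<open>
  The events \<open>Y\<^sub>j = i - 1\<close> are disjoint, so the losses on them add up to at most the whole loss.
\<close>

lemma sum_indicator_pred_le:
  fixes F :: "nat \<Rightarrow> ennreal"
  assumes "finite I" "\<And>i. i \<in> I \<Longrightarrow> 1 \<le> i"
  shows "(\<Sum>i\<in>I. F (i - 1) * indicator {i - 1} y) \<le> F y"
proof -
  have "(\<Sum>i\<in>I. F (i - 1) * indicator {i - 1} y) = (\<Sum>i\<in>I \<inter> {Suc y}. F y)"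
    using assms by (intro sum.mono_neutral_cong_right) (force simp: indicator_def)+
  also have "\<dots> \<le> (\<Sum>i\<in>{Suc y}. F y)"
    by (intro sum_mono2) auto
  finally show ?thesis by simp
qed


text \<open>
  Assouad's argument: in the sum over all vertices \<open>S\<close> of the cube, group the \<open>i\<close>-th partial loss along the
  edges in direction \<open>i\<close>. There are half as many edges as vertices, hence the factor 2.
\<close>

lemma hypercube_average:
  fixes r :: "'a set \<Rightarrow> ennreal"
  assumes "finite I" "I \<noteq> {}"
    and split: "\<And>S. S \<subseteq> I \<Longrightarrow> (\<Sum>i\<in>I. l i S) \<le> r S"
    and edge: "\<And>i S. i \<in> I \<Longrightarrow> S \<subseteq> I - {i} \<Longrightarrow> g i \<le> l i S + l i (insert i S)"
    and M: "\<And>S. S \<subseteq> I \<Longrightarrow> r S \<le> M"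
  shows "(\<Sum>i\<in>I. g i) \<le> 2 * M"
proof -
  define k where "k = card I - 1"
  have card: "card I = Suc k" using assms(1,2) by (simp add: k_def card_gt_0_iff)
  have "of_nat (2 ^ k) * (\<Sum>i\<in>I. g i) = (\<Sum>i\<in>I. \<Sum>S\<in>Pow (I - {i}). g i)"
    using assms(1) card by (simp add: card_Pow sum_distrib_left)
  also have "\<dots> \<le> (\<Sum>i\<in>I. \<Sum>S\<in>Pow (I - {i}). l i S + l i (insert i S))"
    by (intro sum_mono edge) auto
  also have "\<dots> = (\<Sum>i\<in>I. \<Sum>S\<in>Pow I. l i S)"
  proof (rule sum.cong[OF refl])
    fix i assume i: "i \<in> I"
    have Pow_I: "Pow I = Pow (I - {i}) \<union> insert i ` Pow (I - {i})"
      using i by (metis Pow_insert insert_Diff)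
    have "(\<Sum>S\<in>Pow I. l i S) = (\<Sum>S\<in>Pow (I - {i}). l i S) + (\<Sum>S\<in>insert i ` Pow (I - {i}). l i S)"
      using assms(1) unfolding Pow_I by (intro sum.union_disjoint) auto
    also have "(\<Sum>S\<in>insert i ` Pow (I - {i}). l i S) = (\<Sum>S\<in>Pow (I - {i}). l i (insert i S))"
      by (subst sum.reindex) (auto simp: inj_on_def)
    finally show "(\<Sum>S\<in>Pow (I - {i}). l i S + l i (insert i S)) = (\<Sum>S\<in>Pow I. l i S)"
      by (simp add: sum.distrib)
  qed
  also have "\<dots> = (\<Sum>S\<in>Pow I. \<Sum>i\<in>I. l i S)"
    by (rule sum.swap)
  also have "\<dots> \<le> (\<Sum>S\<in>Pow I. M)"
    using split M by (intro sum_mono) (auto intro: order_trans)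
  also have "\<dots> = of_nat (2 ^ k) * (2 * M)"
    using assms(1) card by (simp add: card_Pow mult_ac)
  finally show ?thesis
    by (subst (asm) ennreal_mult_le_mult_iff) (auto simp: ennreal_of_nat_eq_real_of_nat)
qed

section \<open>Signed grid weights with a localized Poisson mixture\<close>

definition lagrange_basis :: "nat \<Rightarrow> nat \<Rightarrow> real poly" where
  "lagrange_basis L k = (\<Prod>j\<in>{..L} - {k}. smult (1 / (real k - real j)) [:- real j, 1:])"

lemma poly_lagrange_basis:
  assumes "k \<le> L" "t \<le> L"
  shows "poly (lagrange_basis L k) (real t) = (if t = k then 1 else 0)"
proof (cases "t = k")
  case True
  have "poly (lagrange_basis L k) (real t) = (\<Prod>j\<in>{..L} - {k}. 1)"
    unfolding lagrange_basis_def poly_prod True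
    by (intro prod.cong) (auto simp: diff_divide_distrib[symmetric])
  then show ?thesis using True by simp
next
  case False
  then show ?thesis
    using assms unfolding lagrange_basis_def poly_prod by auto
qed

lemma degree_lagrange_basis:
  assumes "k \<le> L" shows "degree (lagrange_basis L k) \<le> L"
proof -
  have "degree (lagrange_basis L k) \<le> (\<Sum>j\<in>{..L} - {k}. 1)"
    unfolding lagrange_basis_def
    by (rule order_trans[OF degree_prod_sum_le]) (auto intro!: sum_mono simp: degree_smult_le)
  also have "\<dots> = L" using assms by simp
  finally show ?thesis .
qed

text \<open>
  Comparing coefficients of degree \<open>i\<close> shows that the numbers \<open>coeff (lagrange_basis L k) i\<close> annihilate all moments of
  order at most \<open>L\<close> on the nodes, except the one of order \<open>i\<close>.
\<close>

lemma lagrange_interpolation_monom: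
  assumes "y \<le> L"
  shows "(\<Sum>k\<le>L. smult (real k ^ y) (lagrange_basis L k)) = monom 1 y"
proof (rule poly_eqI_degree[where A = "real ` {..L}"])
  fix x assume "x \<in> real ` {..L}"
  then obtain t where t: "t \<le> L" "x = real t" by auto
  have "(\<Sum>k\<le>L. real k ^ y * poly (lagrange_basis L k) (real t)) = (\<Sum>k\<le>L. if k = t then real t ^ y else 0)"
    using t by (intro sum.cong) (auto simp: poly_lagrange_basis)
  with t show "poly (\<Sum>k\<le>L. smult (real k ^ y) (lagrange_basis L k)) x = poly (monom 1 y) x"
    by (simp add: poly_sum poly_monom)
next
  have "degree (\<Sum>k\<le>L. smult (real k ^ y) (lagrange_basis L k)) \<le> L"
    by (intro degree_sum_le order_trans[OF degree_smult_le] degree_lagrange_basis) auto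
  then show "degree (\<Sum>k\<le>L. smult (real k ^ y) (lagrange_basis L k)) < card (real ` {..L})"
    by (simp add: card_image)
  show "degree (monom (1::real) y) < card (real ` {..L})"
    using assms by (simp add: card_image degree_monom_eq)
qed

lemma abs_coeff_node_product:
  assumes "finite A"
  shows "\<bar>coeff (\<Prod>j\<in>A. [:- real j, 1:]) i\<bar> \<le> coeff (\<Prod>j\<in>A. [:real j, 1:]) i"
  using assms
proof (induction A arbitrary: i rule: finite_induct)
  case (insert a A)
  have "\<bar>- real a * coeff (\<Prod>j\<in>A. [:- real j, 1:]) i\<bar> \<le> real a * coeff (\<Prod>j\<in>A. [:real j, 1:]) i" for i
    using insert.IH[of i] by (simp add: abs_mult mult_left_mono)
  with insert show ?case
    by (cases i) (simp_all, smt (verit, best))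
qed (simp add: coeff_1)

lemma coeff_node_product_le:
  assumes "finite A" "0 \<le> x"
  shows "coeff (\<Prod>j\<in>A. [:real j, 1:]) i * x ^ i \<le> (\<Prod>j\<in>A. x + real j)"
proof -
  let ?p = "\<Prod>j\<in>A. [:real j, 1:]"
  have nn: "0 \<le> coeff ?p k" for k
    using abs_coeff_node_product[OF assms(1), of k] by linarith
  have "coeff ?p i * x ^ i \<le> poly ?p x"
  proof (cases "i \<le> degree ?p")
    case True
    then show ?thesis
      unfolding poly_altdef using nn assms(2) by (intro member_le_sum) auto
  next
    case False
    have "0 \<le> poly ?p x"
      unfolding poly_altdef using nn assms(2) by (intro sum_nonneg) auto
    with False show ?thesis by (simp add: coeff_eq_0)
  qed
  then show ?thesis by (simp add: poly_prod add.commute)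
qed

lemma prod_node_gaps:
  assumes "k \<le> L"
  shows "(\<Prod>j\<in>{..L} - {k}. \<bar>real k - real j\<bar>) = fact k * fact (L - k)"
proof -
  have parts: "{..L} - {k} = {..<k} \<union> {k<..L}" using assms by auto
  have "(\<Prod>j\<in>{..L} - {k}. \<bar>real k - real j\<bar>) = (\<Prod>j<k. \<bar>real k - real j\<bar>) * (\<Prod>j\<in>{k<..L}. \<bar>real k - real j\<bar>)"
    unfolding parts by (rule prod.union_disjoint) auto
  also have "(\<Prod>j<k. \<bar>real k - real j\<bar>) = (\<Prod>j\<in>{1..k}. real j)"
    by (rule prod.reindex_bij_witness[of _ "\<lambda>j. k - j" "\<lambda>j. k - j"]) auto
  also have "(\<Prod>j\<in>{k<..L}. \<bar>real k - real j\<bar>) = (\<Prod>j\<in>{1..L - k}. real j)"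
    using assms by (intro prod.reindex_bij_witness[of _ "\<lambda>j. j + k" "\<lambda>j. j - k"]) auto
  finally show ?thesis by (simp add: fact_prod)
qed

text \<open>
  The factor \<open>i!\<close> is harmless because evaluating the numerator at \<open>L\<close> gains \<open>L\<^sup>i \<ge> i!\<close>. The
  resulting bound is only exponential in \<open>L\<close>, which is what later admits \<open>m\<close> of order \<open>log n\<close>.
\<close>

lemma coeff_lagrange_basis:
  assumes "k \<le> L" "i \<le> L"
  shows "fact i * \<bar>coeff (lagrange_basis L k) i\<bar> \<le> (2 * real L) ^ L / fact L * real (L choose k)"
proof -
  let ?A = "{..L} - {k}"
  let ?g = "\<Prod>j\<in>?A. \<bar>real k - real j\<bar>"
  have card: "card ?A = L" using assms by simp
  have split: "lagrange_basis L k = smult (\<Prod>j\<in>?A. 1 / (real k - real j)) (\<Prod>j\<in>?A. [:- real j, 1:])"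
    unfolding lagrange_basis_def by (rule prod_smult)
  have "fact i * \<bar>coeff (lagrange_basis L k) i\<bar> = fact i * \<bar>coeff (\<Prod>j\<in>?A. [:- real j, 1:]) i\<bar> / ?g"
    unfolding split by (simp add: abs_mult abs_prod prod_dividef)
  also have "\<dots> \<le> real L ^ i * coeff (\<Prod>j\<in>?A. [:real j, 1:]) i / ?g"
  proof (intro divide_right_mono mult_mono abs_coeff_node_product prod_nonneg)
    have "fact i \<le> real (i ^ i)" by (rule fact_le_power)
    also have "\<dots> \<le> real L ^ i" using assms by (simp add: power_mono)
    finally show "fact i \<le> real L ^ i" .
  qed auto
  also have "\<dots> \<le> (\<Prod>j\<in>?A. real L + real j) / ?g"
    using coeff_node_product_le[of ?A "real L" i] by (intro divide_right_mono prod_nonneg) (auto simp: mult.commute)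
  also have "\<dots> \<le> (2 * real L) ^ L / ?g"
  proof (intro divide_right_mono prod_nonneg)
    have "(\<Prod>j\<in>?A. real L + real j) \<le> (\<Prod>j\<in>?A. 2 * real L)"
      by (intro prod_mono) auto
    then show "(\<Prod>j\<in>?A. real L + real j) \<le> (2 * real L) ^ L"
      by (simp add: card)
  qed auto
  also have "\<dots> = (2 * real L) ^ L / fact L * real (L choose k)"
    using assms by (simp add: prod_node_gaps binomial_fact)
  finally show ?thesis .
qed

lemma sum_coeff_lagrange_basis:
  assumes "i \<le> L"
  shows "(\<Sum>k\<le>L. fact i * \<bar>coeff (lagrange_basis L k) i\<bar>) \<le> 16 ^ L"
proof -
  have "(\<Sum>k\<le>L. fact i * \<bar>coeff (lagrange_basis L k) i\<bar>)
      \<le> (\<Sum>k\<le>L. (2 * real L) ^ L / fact L * real (L choose k))"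
    using assms by (intro sum_mono coeff_lagrange_basis) auto
  also have "\<dots> = (2 * real L) ^ L / fact L * 2 ^ L"
    unfolding sum_distrib_left[symmetric] of_nat_sum[symmetric] choose_row_sum by simp
  also have "\<dots> = 4 ^ L * (real L ^ L / fact L)"
    by (simp add: power_mult_distrib) (simp add: power_mult_distrib[symmetric])
  also have "\<dots> \<le> 4 ^ L * exp (real L)"
    by (intro mult_left_mono power_over_fact_le_exp) auto
  also have "exp (real L) = exp 1 ^ L"
    by (simp add: exp_of_nat_mult[symmetric])
  also have "4 ^ L * exp 1 ^ L \<le> 4 ^ L * (4::real) ^ L"
    using exp_le by (intro mult_left_mono power_mono) auto
  also have "\<dots> = 16 ^ L" by (simp add: power_mult_distrib[symmetric])
  finally show ?thesis .
qed

text \<open>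
  The node \<open>0\<close> is left out: its powers vanish for \<open>y \<ge> 1\<close>, so it has no influence on the moments in question.
\<close>

lemma moment_localizing_weights:
  fixes \<epsilon> :: real
  assumes "1 \<le> i" "i \<le> L" "0 < \<epsilon>"
  obtains \<nu> :: "nat \<Rightarrow> real" where
    "\<And>y. 1 \<le> y \<Longrightarrow> y \<le> L \<Longrightarrow> (\<Sum>k=1..L. \<nu> k * (real k * \<epsilon>) ^ y) = (if y = i then fact i else 0)"
    "(\<Sum>k=1..L. \<bar>\<nu> k\<bar>) \<le> 16 ^ L / \<epsilon> ^ i"
proof
  define \<nu> where "\<nu> k = fact i * coeff (lagrange_basis L k) i / \<epsilon> ^ i" for k
  have atMost: "{..L} = insert 0 {1..L}" by auto
  show "(\<Sum>k=1..L. \<nu> k * (real k * \<epsilon>) ^ y) = (if y = i then fact i else 0)" if y: "1 \<le> y" "y \<le> L" for y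
  proof -
    have "coeff (\<Sum>k\<le>L. smult (real k ^ y) (lagrange_basis L k)) i = coeff (monom 1 y) i"
      using y by (simp only: lagrange_interpolation_monom)
    then have "(\<Sum>k\<le>L. real k ^ y * coeff (lagrange_basis L k) i) = (if y = i then 1 else 0)"
      by (simp add: coeff_sum)
    then have *: "(\<Sum>k=1..L. real k ^ y * coeff (lagrange_basis L k) i) = (if y = i then 1 else 0)"
      using y unfolding atMost by (simp add: zero_power)
    have "(\<Sum>k=1..L. \<nu> k * (real k * \<epsilon>) ^ y)
        = fact i * \<epsilon> ^ y / \<epsilon> ^ i * (\<Sum>k=1..L. real k ^ y * coeff (lagrange_basis L k) i)"
      unfolding sum_distrib_left by (intro sum.cong) (auto simp: \<nu>_def power_mult_distrib)
    with assms show ?thesis unfolding * by simp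
  qed
  have "(\<Sum>k=1..L. \<bar>\<nu> k\<bar>) = (\<Sum>k=1..L. fact i * \<bar>coeff (lagrange_basis L k) i\<bar>) / \<epsilon> ^ i"
    using assms by (simp add: \<nu>_def abs_mult sum_divide_distrib)
  also have "\<dots> \<le> (\<Sum>k\<le>L. fact i * \<bar>coeff (lagrange_basis L k) i\<bar>) / \<epsilon> ^ i"
    using assms unfolding atMost by (intro divide_right_mono) auto
  also have "\<dots> \<le> 16 ^ L / \<epsilon> ^ i"
    using assms by (intro divide_right_mono sum_coeff_lagrange_basis) auto
  finally show "(\<Sum>k=1..L. \<bar>\<nu> k\<bar>) \<le> 16 ^ L / \<epsilon> ^ i" .
qed

text \<open>
  The grid \<open>k \<epsilon>\<close> with \<open>k \<le> 2 m\<close> ends at \<open>H / 1024\<close>. The small ratio to \<open>H\<close> makes the mixture of the grid weights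
  beyond \<open>2 m\<close> negligible against that of the atom at \<open>H\<close>, although the weights are exponentially large in \<open>m\<close>.
\<close>

definition grid_step :: "real \<Rightarrow> nat \<Rightarrow> real" where
  "grid_step H m = H / (2048 * real m)"

text \<open>
  Weights \<open>\<mu>\<close> of total mass zero on the grid, with Poisson mixture \<open>q\<close>. On \<open>{1..2 m}\<close> the mixture sees
  only the point \<open>i\<close>. The value at \<open>0\<close> cannot vanish, since all values of \<open>q\<close> add up to zero.
\<close>

definition localized_direction ::
    "real \<Rightarrow> nat \<Rightarrow> nat \<Rightarrow> (nat \<Rightarrow> real) \<Rightarrow> (nat \<Rightarrow> real) \<Rightarrow> bool" where
  "localized_direction H m i \<mu> q \<longleftrightarrow>
     (\<forall>y. q y = (\<Sum>k\<le>2*m. \<mu> k * likelihood (real k * grid_step H m) y)) \<and>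
     (\<Sum>k\<le>2*m. \<mu> k) = 0 \<and>
     (\<forall>k\<le>2*m. \<bar>\<mu> k\<bar> \<le> exp H * (256 ^ m / grid_step H m ^ i)) \<and>
     q i = 1 \<and> (\<forall>y. 1 \<le> y \<longrightarrow> y \<le> 2 * m \<longrightarrow> y \<noteq> i \<longrightarrow> q y = 0) \<and> \<bar>q 0\<bar> \<le> 2 \<and>
     (\<forall>y>2*m. \<bar>q y\<bar> \<le> 256 ^ m / grid_step H m ^ i * ((H / 1024) ^ y / fact y))"

text \<open>
  Multiplying localizing weights by \<open>exp (k \<epsilon>)\<close> cancels the exponential factor of the likelihood and turns
  moments into mixture masses. The atom at \<open>0\<close> is invisible for \<open>y \<ge> 1\<close> and is free to balance the total mass.
  Then \<open>q 0 = - 1\<close> up to the geometric tail of \<open>q\<close> beyond \<open>2 m\<close>.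
\<close>

lemma ex_localized_direction:
  assumes H: "0 < H" "6 * H \<le> real m" and i: "1 \<le> i" "i \<le> m"
  shows "\<exists>\<mu> q. localized_direction H m i \<mu> q"
proof -
  define \<epsilon> where "\<epsilon> = grid_step H m"
  define K where "K = 256 ^ m / \<epsilon> ^ i"
  note \<epsilon>_def = \<epsilon>_def[unfolded grid_step_def]
  have m: "0 < real m" using i by simp
  have \<epsilon>: "0 < \<epsilon>" using H m by (simp add: \<epsilon>_def)
  have \<epsilon>_small: "12288 * \<epsilon> \<le> 1" using H m by (simp add: \<epsilon>_def field_simps)
  have node: "real k * \<epsilon> \<le> H / 1024" if "k \<le> 2 * m" for k
  proof -
    have "real k * \<epsilon> \<le> real (2 * m) * \<epsilon>" using that \<epsilon> by (intro mult_right_mono) auto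
    also have "\<dots> = H / 1024" using m by (simp add: \<epsilon>_def)
    finally show ?thesis .
  qed
  obtain \<nu> where \<nu>: "\<And>y. 1 \<le> y \<Longrightarrow> y \<le> 2 * m \<Longrightarrow> (\<Sum>k=1..2*m. \<nu> k * (real k * \<epsilon>) ^ y) = (if y = i then fact i else 0)"
    and \<nu>_sum: "(\<Sum>k=1..2*m. \<bar>\<nu> k\<bar>) \<le> 16 ^ (2 * m) / \<epsilon> ^ i"
    using i \<epsilon> by (elim moment_localizing_weights[of i "2 * m" \<epsilon>, rotated 3]) simp_all
  have \<nu>_K: "(\<Sum>k=1..2*m. \<bar>\<nu> k\<bar>) \<le> K"
    using \<nu>_sum unfolding K_def power_mult by simp
  define \<mu> where "\<mu> k = (if k = 0 then - (\<Sum>k=1..2*m. exp (real k * \<epsilon>) * \<nu> k) else exp (real k * \<epsilon>) * \<nu> k)" for k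
  define q where "q y = (\<Sum>k\<le>2*m. \<mu> k * likelihood (real k * \<epsilon>) y)" for y
  have atMost: "{..2*m} = insert 0 {1..2*m}" by auto
  have \<mu>_total: "(\<Sum>k\<le>2*m. \<mu> k) = 0"
    unfolding atMost by (simp add: \<mu>_def)
  have q_Suc: "q y = (\<Sum>k=1..2*m. \<nu> k * (real k * \<epsilon>) ^ y) / fact y" if "1 \<le> y" for y
  proof -
    have "q y = (\<Sum>k=1..2*m. \<mu> k * likelihood (real k * \<epsilon>) y)"
      unfolding q_def atMost using that by (simp add: likelihood_eq[of 0] zero_power)
    also have "\<dots> = (\<Sum>k=1..2*m. \<nu> k * (real k * \<epsilon>) ^ y / fact y)"
      using \<epsilon> by (intro sum.cong) (auto simp: \<mu>_def likelihood_eq exp_minus)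
    finally show ?thesis by (simp add: sum_divide_distrib)
  qed
  have q_i: "q i = 1" using \<nu>[of i] i by (simp add: q_Suc)
  have q_0: "q y = 0" if "1 \<le> y" "y \<le> 2 * m" "y \<noteq> i" for y
    using \<nu>[of y] that by (simp add: q_Suc)
  have q_abs: "\<bar>q y\<bar> \<le> K * ((H / 1024) ^ y / fact y)" if "1 \<le> y" for y
  proof -
    have "\<bar>\<Sum>k=1..2*m. \<nu> k * (real k * \<epsilon>) ^ y\<bar> \<le> (\<Sum>k=1..2*m. \<bar>\<nu> k\<bar> * (H / 1024) ^ y)"
      using \<epsilon> node
      by (intro order_trans[OF sum_abs] sum_mono) (auto simp: abs_mult intro!: mult_left_mono power_mono)
    also have "\<dots> \<le> K * (H / 1024) ^ y"
      unfolding sum_distrib_right[symmetric] using \<nu>_K H by (intro mult_right_mono) auto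
    finally have "\<bar>\<Sum>k=1..2*m. \<nu> k * (real k * \<epsilon>) ^ y\<bar> / fact y \<le> K * (H / 1024) ^ y / fact y"
      by (rule divide_right_mono) simp
    then show ?thesis
      unfolding q_Suc[OF that] abs_divide by simp
  qed
  have q_geometric: "\<bar>q y\<bar> \<le> K * (3 * \<epsilon>) ^ y" if y: "2 * m < y" for y
  proof -
    have "H / 1024 = real (2 * m) * \<epsilon>" using m by (simp add: \<epsilon>_def)
    also have "\<dots> \<le> real y * \<epsilon>" using y \<epsilon> by (intro mult_right_mono) auto
    finally have "(H / 1024) ^ y / fact y \<le> (real y * \<epsilon>) ^ y / fact y"
      using H by (intro divide_right_mono power_mono) auto
    also have "\<dots> = real y ^ y / fact y * \<epsilon> ^ y" by (simp add: power_mult_distrib)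
    also have "\<dots> \<le> exp (real y) * \<epsilon> ^ y"
      using \<epsilon> by (intro mult_right_mono power_over_fact_le_exp) auto
    also have "exp (real y) = exp 1 ^ y"
      by (simp add: exp_of_nat_mult[symmetric])
    also have "exp 1 ^ y * \<epsilon> ^ y \<le> 3 ^ y * \<epsilon> ^ y"
      using \<epsilon> exp_le by (intro mult_right_mono power_mono) auto
    finally have "(H / 1024) ^ y / fact y \<le> (3 * \<epsilon>) ^ y" by (simp add: power_mult_distrib)
    moreover have "0 \<le> K" using \<epsilon> by (simp add: K_def)
    ultimately show ?thesis
      using y by (intro order_trans[OF q_abs] mult_left_mono) auto
  qed
  have "\<bar>q 0\<bar> \<le> 2"
  proof -
    have "q sums (\<Sum>k\<le>2*m. \<mu> k * 1)"
      unfolding q_def by (intro sums_sum sums_mult sums_likelihood)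
    then have "q sums 0" by (simp add: \<mu>_total)
    then have *: "(\<lambda>y. q (y + Suc (2 * m))) sums (0 - (\<Sum>y<Suc (2*m). q y))"
      by (rule sums_split_initial_segment)
    have "(\<Sum>y<Suc (2*m). q y) = q 0 + (\<Sum>y=1..2*m. q y)"
      unfolding lessThan_Suc_atMost atMost by simp
    also have "(\<Sum>y=1..2*m. q y) = q i + (\<Sum>y\<in>{1..2*m} - {i}. q y)"
      using i by (intro sum.remove) auto
    also have "(\<Sum>y\<in>{1..2*m} - {i}. q y) = 0"
      using q_0 by (intro sum.neutral) auto
    finally have head: "(\<Sum>y<Suc (2*m). q y) = q 0 + 1"
      by (simp only: q_i add_0_right)
    have tail: "(\<lambda>y. q (y + Suc (2 * m))) sums (- (q 0 + 1))"
      using * unfolding head by simp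
    define a where "a = 3 * \<epsilon>"
    have a: "0 < a" "2 * a \<le> 1" using \<epsilon> \<epsilon>_small by (auto simp: a_def)
    have geo: "(\<lambda>y. K * a ^ Suc (2 * m) * a ^ y) sums (K * a ^ Suc (2 * m) * (1 / (1 - a)))"
      using a by (intro sums_mult geometric_sums) auto
    have bound: "norm (q (y + Suc (2 * m))) \<le> K * a ^ Suc (2 * m) * a ^ y" for y
      using q_geometric[of "y + Suc (2 * m)"] unfolding a_def[symmetric] power_add[of a y]
      by (simp only: real_norm_def mult_ac)
    have "norm (\<Sum>y. q (y + Suc (2 * m))) \<le> (\<Sum>y. K * a ^ Suc (2 * m) * a ^ y)"
      by (rule norm_suminf_le[OF bound sums_summable[OF geo]])
    then have "\<bar>q 0 + 1\<bar> \<le> K * a ^ Suc (2 * m) * (1 / (1 - a))"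
      unfolding sums_unique[OF tail, symmetric] sums_unique[OF geo, symmetric] by (simp only: real_norm_def abs_minus_cancel)
    also have "\<dots> = K * a ^ (2 * m) * (a / (1 - a))" by simp
    also have "\<dots> \<le> K * a ^ (2 * m) * 1"
      using a \<epsilon> by (intro mult_left_mono) (auto simp: K_def)
    also have "\<dots> = (2304 * \<epsilon>) ^ m * \<epsilon> ^ (m - i)"
    proof -
      have "a ^ (2 * m) = 9 ^ m * \<epsilon> ^ m * \<epsilon> ^ m"
        by (simp add: a_def power_mult power2_eq_square power_mult_distrib)
      moreover have "\<epsilon> ^ (m - i) = \<epsilon> ^ m / \<epsilon> ^ i"
        using i \<epsilon> by (simp add: power_diff)
      moreover have "(2304::real) ^ m = 256 ^ m * 9 ^ m"
        unfolding power_mult_distrib[symmetric] by simp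
      ultimately show ?thesis by (simp add: K_def power_mult_distrib)
    qed
    also have "\<dots> \<le> 1 * 1"
      using \<epsilon> \<epsilon>_small by (intro mult_mono power_le_one) auto
    finally show ?thesis by linarith
  qed
  moreover have "\<bar>\<mu> k\<bar> \<le> exp H * K" if k: "k \<le> 2 * m" for k
  proof -
    have e: "exp (real k * \<epsilon>) \<le> exp H" if "k \<le> 2 * m" for k
      using node[OF that] H by simp
    have sum: "(\<Sum>k=1..2*m. exp (real k * \<epsilon>) * \<bar>\<nu> k\<bar>) \<le> exp H * K"
    proof -
      have "(\<Sum>k=1..2*m. exp (real k * \<epsilon>) * \<bar>\<nu> k\<bar>) \<le> (\<Sum>k=1..2*m. exp H * \<bar>\<nu> k\<bar>)"
        using e by (intro sum_mono mult_right_mono) auto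
      also have "\<dots> \<le> exp H * K"
        unfolding sum_distrib_left[symmetric] using \<nu>_K by (intro mult_left_mono) auto
      finally show ?thesis .
    qed
    show ?thesis
    proof (cases "k = 0")
      case True
      have "\<bar>\<Sum>k=1..2*m. exp (real k * \<epsilon>) * \<nu> k\<bar> \<le> (\<Sum>k=1..2*m. \<bar>exp (real k * \<epsilon>) * \<nu> k\<bar>)"
        by (rule sum_abs)
      with sum True show ?thesis by (simp add: \<mu>_def abs_mult)
    next
      case False
      have "exp (real k * \<epsilon>) * \<bar>\<nu> k\<bar> \<le> (\<Sum>k=1..2*m. exp (real k * \<epsilon>) * \<bar>\<nu> k\<bar>)"
        using k False by (intro member_le_sum) auto
      with sum False show ?thesis by (simp add: \<mu>_def abs_mult)
    qed
  qed
  ultimately have "localized_direction H m i \<mu> q"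
    using q_i q_0 q_abs i \<mu>_total
    unfolding localized_direction_def grid_step_def \<epsilon>_def[symmetric] K_def[symmetric] by (auto simp: q_def)
  then show ?thesis by blast
qed

text \<open>
  The three parts of \<open>7 = 4 + 1 + 2\<close> come from \<open>y = 0\<close>, from \<open>y = i\<close> and from the tail \<open>y > 2 m\<close>. The
  origin is cheap because \<open>f0\<close> is no smaller there than at \<open>i\<close>. In the tail, \<open>f0\<close> is bounded below by the atom at \<open>H\<close>, and the
  quotient decays geometrically because the grid is short.
\<close>

lemma localized_direction_chi_square:
  fixes f0 q :: "nat \<Rightarrow> real"
  assumes dir: "localized_direction H m i \<mu> q"
    and H: "0 < H" "6 * H \<le> real m" and i: "1 \<le> i" "i \<le> m" "3 * H \<le> real i" and \<eta>: "0 < \<eta>"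
    and f0_pos: "\<And>y. 0 < f0 y" and f0_ge: "\<And>y. \<eta> / 2 * likelihood H y \<le> f0 y"
    and origin: "f0 i \<le> f0 0" and upper: "f0 i \<le> \<eta> * likelihood H i"
  shows "(\<integral>\<^sup>+y. ennreal ((q y)\<^sup>2 / f0 y) \<partial>count_space UNIV) \<le> ennreal (7 / f0 i)"
proof -
  define \<epsilon> where "\<epsilon> = grid_step H m"
  note \<epsilon>_def' = \<epsilon>_def[unfolded grid_step_def]
  have m: "0 < real m" using i by simp
  have \<epsilon>: "0 < \<epsilon>" "\<epsilon> \<le> 1" using H m by (auto simp: \<epsilon>_def' field_simps)
  have q_1: "q i = 1" and q_origin: "\<bar>q 0\<bar> \<le> 2"
    and q_0: "1 \<le> y \<Longrightarrow> y \<le> 2 * m \<Longrightarrow> y \<noteq> i \<Longrightarrow> q y = 0"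
    and q_tail: "2 * m < y \<Longrightarrow> \<bar>q y\<bar> \<le> 256 ^ m / \<epsilon> ^ i * ((H / 1024) ^ y / fact y)" for y
    using dir unfolding localized_direction_def \<epsilon>_def by blast+
  define h where "h y = (if 2 * m < y then 2 * (1 / 2) ^ (y - 2 * m) else 0 :: real)" for y
  define D where "D y = 1 / f0 i * (4 * indicator {0} y + indicator {i} y + h y)" for y
  have fi: "0 < 1 / f0 i" using f0_pos[of i] by simp
  have "(q y)\<^sup>2 / f0 y \<le> D y" for y
  proof -
    consider "y = 0" | "y = i" | "1 \<le> y" "y \<le> 2 * m" "y \<noteq> i" | "2 * m < y" by linarith
    then show ?thesis
    proof cases
      case 1
      have "\<bar>q 0\<bar>\<^sup>2 \<le> 2\<^sup>2"
        by (intro power_mono q_origin) simp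
      then have "(q 0)\<^sup>2 / f0 0 \<le> 4 / f0 i"
        using origin f0_pos[of i] by (intro frac_le) auto
      then show ?thesis using 1 i by (simp add: D_def h_def)
    next
      case 2
      then show ?thesis using q_1 i by (simp add: D_def h_def)
    next
      case 3
      then show ?thesis using q_0 fi by (simp add: D_def h_def)
    next
      case 4
      define K where "K = 256 ^ m / \<epsilon> ^ i"
      define a where "a = 3 * \<epsilon> / 1024"
      have a: "0 \<le> a" "a \<le> 1 / 2" using \<epsilon> by (auto simp: a_def)
      have K: "0 \<le> K" using \<epsilon> by (simp add: K_def)
      have "(q y)\<^sup>2 \<le> (K * ((H / 1024) ^ y / fact y))\<^sup>2"
        using power_mono[OF q_tail[OF 4], of 2] by (simp add: K_def)
      moreover have "\<eta> / 2 * (H ^ y / fact y * exp (- H)) \<le> f0 y"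
        using f0_ge[of y] H by (simp add: likelihood_eq)
      moreover have "0 < \<eta> / 2 * (H ^ y / fact y * exp (- H))" using \<eta> H by simp
      ultimately have "(q y)\<^sup>2 / f0 y \<le> (K * ((H / 1024) ^ y / fact y))\<^sup>2 / (\<eta> / 2 * (H ^ y / fact y * exp (- H)))"
        by (intro frac_le) auto
      also have "\<dots> = 2 * exp H / \<eta> * (K\<^sup>2 * ((H / 1048576) ^ y / fact y))"
      proof -
        define c where "c = (1 / 1024 :: real) ^ y"
        have c: "(H / 1024) ^ y = H ^ y * c" "(H / 1048576) ^ y = H ^ y * (c * c)"
          unfolding c_def power_mult_distrib[symmetric] by simp_all
        have "(K * (A * c / F))\<^sup>2 / (\<eta> / 2 * (A / F * (1 / e))) = 2 * e / \<eta> * (K\<^sup>2 * (A * (c * c) / F))"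
          if "0 < A" "0 < F" "0 < e" for A F e
          using that \<eta> by (simp add: field_simps power2_eq_square)
        from this[of "H ^ y" "fact y" "exp H"] show ?thesis
          unfolding c using H by (simp add: exp_minus inverse_eq_divide)
      qed
      also have "\<dots> \<le> 2 * exp H / \<eta> * (K\<^sup>2 * a ^ y)"
      proof (intro mult_left_mono)
        have "H / 1048576 = real (2 * m) * (\<epsilon> / 1024)" using m by (simp add: \<epsilon>_def')
        also have "\<dots> \<le> real y * (\<epsilon> / 1024)" using 4 \<epsilon> by (intro mult_right_mono) auto
        finally have "(H / 1048576) ^ y / fact y \<le> (real y * (\<epsilon> / 1024)) ^ y / fact y"
          using H by (intro divide_right_mono power_mono) auto
        also have "\<dots> = real y ^ y / fact y * (\<epsilon> / 1024) ^ y" by (simp only: power_mult_distrib times_divide_eq_left)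
        also have "\<dots> \<le> exp (real y) * (\<epsilon> / 1024) ^ y"
          using \<epsilon> by (intro mult_right_mono power_over_fact_le_exp) auto
        also have "exp (real y) = exp 1 ^ y"
          by (simp add: exp_of_nat_mult[symmetric])
        also have "exp 1 ^ y * (\<epsilon> / 1024) ^ y \<le> 3 ^ y * (\<epsilon> / 1024) ^ y"
          using \<epsilon> exp_le by (intro mult_right_mono power_mono) auto
        also have "\<dots> = a ^ y" unfolding power_mult_distrib[symmetric] by (simp add: a_def)
        finally show "(H / 1048576) ^ y / fact y \<le> a ^ y" .
      qed (use \<eta> in auto)
      also have "K\<^sup>2 * a ^ y \<le> (1 / 2) ^ (y - 2 * m)"
      proof -
        have "a ^ y = a ^ (2 * m) * a ^ (y - 2 * m)" using 4 by (simp flip: power_add)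
        moreover have "K\<^sup>2 * a ^ (2 * m) \<le> 1"
        proof -
          have "256 ^ m * a ^ m = (256 * 3 / 1024) ^ m * \<epsilon> ^ m"
            unfolding power_mult_distrib[symmetric] by (simp add: a_def)
          then have "K * a ^ m = (256 * 3 / 1024) ^ m * (\<epsilon> ^ m / \<epsilon> ^ i)"
            by (simp only: K_def times_divide_eq_left times_divide_eq_right)
          also have "\<epsilon> ^ m / \<epsilon> ^ i = \<epsilon> ^ (m - i)"
            using \<epsilon> i by (simp add: power_diff)
          also have "(256 * 3 / 1024) ^ m * \<epsilon> ^ (m - i) \<le> 1 * 1"
            using \<epsilon> by (intro mult_mono power_le_one) auto
          finally have "K * a ^ m \<le> 1" by simp
          then have "(K * a ^ m)\<^sup>2 \<le> 1" using K a by (intro power_le_one) auto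
          then show ?thesis by (simp only: power_mult_distrib power_mult[symmetric] mult.commute)
        qed
        moreover have "a ^ (y - 2 * m) \<le> (1 / 2) ^ (y - 2 * m)" using a by (intro power_mono) auto
        ultimately have "K\<^sup>2 * a ^ (2 * m) * a ^ (y - 2 * m) \<le> 1 * (1 / 2) ^ (y - 2 * m)"
          using a by (intro mult_mono) auto
        then show ?thesis using \<open>a ^ y = _\<close> by (simp only: mult.assoc mult_1)
      qed
      finally have "(q y)\<^sup>2 / f0 y \<le> exp H / \<eta> * (2 * (1 / 2) ^ (y - 2 * m))"
        using \<eta> by (simp add: mult_left_mono divide_right_mono mult_ac)
      also have "\<dots> \<le> 1 / f0 i * (2 * (1 / 2) ^ (y - 2 * m))"
      proof (intro mult_right_mono)
        have "f0 i \<le> \<eta> * (H ^ i / fact i * exp (- H))"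
          using upper H by (simp add: likelihood_eq)
        also have "\<dots> \<le> \<eta> * (1 * exp (- H))"
          using power_le_fact[of H i] i H \<eta> by (intro mult_left_mono mult_right_mono) auto
        finally show "exp H / \<eta> \<le> 1 / f0 i"
          using \<eta> f0_pos[of i] by (simp add: exp_minus field_simps)
      qed auto
      also have "\<dots> = D y" using 4 i by (auto simp: D_def h_def)
      finally show ?thesis .
    qed
  qed
  then have "(\<integral>\<^sup>+y. ennreal ((q y)\<^sup>2 / f0 y) \<partial>count_space UNIV) \<le> (\<integral>\<^sup>+y. ennreal (D y) \<partial>count_space UNIV)"
    by (intro nn_integral_mono ennreal_leI)
  also have "\<dots> = ennreal (7 / f0 i)"
  proof -
    have "(\<lambda>k. h (k + Suc (2 * m))) = (\<lambda>k. (1 / 2) ^ k)"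
      by (auto simp: h_def fun_eq_iff)
    moreover have "(\<lambda>k. (1 / 2 :: real) ^ k) sums 2" using geometric_sums[of "1 / 2 :: real"] by simp
    moreover have "(\<Sum>y<Suc (2 * m). h y) = 0" by (intro sum.neutral) (auto simp: h_def)
    ultimately have h: "h sums 2"
      using sums_iff_shift[of h "Suc (2 * m)" 2] by (simp only: add_0_right)
    have ind: "(\<lambda>y. indicator {z} y :: real) sums 1" for z :: nat
      using sums_finite[of "{z}" "indicator {z} :: nat \<Rightarrow> real"] by simp
    have "(\<lambda>y. 4 * indicator {0} y + indicator {i} y + h y) sums (4 * 1 + 1 + 2)"
      by (intro sums_add sums_mult h ind)
    from sums_mult[OF this, of "1 / f0 i"] have D: "D sums (7 / f0 i)"
      by (simp add: D_def[abs_def])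
    have "0 \<le> D y" for y using fi by (simp add: D_def h_def)
    then show ?thesis unfolding nn_integral_count_space_nat by (intro suminf_ennreal_eq D)
  qed
  finally show ?thesis .
qed

section \<open>Minimax lower bound\<close>

definition discrete_prior :: "nat \<Rightarrow> (nat \<Rightarrow> real) \<Rightarrow> (nat \<Rightarrow> real) \<Rightarrow> real measure" where
  "discrete_prior K w x = distr (point_measure {..K} (\<lambda>k. ennreal (w k))) borel x"

context
  fixes K :: nat and w x :: "nat \<Rightarrow> real"
  assumes w: "\<And>k. k \<le> K \<Longrightarrow> 0 \<le> w k" "(\<Sum>k\<le>K. w k) = 1"
    and x: "\<And>k. k \<le> K \<Longrightarrow> 0 \<le> x k"
begin

lemma measurable_atoms: "x \<in> point_measure {..K} (\<lambda>k. ennreal (w k)) \<rightarrow>\<^sub>M borel"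
  by (simp add: measurable_point_measure_eq1)

lemma emeasure_discrete_prior:
  assumes "A \<in> sets borel"
  shows "emeasure (discrete_prior K w x) A = ennreal (\<Sum>k\<le>K. w k * indicator A (x k))"
proof -
  have "emeasure (discrete_prior K w x) A = emeasure (point_measure {..K} (\<lambda>k. ennreal (w k))) (x -` A \<inter> {..K})"
    unfolding discrete_prior_def using assms measurable_atoms by (simp add: emeasure_distr space_point_measure)
  also have "\<dots> = (\<Sum>k\<in>x -` A \<inter> {..K}. ennreal (w k))"
    by (rule emeasure_point_measure_finite) auto
  also have "\<dots> = (\<Sum>k\<le>K. ennreal (w k * indicator A (x k)))"
    by (rule sum.mono_neutral_cong_left) (auto simp: indicator_def split: if_splits)
  also have "\<dots> = ennreal (\<Sum>k\<le>K. w k * indicator A (x k))"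
    using w by (intro sum_ennreal) auto
  finally show ?thesis .
qed

lemma measure_discrete_prior:
  assumes "A \<in> sets borel"
  shows "measure (discrete_prior K w x) A = (\<Sum>k\<le>K. w k * indicator A (x k))"
  using w unfolding measure_def emeasure_discrete_prior[OF assms]
  by (subst enn2real_ennreal) (auto intro!: sum_nonneg)

lemma poisson_prior_discrete: "poisson_prior (discrete_prior K w x)"
proof -
  have sets: "sets (discrete_prior K w x) = sets borel"
    by (simp add: discrete_prior_def)
  interpret prob_space "discrete_prior K w x"
    by (rule prob_spaceI) (simp add: emeasure_discrete_prior w discrete_prior_def[of K w x, THEN arg_cong, of space])
  have "AE \<theta> in discrete_prior K w x. 0 \<le> \<theta>"
    unfolding discrete_prior_def
    by (subst AE_distr_iff[OF measurable_atoms]) (auto simp: AE_point_measure x)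
  with sets show ?thesis by unfold_locales
qed

lemma mixture_discrete_prior:
  "poisson_prior.mixture (discrete_prior K w x) y = (\<Sum>k\<le>K. w k * likelihood (x k) y)"
proof -
  interpret poisson_prior "discrete_prior K w x" by (rule poisson_prior_discrete)
  have "mixture y = (\<integral>k. likelihood (x k) y \<partial>point_measure {..K} (\<lambda>k. ennreal (w k)))"
    unfolding mixture_def unfolding discrete_prior_def by (rule integral_distr[OF measurable_atoms]) simp
  also have "\<dots> = (\<Sum>k\<le>K. w k * likelihood (x k) y)"
    using w by (subst lebesgue_integral_point_measure_finite) auto
  finally show ?thesis .
qed

end

text \<open>
  The base prior has weight \<open>1 - \<eta>\<close> at \<open>0\<close>, \<open>\<eta> / 2\<close> at \<open>H\<close>, and \<open>\<eta> / 2\<close> spread evenly over the grid. At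
  \<open>y \<ge> H\<close> its mixture is \<open>\<eta>\<close> times the likelihood of \<open>H\<close> up to a factor 2, so neighbouring masses have a ratio of
  order \<open>H / y\<close>. The amplitude \<open>\<delta>\<^sub>i\<^sup>2 = f0 i / (14 n)\<close> makes the chi-square distance along an edge at most
  \<open>1 / (2 n)\<close>, as \<open>two_point\<close> requires. The hypothesis on \<open>n\<close> keeps every weight between half and twice its base value.
  Only \<open>i > m / 2\<close> are used, which ensures \<open>3 H \<le> i\<close> and \<open>H \<le> i - 1\<close>.
\<close>

lemma regret_lower_bound:
  fixes H \<eta> :: real and m n :: nat
  assumes m: "2 \<le> m" and n: "1 \<le> n" and H: "0 < H" "6 * H \<le> real m" and \<eta>: "0 < \<eta>" "\<eta> \<le> 1 / 2"
    and size: "8 * (real m)\<^sup>2 * exp H * (524288 * real m / H) ^ m \<le> \<eta> * sqrt (real n)"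
    and in_class: "\<And>G. poisson_prior G \<Longrightarrow> measure G {0..H} = 1 \<Longrightarrow>
        (\<And>t. 0 < t \<Longrightarrow> measure G {t..} \<le> 2 * \<eta>) \<Longrightarrow> G \<in> \<G>"
    and T: "T \<in> estimators n"
  shows "ereal ((real m)\<^sup>2 * H / 1792) \<le> max_regret n \<G> T"
proof -
  define \<epsilon> where "\<epsilon> = grid_step H m"
  note \<epsilon>_def' = \<epsilon>_def[unfolded grid_step_def]
  have \<epsilon>: "0 < \<epsilon>" "\<epsilon> \<le> 1" using H m by (auto simp: \<epsilon>_def' field_simps)
  define N where "N = 2 * m + 1"
  define node where "node k = (if k \<le> 2 * m then real k * \<epsilon> else H)" for k
  define w0 where "w0 k = (if k = 0 then 1 - \<eta> else if k \<le> 2 * m then \<eta> / (4 * real m) else \<eta> / 2)" for k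
  define f0 where "f0 y = (\<Sum>k\<le>N. w0 k * likelihood (node k) y)" for y
  define I where "I = {m div 2 + 1..m}"
  have split_N: "(\<Sum>k\<le>N. g k) = (\<Sum>k\<le>2*m. g k) + g N" for g :: "nat \<Rightarrow> real"
    by (simp add: N_def)
  have split_0: "(\<Sum>k\<le>2*m. g k) = g 0 + (\<Sum>k=1..2*m. g k)" for g :: "nat \<Rightarrow> real"
  proof -
    have "{..2*m} = insert 0 {1..2*m}" by auto
    then show ?thesis by simp
  qed
  have node: "0 \<le> node k" "node k \<le> H" for k
  proof -
    have "real k * \<epsilon> \<le> real (2 * m) * \<epsilon>" if "k \<le> 2 * m"
      using that \<epsilon> by (intro mult_right_mono) auto
    moreover have "real (2 * m) * \<epsilon> \<le> H" using H m by (simp add: \<epsilon>_def')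
    ultimately show "node k \<le> H" by (auto simp: node_def)
  qed (use H \<epsilon> in \<open>auto simp: node_def\<close>)
  have node_N: "node N = H" and w0_N: "w0 N = \<eta> / 2"
    using m by (auto simp: N_def node_def w0_def)
  have w0_pos: "0 < w0 k" and w0_ge: "k \<le> 2 * m \<Longrightarrow> \<eta> / (4 * real m) \<le> w0 k" for k
  proof -
    have "\<eta> / (4 * real m) \<le> \<eta> / 1" using \<eta> m by (intro divide_left_mono) auto
    then show "k \<le> 2 * m \<Longrightarrow> \<eta> / (4 * real m) \<le> w0 k"
      using \<eta> by (auto simp: w0_def)
    show "0 < w0 k" using \<eta> m by (auto simp: w0_def)
  qed
  have w0_tail: "(\<Sum>k=1..2*m. w0 k) = \<eta> / 2"
  proof -
    have "(\<Sum>k=1..2*m. w0 k) = (\<Sum>k=1..2*m. \<eta> / (4 * real m))"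
      by (intro sum.cong) (auto simp: w0_def)
    also have "\<dots> = \<eta> / 2" using m by simp
    finally show ?thesis .
  qed
  have w0_total: "(\<Sum>k\<le>N. w0 k) = 1"
    unfolding split_N split_0 w0_tail w0_N by (simp add: w0_def)

  have f0_ge: "\<eta> / 2 * likelihood H y \<le> f0 y" for y
    unfolding f0_def split_N node_N w0_N using w0_pos[THEN less_imp_le] by (simp add: sum_nonneg)
  have f0_pos: "0 < f0 y" for y
  proof -
    have "0 < \<eta> / 2 * likelihood H y" using \<eta> H by (simp add: likelihood_eq)
    then show ?thesis using f0_ge[of y] by linarith
  qed
  have f0_le: "f0 y \<le> \<eta> * likelihood H y" if y: "1 \<le> y" "H \<le> real y" for y
  proof -
    have "(\<Sum>k=1..2*m. w0 k * likelihood (node k) y) \<le> (\<Sum>k=1..2*m. w0 k * likelihood H y)"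
      using node y H w0_pos[THEN less_imp_le] by (intro sum_mono mult_left_mono likelihood_mono_below) auto
    also have "\<dots> = \<eta> / 2 * likelihood H y"
      by (simp only: sum_distrib_right[symmetric] w0_tail)
    finally show ?thesis
      unfolding f0_def split_N split_0 node_N w0_N using y
      by (simp add: node_def[of 0] likelihood_eq[of 0] zero_power)
  qed
  have f0_0: "1 / 2 \<le> f0 0"
  proof -
    have "w0 0 * likelihood (node 0) 0 \<le> f0 0"
      unfolding f0_def using w0_pos[THEN less_imp_le] by (intro member_le_sum) auto
    then show ?thesis using \<eta> by (simp add: w0_def node_def likelihood_eq)
  qed
  have I: "finite I" "I \<noteq> {}" "card I \<le> m" "real m \<le> 2 * real (card I)"
    using m by (auto simp: I_def)
  have I_ge: "1 \<le> i" "2 \<le> i" "i \<le> m" "real m \<le> 2 * real i" "3 * H \<le> real i" "H \<le> real (i - 1)" if "i \<in> I" for i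
  proof -
    show i: "1 \<le> i" "2 \<le> i" "i \<le> m" using that m by (auto simp: I_def)
    have "m + 1 \<le> 2 * i" using that by (auto simp: I_def)
    then have "real m + 1 \<le> 2 * real i" by linarith
    then show "real m \<le> 2 * real i" "3 * H \<le> real i" "H \<le> real (i - 1)"
      using H m i by (auto simp: of_nat_diff)
  qed
  have f0_le_1: "f0 i \<le> 1 / 2" if "i \<in> I" for i
  proof -
    have "f0 i \<le> \<eta> * likelihood H i"
      using I_ge[OF that] H by (intro f0_le) auto
    also have "\<dots> \<le> \<eta> * 1" using \<eta> likelihood_le_1 by (intro mult_left_mono) auto
    finally show ?thesis using \<eta> by simp
  qed

  have "\<forall>i\<in>I. \<exists>\<mu> q. localized_direction H m i \<mu> q"
    using ex_localized_direction[OF H] I_ge by auto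
  from bchoice[OF this] obtain \<mu> where "\<forall>i\<in>I. \<exists>q. localized_direction H m i (\<mu> i) q" ..
  from bchoice[OF this] obtain q where dir: "\<forall>i\<in>I. localized_direction H m i (\<mu> i) (q i)" ..
  have q: "q i y = (\<Sum>k\<le>2*m. \<mu> i k * likelihood (real k * \<epsilon>) y)"
    and \<mu>_total: "(\<Sum>k\<le>2*m. \<mu> i k) = 0"
    and \<mu>_le: "k \<le> 2*m \<Longrightarrow> \<bar>\<mu> i k\<bar> \<le> exp H * (256 ^ m / \<epsilon> ^ i)"
    and q_1: "q i i = 1"
    and q_0: "1 \<le> y \<Longrightarrow> y \<le> 2 * m \<Longrightarrow> y \<noteq> i \<Longrightarrow> q i y = 0" if "i \<in> I" for i y k
    using bspec[OF dir that] unfolding localized_direction_def \<epsilon>_def by blast+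

  have \<chi>: "(\<integral>\<^sup>+y. ennreal ((q i y)\<^sup>2 / f0 y) \<partial>count_space UNIV) \<le> ennreal (7 / f0 i)" if i: "i \<in> I" for i
  proof (rule localized_direction_chi_square)
    show "localized_direction H m i (\<mu> i) (q i)" using dir i by blast
    show "f0 i \<le> f0 0" using f0_0 f0_le_1[OF i] by linarith
    show "f0 i \<le> \<eta> * likelihood H i" using I_ge[OF i] H by (intro f0_le) auto
  qed (use I_ge[OF i] H \<eta> f0_pos f0_ge in auto)

  define \<delta> where "\<delta> i = sqrt (f0 i / (14 * real n))" for i
  have \<delta>_nonneg: "0 \<le> \<delta> i" for i using f0_pos[of i] by (simp add: \<delta>_def)
  have \<delta>_sq: "(\<delta> i)\<^sup>2 = f0 i / (14 * real n)" for i using f0_pos[of i] by (simp add: \<delta>_def)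
  have \<delta>_le: "\<delta> i \<le> 1 / sqrt (real n)" if "i \<in> I" for i
  proof -
    have "f0 i / (14 * real n) \<le> 1 / real n"
      using f0_le_1[OF that] n by (simp add: field_simps)
    then show ?thesis unfolding \<delta>_def by (metis real_sqrt_divide real_sqrt_le_mono real_sqrt_one)
  qed

  define w where "w S k = w0 k + (if k \<le> 2 * m then \<Sum>i\<in>S. \<delta> i * \<mu> i k else 0)" for S k
  define G where "G S = discrete_prior N (w S) node" for S
  define f where "f S y = (\<Sum>k\<le>N. w S k * likelihood (node k) y)" for S y
  (* Even with all perturbations switched on, no grid weight changes by more than half. *)
  have perturb: "\<bar>\<Sum>i\<in>S. \<delta> i * \<mu> i k\<bar> \<le> w0 k / 2" if S: "S \<subseteq> I" and k: "k \<le> 2 * m" for S k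
  proof -
    have fin: "finite S" using S I by (auto intro: finite_subset)
    have "\<bar>\<Sum>i\<in>S. \<delta> i * \<mu> i k\<bar> \<le> (\<Sum>i\<in>S. 1 / sqrt (real n) * (exp H * (256 ^ m / \<epsilon> ^ m)))"
    proof (intro order_trans[OF sum_abs] sum_mono)
      fix i assume "i \<in> S"
      then have i: "i \<in> I" using S by auto
      have "256 ^ m / \<epsilon> ^ i \<le> 256 ^ m / \<epsilon> ^ m"
        using \<epsilon> I_ge(3)[OF i] by (intro divide_left_mono power_decreasing) auto
      then have "\<bar>\<mu> i k\<bar> \<le> exp H * (256 ^ m / \<epsilon> ^ m)"
        by (intro order_trans[OF \<mu>_le[OF i k]] mult_left_mono) auto
      then show "\<bar>\<delta> i * \<mu> i k\<bar> \<le> 1 / sqrt (real n) * (exp H * (256 ^ m / \<epsilon> ^ m))"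
        using \<delta>_le[OF i] \<delta>_nonneg[of i] unfolding abs_mult by (intro mult_mono) auto
    qed
    also have "\<dots> \<le> real m * (1 / sqrt (real n) * (exp H * (256 ^ m / \<epsilon> ^ m)))"
    proof -
      have "card S \<le> m" using card_mono[OF I(1) S] I(3) by simp
      then show ?thesis
        unfolding sum_constant using \<epsilon> by (intro mult_right_mono) auto
    qed
    also have "256 ^ m / \<epsilon> ^ m = (524288 * real m / H) ^ m"
      unfolding power_divide[symmetric] by (simp add: \<epsilon>_def')
    also have "real m * (1 / sqrt (real n) * (exp H * (524288 * real m / H) ^ m)) \<le> \<eta> / (4 * real m) / 2"
    proof -
      have "a * (1 / s * (b * c)) \<le> \<eta> / (4 * a) / 2" if "8 * a\<^sup>2 * b * c \<le> \<eta> * s" "0 < a" "0 < s" for a b c s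
        using that by (simp add: field_simps power2_eq_square)
      from this[OF size] show ?thesis using n m by simp
    qed
    also have "\<dots> \<le> w0 k / 2"
      using w0_ge[OF k] by simp
    finally show ?thesis .
  qed
  have w_bounds: "w0 k / 2 \<le> w S k" "w S k \<le> 2 * w0 k" if "S \<subseteq> I" for S k
    using perturb[OF that, of k] w0_pos[of k] by (auto simp: w_def abs_le_iff)
  have w_nonneg: "0 \<le> w S k" if "S \<subseteq> I" for S k
    using w_bounds(1)[OF that, of k] w0_pos[of k] by linarith
  have w_total: "(\<Sum>k\<le>N. w S k) = 1" if S: "S \<subseteq> I" for S
  proof -
    have "(\<Sum>k\<le>2*m. \<Sum>i\<in>S. \<delta> i * \<mu> i k) = (\<Sum>i\<in>S. \<delta> i * (\<Sum>k\<le>2*m. \<mu> i k))"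
      unfolding sum_distrib_left by (rule sum.swap)
    also have "\<dots> = 0" using \<mu>_total S by (intro sum.neutral) auto
    finally have "(\<Sum>k\<le>N. w S k) = (\<Sum>k\<le>N. w0 k)"
      unfolding split_N by (simp add: w_def sum.distrib N_def)
    with w0_total show ?thesis by simp
  qed
  have f_eq: "f S y = f0 y + (\<Sum>i\<in>S. \<delta> i * q i y)" if S: "S \<subseteq> I" for S y
  proof -
    have "(\<Sum>k\<le>2*m. (\<Sum>i\<in>S. \<delta> i * \<mu> i k) * likelihood (node k) y)
        = (\<Sum>i\<in>S. \<delta> i * (\<Sum>k\<le>2*m. \<mu> i k * likelihood (real k * \<epsilon>) y))"
      unfolding sum_distrib_left sum_distrib_right mult.assoc
      by (subst sum.swap) (intro sum.cong refl, simp add: node_def)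
    also have "\<dots> = (\<Sum>i\<in>S. \<delta> i * q i y)"
      using q S by (intro sum.cong) auto
    finally show ?thesis
      unfolding f_def f0_def split_N by (simp add: w_def distrib_right sum.distrib N_def)
  qed
  have f_bounds: "f0 y / 2 \<le> f S y" "f S y \<le> 2 * f0 y" if "S \<subseteq> I" for S y
  proof -
    have "f0 y / 2 = (\<Sum>k\<le>N. w0 k / 2 * likelihood (node k) y)"
      by (simp add: f0_def sum_divide_distrib)
    also have "\<dots> \<le> f S y"
      unfolding f_def by (intro sum_mono mult_right_mono w_bounds that) auto
    finally show "f0 y / 2 \<le> f S y" .
    have "f S y \<le> (\<Sum>k\<le>N. 2 * w0 k * likelihood (node k) y)"
      unfolding f_def by (intro sum_mono mult_right_mono w_bounds that) auto
    also have "\<dots> = 2 * f0 y"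
      by (simp add: f0_def sum_distrib_left mult.assoc)
    finally show "f S y \<le> 2 * f0 y" .
  qed
  have f_pos: "0 < f S y" if "S \<subseteq> I" for S y
    using f_bounds(1)[OF that, of y] f0_pos[of y] by linarith
  have prior: "poisson_prior (G S)" and mixture: "poisson_prior.mixture (G S) = f S" if "S \<subseteq> I" for S
    using poisson_prior_discrete[of N "w S" node] mixture_discrete_prior[of N "w S" node] w_nonneg[OF that] w_total[OF that] node
    by (auto simp: G_def f_def fun_eq_iff)
  have G_class: "G S \<in> \<G>" if S: "S \<subseteq> I" for S
  proof (rule in_class[OF prior[OF S]])
    note meas = measure_discrete_prior[of N "w S" node, OF w_nonneg[OF S] w_total[OF S] node(1), folded G_def]
    show "measure (G S) {0..H} = 1"
      using node w_total[OF S] by (subst meas) auto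
    fix t :: real assume t: "0 < t"
    have "measure (G S) {t..} = (\<Sum>k\<le>N. w S k * indicator {t..} (node k))"
      by (rule meas) simp
    also have "\<dots> \<le> (\<Sum>k\<in>{1..N}. 2 * w0 k)"
    proof -
      have split: "(\<Sum>k\<le>N. g k) = g 0 + (\<Sum>k\<in>{1..N}. g k)" for g :: "nat \<Rightarrow> real"
      proof -
        have "{..N} = insert 0 {1..N}" by auto
        then show ?thesis by simp
      qed
      have "indicator {t..} (node 0) = (0 :: real)" using t by (simp add: node_def)
      then have "(\<Sum>k\<le>N. w S k * indicator {t..} (node k)) = (\<Sum>k\<in>{1..N}. w S k * indicator {t..} (node k))"
        unfolding split by (simp only: mult_zero_right add_0_left)
      also have "\<dots> \<le> (\<Sum>k\<in>{1..N}. 2 * w0 k)"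
        using w_bounds[OF S] w_nonneg[OF S] w0_pos[THEN less_imp_le] by (intro sum_mono) (auto simp: indicator_def)
      finally show ?thesis .
    qed
    also have "\<dots> = 2 * ((\<Sum>k=1..2*m. w0 k) + w0 N)"
      unfolding sum_distrib_left[symmetric] by (simp add: N_def)
    also have "\<dots> = 2 * \<eta>" unfolding w0_tail w0_N by simp
    finally show "measure (G S) {t..} \<le> 2 * \<eta>" .
  qed

  define R where "R = max_regret n \<G> T"
  define r where "r S = poisson_prior.regret (G S) n T" for S
  have r_le: "enn2ereal (r S) \<le> R" if S: "S \<subseteq> I" for S
  proof -
    interpret poisson_prior "G S" by (rule prior[OF S])
    have "(\<integral>\<^sup>+\<theta>. ennreal (\<theta>\<^sup>2) \<partial>G S) \<le> (\<integral>\<^sup>+\<theta>. ennreal (H\<^sup>2) \<partial>G S)"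
    proof (rule nn_integral_mono_AE)
      have "measure (G S) {0..H} = 1"
        unfolding G_def using node w_total[OF S] w_nonneg[OF S] by (subst measure_discrete_prior) auto
      then have "AE \<theta> in G S. \<theta> \<in> {0..H}"
        by (subst prob_eq_1[symmetric]) auto
      then show "AE \<theta> in G S. ennreal (\<theta>\<^sup>2) \<le> ennreal (H\<^sup>2)"
        by eventually_elim (auto intro!: ennreal_leI power_mono)
    qed
    also have "\<dots> < \<top>" by (simp add: emeasure_space_1[simplified])
    finally have "mmse (G S) < \<top>" using mmse_le_second_moment by (rule le_less_trans[rotated])
    from excess_risk[OF T this] show ?thesis
      unfolding R_def max_regret_def r_def using G_class[OF S] by (intro SUP_upper2[of "G S"]) auto
  qed
  have R_nonneg: "0 \<le> R"
    using r_le[of "{}"] by (rule order_trans[rotated]) auto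

  define l where "l i S = (\<Sum>j<n. \<integral>\<^sup>+Y. ennreal ((T Y j - poisson_prior.posterior_mean (G S) (i - 1))\<^sup>2
      * (\<Prod>k<n. f S (Y k))) * indicator {i - 1} (Y j) \<partial>obs_space n)" for i S
  define g where "g i = ennreal (real i * H / 224)" for i :: nat
  have "(\<Sum>i\<in>I. g i) \<le> 2 * e2ennreal R"
  proof (rule hypercube_average[OF I(1,2)])
    fix S assume S: "S \<subseteq> I"
    interpret poisson_prior "G S" by (rule prior[OF S])
    have "(\<Sum>i\<in>I. l i S) = (\<Sum>j<n. \<Sum>i\<in>I. \<integral>\<^sup>+Y. ennreal ((T Y j - posterior_mean (i - 1))\<^sup>2
      * (\<Prod>k<n. f S (Y k))) * indicator {i - 1} (Y j) \<partial>obs_space n)"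
      unfolding l_def by (rule sum.swap)
    also have "\<dots> = (\<Sum>j<n. \<integral>\<^sup>+Y. (\<Sum>i\<in>I. ennreal ((T Y j - posterior_mean (i - 1))\<^sup>2
      * (\<Prod>k<n. f S (Y k))) * indicator {i - 1} (Y j)) \<partial>obs_space n)"
      unfolding obs_space_eq_count_space by (intro sum.cong nn_integral_sum[symmetric]) auto
    also have "\<dots> \<le> r S"
      unfolding r_def regret_def mixture[OF S] using I(1) I_ge(1)
      by (intro sum_mono nn_integral_mono
          sum_indicator_pred_le[of I "\<lambda>y. ennreal ((T _ _ - posterior_mean y)\<^sup>2 * (\<Prod>k<n. f S (_ k)))"])
    finally show "(\<Sum>i\<in>I. l i S) \<le> r S" .
    show "r S \<le> e2ennreal R"
      using e2ennreal_mono[OF r_le[OF S]] by simp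
  next
    fix i S assume i: "i \<in> I" and "S \<subseteq> I - {i}"
    then have S: "S \<subseteq> I" and S': "insert i S \<subseteq> I" and iS: "i \<notin> S" by auto
    interpret A: poisson_prior "G S" by (rule prior[OF S])
    interpret B: poisson_prior "G (insert i S)" by (rule prior[OF S'])
    have fin: "finite S" using S I(1) by (rule finite_subset)
    have diff: "f (insert i S) y = f S y + \<delta> i * q i y" for y
      unfolding f_eq[OF S] f_eq[OF S'] using fin iS by simp
    have same: "f S (i - 1) = f (insert i S) (i - 1)"
      unfolding diff using q_0[OF i, of "i - 1"] I_ge[OF i] by simp
    have Suc_i: "Suc (i - 1) = i" using I_ge(1)[OF i] by simp
    (* Along an edge only the numerator of the posterior mean at i - 1 changes. *)
    have gap: "(A.posterior_mean (i - 1) - B.posterior_mean (i - 1))\<^sup>2 * f S (i - 1) / 4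
        = (real i)\<^sup>2 * (\<delta> i)\<^sup>2 / (4 * f S (i - 1))"
    proof -
      have d: "A.posterior_mean (i - 1) - B.posterior_mean (i - 1) = - (real i * \<delta> i) / f S (i - 1)"
        unfolding A.posterior_mean_def B.posterior_mean_def mixture[OF S] mixture[OF S'] Suc_i same[symmetric]
        using q_1[OF i] by (simp add: diff diff_divide_distrib[symmetric] algebra_simps)
      have "(- (a * b) / c)\<^sup>2 * c / 4 = a\<^sup>2 * b\<^sup>2 / (4 * c)" if "0 < c" for a b c :: real
        using that by (simp add: power2_eq_square field_simps)
      from this[OF f_pos[OF S, of "i - 1"]] show ?thesis unfolding d .
    qed
    have ratio: "real i * H / 224 \<le> real n * ((real i)\<^sup>2 * (\<delta> i)\<^sup>2 / (4 * f S (i - 1)))"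
    proof -
      let ?c = "likelihood H (i - 1)"
      have c: "0 < ?c" using H by (simp add: likelihood_eq)
      have "real i * likelihood H i = H * ?c"
        using mult_likelihood[of H "i - 1"] H unfolding Suc_i by linarith
      then have "\<eta> / 2 * (H * ?c) = real i * (\<eta> / 2 * likelihood H i)"
        by (metis mult.left_commute)
      also have "\<dots> \<le> real i * f0 i"
        by (intro mult_left_mono f0_ge) simp
      finally have "\<eta> / 2 * (H * ?c) \<le> real i * f0 i" .
      moreover have "f S (i - 1) \<le> 2 * \<eta> * ?c"
      proof -
        have "1 \<le> i - 1" using I_ge(2)[OF i] by simp
        with f_bounds(2)[OF S, of "i - 1"] f0_le[OF _ I_ge(6)[OF i]] show ?thesis
          unfolding mult.assoc by fastforce
      qed
      ultimately have "H / 4 * f S (i - 1) \<le> real i * f0 i"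
      proof -
        assume *: "\<eta> / 2 * (H * ?c) \<le> real i * f0 i" "f S (i - 1) \<le> 2 * \<eta> * ?c"
        have "H / 4 * f S (i - 1) \<le> H / 4 * (2 * \<eta> * ?c)"
          using * H by (intro mult_left_mono) auto
        also have "\<dots> = \<eta> / 2 * (H * ?c)" by simp
        finally show ?thesis using *(1) by linarith
      qed
      then have scaled: "real i * (H / 4 * f S (i - 1)) \<le> real i * (real i * f0 i)"
        by (intro mult_left_mono) auto
      show ?thesis
      proof -
        have "a * H / 224 \<le> b * (a\<^sup>2 * (c / (14 * b)) / (4 * d))" if "a * (H / 4 * d) \<le> a * (a * c)" "0 < b" "0 < d" for a b c d
          using that by (simp add: field_simps power2_eq_square)
        from this[OF scaled] show ?thesis
          unfolding \<delta>_sq using f_pos[OF S, of "i - 1"] n by simp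
      qed
    qed
    have close: "(\<integral>\<^sup>+y. ennreal ((f S y - f (insert i S) y)\<^sup>2 / (f S y + f (insert i S) y)) \<partial>count_space UNIV)
        \<le> ennreal (1 / (2 * real n))"
    proof -
      have "(\<integral>\<^sup>+y. ennreal ((f S y - f (insert i S) y)\<^sup>2 / (f S y + f (insert i S) y)) \<partial>count_space UNIV)
          \<le> (\<integral>\<^sup>+y. ennreal ((\<delta> i)\<^sup>2) * ennreal ((q i y)\<^sup>2 / f0 y) \<partial>count_space UNIV)"
      proof (rule nn_integral_mono)
        fix y
        have "(f S y - f (insert i S) y)\<^sup>2 / (f S y + f (insert i S) y) \<le> (\<delta> i * q i y)\<^sup>2 / f0 y"
          using f_bounds(1)[OF S, of y] f_bounds(1)[OF S', of y] f0_pos[of y]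
          by (intro frac_le) (auto simp: diff)
        then show "ennreal ((f S y - f (insert i S) y)\<^sup>2 / (f S y + f (insert i S) y))
            \<le> ennreal ((\<delta> i)\<^sup>2) * ennreal ((q i y)\<^sup>2 / f0 y)"
          by (simp add: ennreal_mult'[symmetric] power_mult_distrib ennreal_leI)
      qed
      also have "\<dots> = ennreal ((\<delta> i)\<^sup>2) * (\<integral>\<^sup>+y. ennreal ((q i y)\<^sup>2 / f0 y) \<partial>count_space UNIV)"
        by (rule nn_integral_cmult) simp
      also have "\<dots> \<le> ennreal ((\<delta> i)\<^sup>2) * ennreal (7 / f0 i)"
        using \<chi>[OF i] by (rule mult_left_mono) simp
      also have "\<dots> = ennreal (1 / (2 * real n))"
        unfolding \<delta>_sq using f0_pos[of i] by (simp add: ennreal_mult'[symmetric])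
      finally show ?thesis .
    qed
    have "g i \<le> (\<Sum>j<n. ennreal ((A.posterior_mean (i - 1) - B.posterior_mean (i - 1))\<^sup>2 * f S (i - 1) / 4))"
      unfolding gap g_def using ratio n by (simp add: ennreal_of_nat_eq_real_of_nat ennreal_mult'[symmetric] ennreal_leI)
    also have "\<dots> \<le> (\<Sum>j<n.
        (\<integral>\<^sup>+Y. ennreal ((T Y j - A.posterior_mean (i - 1))\<^sup>2 * (\<Prod>k<n. f S (Y k))) * indicator {i - 1} (Y j) \<partial>obs_space n)
      + (\<integral>\<^sup>+Y. ennreal ((T Y j - B.posterior_mean (i - 1))\<^sup>2 * (\<Prod>k<n. f (insert i S) (Y k))) * indicator {i - 1} (Y j) \<partial>obs_space n))"
    proof (intro sum_mono two_point[OF _ _ _ _ same close])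
      show "0 \<le> f S z" "0 \<le> f (insert i S) z" for z
        using f_pos[OF S, of z] f_pos[OF S', of z] by auto
      show "(\<integral>\<^sup>+z. ennreal (f S z) \<partial>count_space UNIV) = 1" "(\<integral>\<^sup>+z. ennreal (f (insert i S) z) \<partial>count_space UNIV) = 1"
        using A.mixture_total B.mixture_total unfolding mixture[OF S] mixture[OF S'] by auto
    qed auto
    also have "\<dots> = l i S + l i (insert i S)"
      by (simp add: l_def sum.distrib)
    finally show "g i \<le> l i S + l i (insert i S)" .
  qed
  moreover have "ennreal ((real m)\<^sup>2 * H / 896) \<le> (\<Sum>i\<in>I. g i)"
  proof -
    have "(real m)\<^sup>2 * H / 896 \<le> (2 * real (card I)) * (real m * H / 896)"
      using I(4) H by (simp add: power2_eq_square mult_right_mono)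
    also have "\<dots> = (\<Sum>i\<in>I. real m / 2 * H / 224)"
      by simp
    also have "\<dots> \<le> (\<Sum>i\<in>I. real i * H / 224)"
    proof (intro sum_mono divide_right_mono mult_right_mono)
      show "real m / 2 \<le> real i" if "i \<in> I" for i using I_ge(4)[OF that] by simp
    qed (use H in auto)
    finally have "ennreal ((real m)\<^sup>2 * H / 896) \<le> ennreal (\<Sum>i\<in>I. real i * H / 224)"
      by (rule ennreal_leI)
    also have "\<dots> = (\<Sum>i\<in>I. g i)"
      unfolding g_def using H by (intro sum_ennreal[symmetric]) auto
    finally show ?thesis .
  qed
  ultimately have le: "ennreal ((real m)\<^sup>2 * H / 896) \<le> 2 * e2ennreal R"
    by (rule order_trans[rotated])
  have "ereal ((real m)\<^sup>2 * H / 1792) \<le> R"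
  proof (cases R)
    case (real x)
    then have "2 * e2ennreal R = ennreal (2 * x)"
      using R_nonneg by (simp add: e2ennreal_ereal ennreal_mult)
    then have "(real m)\<^sup>2 * H / 896 \<le> 2 * x"
      using le real R_nonneg by (simp add: ennreal_le_iff)
    then show ?thesis using real by simp
  qed (use R_nonneg in auto)
  then show ?thesis by (simp add: R_def)
qed

section \<open>Robbins regret over bounded and subexponential priors\<close>

lemma (in poisson_prior) mixture_chernoff:
  assumes "0 < b" "(\<integral>\<^sup>+\<theta>. ennreal (exp (\<theta> * (b - 1))) \<partial>G) \<le> ennreal M" "0 \<le> M"
  shows "mixture z \<le> M / b ^ z"
proof -
  have "ennreal (mixture z) = (\<integral>\<^sup>+\<theta>. ennreal (likelihood \<theta> z) \<partial>G)"
    by (rule nn_integral_mixture[symmetric])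
  also have "\<dots> \<le> (\<integral>\<^sup>+\<theta>. ennreal (1 / b ^ z) * ennreal (exp (\<theta> * (b - 1))) \<partial>G)"
  proof (rule nn_integral_mono_AE)
    show "AE \<theta> in G. ennreal (likelihood \<theta> z) \<le> ennreal (1 / b ^ z) * ennreal (exp (\<theta> * (b - 1)))"
      using nonneg
    proof (rule eventually_mono)
      fix \<theta> :: real assume "0 \<le> \<theta>"
      then show "ennreal (likelihood \<theta> z) \<le> ennreal (1 / b ^ z) * ennreal (exp (\<theta> * (b - 1)))"
        using likelihood_chernoff[OF _ assms(1), of \<theta> z] assms(1)
        by (simp add: ennreal_mult'[symmetric] ennreal_leI)
    qed
  qed
  also have "\<dots> = ennreal (1 / b ^ z) * (\<integral>\<^sup>+\<theta>. ennreal (exp (\<theta> * (b - 1))) \<partial>G)"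
    by (rule nn_integral_cmult) simp
  also have "\<dots> \<le> ennreal (1 / b ^ z) * ennreal M"
    using assms(2) by (rule mult_left_mono) simp
  also have "\<dots> = ennreal (M / b ^ z)"
    using assms by (simp add: ennreal_mult'[symmetric])
  finally show ?thesis
    using assms by (subst (asm) ennreal_le_iff) auto
qed

lemma square_le_exponential:
  fixes \<beta> :: real
  assumes "1 < \<beta>"
  shows "(real (y + 2))\<^sup>2 \<le> 2 * \<beta>\<^sup>2 / (ln \<beta>)\<^sup>2 * \<beta> ^ y"
proof -
  define L where "L = ln \<beta>"
  have L: "0 < L" "exp L = \<beta>" using assms by (auto simp: L_def)
  have "(real (y + 2) * L) ^ 2 / fact 2 \<le> exp (real (y + 2) * L)"
    using L by (intro power_over_fact_le_exp) auto
  also have "\<dots> = \<beta> ^ (y + 2)"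
    unfolding exp_of_nat_mult L ..
  finally have "(real (y + 2))\<^sup>2 * L\<^sup>2 \<le> 2 * \<beta>\<^sup>2 * \<beta> ^ y"
    by (simp add: power_mult_distrib power2_eq_square mult_ac fact_numeral)
  then have "(real (y + 2))\<^sup>2 \<le> 2 * \<beta>\<^sup>2 * \<beta> ^ y / L\<^sup>2"
    using L by (simp add: pos_le_divide_eq)
  then show ?thesis by (simp add: L_def)
qed

lemma
  assumes "G \<in> bounded_priors h"
  shows bounded_prior: "poisson_prior G" and bounded_AE: "AE \<theta> in G. \<theta> \<in> {0..h}"
proof -
  have G: "prob_space G" "sets G = sets borel" "measure G {0..h} = 1"
    using assms by (auto simp: bounded_priors_def)
  interpret prob_space G by (rule G)
  show ae: "AE \<theta> in G. \<theta> \<in> {0..h}"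
    using G by (subst prob_eq_1[symmetric]) auto
  then have "AE \<theta> in G. 0 \<le> \<theta>" by eventually_elim simp
  with G show "poisson_prior G" by unfold_locales
qed

lemma bounded_mmse_finite:
  assumes "G \<in> bounded_priors h"
  shows "mmse G < \<top>"
proof -
  interpret poisson_prior G by (rule bounded_prior[OF assms])
  have "(\<integral>\<^sup>+\<theta>. ennreal (\<theta>\<^sup>2) \<partial>G) \<le> (\<integral>\<^sup>+\<theta>. ennreal (h\<^sup>2) \<partial>G)"
    using bounded_AE[OF assms]
    by (intro nn_integral_mono_AE, eventually_elim) (auto intro!: ennreal_leI power_mono)
  also have "\<dots> < \<top>" by (simp add: emeasure_space_1[simplified])
  finally show ?thesis using mmse_le_second_moment by (rule le_less_trans[rotated])
qed

lemma bounded_posterior_mean: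
  assumes "G \<in> bounded_priors h" "0 < h"
  shows "poisson_prior.posterior_mean G y \<le> h"
proof -
  interpret poisson_prior G by (rule bounded_prior[OF assms(1)])
  show ?thesis
  proof (cases "mixture y = 0")
    case False
    then have pos: "0 < mixture y" using mixture_nonneg[of y] by linarith
    have "posterior_mean y * mixture y = (\<integral>\<theta>. \<theta> * likelihood \<theta> y \<partial>G)"
      by (simp only: posterior_mean_mult integral_mult_likelihood)
    also have "\<dots> \<le> (\<integral>\<theta>. h * likelihood \<theta> y \<partial>G)"
      by (intro integral_mono_AE eventually_mono[OF bounded_AE[OF assms(1)]])
         (auto intro!: mult_right_mono)
    also have "\<dots> = h * mixture y"
      by (simp add: mixture_def)
    finally show ?thesis using pos by simp
  qed (use assms in \<open>simp add: posterior_mean_def\<close>)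
qed

text \<open>
  Chernoff's bound with base \<open>b = ln n\<close>: the exponential moment of the prior is at most \<open>n\<^sup>h\<close>, while
  \<open>b\<^sup>y\<close> reaches any fixed power of \<open>n\<close> at \<open>y\<close> of order \<open>ln n / ln (ln n)\<close>.
\<close>

lemma robbins_bounded:
  fixes h :: real and n y0 :: nat
  assumes h: "0 < h" and n: "3 \<le> n" "4 \<le> ln (real n)"
    and y0: "2 * (h + 3) * ln (real n) \<le> real y0 * ln (ln (real n))"
    and G: "G \<in> bounded_priors h"
  shows "poisson_prior.regret G n (robbins n)
    \<le> ennreal (real y0 * (2 * (real y0 * h) + 5 * h\<^sup>2) + 32 / (ln 2)\<^sup>2)"
proof -
  interpret poisson_prior G by (rule bounded_prior[OF G])
  define x where "x = ln (real n)"
  define \<beta> where "\<beta> = sqrt x"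
  have x: "4 \<le> x" "real n = exp x" using n by (auto simp: x_def)
  have \<beta>: "2 \<le> \<beta>" "\<beta>\<^sup>2 = x"
  proof -
    have "sqrt 4 \<le> \<beta>" unfolding \<beta>_def using x by (intro real_sqrt_le_mono) auto
    then show "2 \<le> \<beta>" by simp
  qed (use x in \<open>simp add: \<beta>_def\<close>)
  have "regret n (robbins n) \<le> ennreal (real y0 * (2 * (real y0 * h) + 5 * h\<^sup>2) + 2 * (2 * 2\<^sup>2 / (ln 2)\<^sup>2) / (1 - 1 / 2))"
  proof (rule regret_robbins_le[where A = "exp (h * (x - 1))" and \<beta> = \<beta>])
    fix y assume "y < y0"
    then have "real (Suc y) * posterior_mean y \<le> real y0 * h" "(posterior_mean y)\<^sup>2 \<le> h\<^sup>2"
      using bounded_posterior_mean[OF G h, of y] h by (auto intro!: mult_mono power_mono)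
    then show "real n * (mixture y * counts_expectation y (n - 1) (robbins_loss y)) \<le> 2 * (real y0 * h) + 5 * h\<^sup>2"
      using robbins_cell_le[OF n(1), of y] by linarith
  next
    fix y
    have "(\<integral>\<^sup>+\<theta>. ennreal (exp (\<theta> * (x - 1))) \<partial>G) \<le> (\<integral>\<^sup>+\<theta>. ennreal (exp (h * (x - 1))) \<partial>G)"
      using x by (intro nn_integral_mono_AE eventually_mono[OF bounded_AE[OF G]])
        (auto intro!: ennreal_leI mult_right_mono)
    then show "mixture y \<le> exp (h * (x - 1)) / \<beta> ^ (2 * y)"
      using mixture_chernoff[of x "exp (h * (x - 1))" y] x \<beta>(2)
      by (simp add: power_mult emeasure_space_1[simplified])
  next
    have "real n ^ 3 * exp (h * (x - 1)) \<le> exp (3 * x) * exp (h * x)"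
      using h x by (intro mult_mono) (auto simp: exp_of_nat_mult[of 3, simplified] intro!: mult_left_mono)
    also have "\<dots> = exp ((h + 3) * x)" by (simp add: exp_add[symmetric] algebra_simps)
    also have "\<dots> \<le> exp (real y0 * (ln x / 2))"
    proof -
      have "(h + 3) * x \<le> real y0 * (ln x / 2)"
        using y0 unfolding x_def[symmetric] by (simp add: algebra_simps)
      then show ?thesis by simp
    qed
    also have "\<dots> = \<beta> ^ y0"
    proof -
      have "exp (ln x / 2) = \<beta>" using x by (simp add: \<beta>_def ln_sqrt[symmetric])
      then show ?thesis by (simp only: exp_of_nat_mult)
    qed
    finally show "real n ^ 3 * exp (h * (x - 1)) \<le> \<beta> ^ y0" .
  next
    show "(real (y + 2))\<^sup>2 \<le> 2 * 2\<^sup>2 / (ln 2)\<^sup>2 * 2 ^ y" for y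
      by (rule square_le_exponential) simp
  qed (use n h \<beta> in auto)
  then show ?thesis by simp
qed

text \<open>
  A bound on the exponential moment of order \<open>1 / (2 s)\<close> of every \<open>s\<close>-subexponential law. It is obtained by rounding
  \<open>\<theta> / s\<close> down to an integer and summing the tail bounds.
\<close>

definition SubE_moment :: real where
  "SubE_moment = 2 * exp (1 / 2) / (1 - exp (- 1 / 2))"

lemma SubE_moment_ge_1: "1 \<le> SubE_moment"
proof -
  define r where "r = exp (- 1 / 2 :: real)"
  have r: "0 < r" "r < 1" by (auto simp: r_def)
  define c where "c = exp (1 / 2 :: real)"
  have "1 \<le> c" by (simp add: c_def)
  then have "1 * (1 - r) \<le> 2 * c" using r by (intro order_trans[of "1 * (1 - r)" 1 "2 * c"]) auto
  then show ?thesis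
    using r unfolding SubE_moment_def r_def[symmetric] c_def[symmetric] by (subst pos_le_divide_eq) auto
qed

lemma
  assumes "G \<in> SubE s" "0 < s"
  shows SubE_prior: "poisson_prior G"
    and SubE_exp_moment: "(\<integral>\<^sup>+\<theta>. ennreal (exp (\<theta> / (2 * s))) \<partial>G) \<le> ennreal SubE_moment"
proof -
  have G: "prob_space G" "sets G = sets borel" "measure G {0..} = 1"
    "\<And>t. 0 < t \<Longrightarrow> measure G {t..} \<le> 2 * exp (- t / s)"
    using assms by (auto simp: SubE_def)
  interpret prob_space G by (rule G)
  have "AE \<theta> in G. \<theta> \<in> {0..}"
    using G by (subst prob_eq_1[symmetric]) auto
  then have ae: "AE \<theta> in G. 0 \<le> \<theta>" by eventually_elim simp
  with G show "poisson_prior G" by unfold_locales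
  define r where "r = exp (- 1 / 2 :: real)"
  have r: "0 < r" "r < 1" by (auto simp: r_def)
  have tail: "measure G {real k * s..} \<le> 2 * exp (- real k)" for k
  proof (cases "k = 0")
    case True
    have "measure G {0..} \<le> 2" using G(3) by simp
    with True show ?thesis by simp
  next
    case False
    then show ?thesis using G(4)[of "real k * s"] assms(2) by simp
  qed
  have "(\<integral>\<^sup>+\<theta>. ennreal (exp (\<theta> / (2 * s))) \<partial>G)
      \<le> (\<integral>\<^sup>+\<theta>. (\<Sum>k. ennreal (exp ((real k + 1) / 2)) * indicator {real k * s..} \<theta>) \<partial>G)"
  proof (rule nn_integral_mono_AE, use ae in eventually_elim)
    fix \<theta> :: real assume \<theta>: "0 \<le> \<theta>"
    define k where "k = nat \<lfloor>\<theta> / s\<rfloor>"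
    have "0 \<le> \<theta> / s" using \<theta> assms(2) by simp
    then have k: "real k \<le> \<theta> / s" "\<theta> / s \<le> real k + 1"
      using floor_correct[of "\<theta> / s"] unfolding k_def by auto
    have "\<theta> / s / 2 \<le> (real k + 1) / 2"
      by (intro divide_right_mono k) simp
    then have "exp (\<theta> / (2 * s)) \<le> exp ((real k + 1) / 2)"
      by (simp add: mult.commute)
    then have "ennreal (exp (\<theta> / (2 * s))) \<le> ennreal (exp ((real k + 1) / 2)) * indicator {real k * s..} \<theta>"
      using k assms(2) by (simp add: ennreal_leI pos_le_divide_eq)
    also have "\<dots> \<le> (\<Sum>k. ennreal (exp ((real k + 1) / 2)) * indicator {real k * s..} \<theta>)"
    proof -
      have "F k \<le> suminf F" for F :: "nat \<Rightarrow> ennreal"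
        using sum_le_suminf[of F "{k}"] by simp
      then show ?thesis .
    qed
    finally show "ennreal (exp (\<theta> / (2 * s))) \<le> (\<Sum>k. ennreal (exp ((real k + 1) / 2)) * indicator {real k * s..} \<theta>)" .
  qed
  also have "\<dots> = (\<Sum>k. \<integral>\<^sup>+\<theta>. ennreal (exp ((real k + 1) / 2)) * indicator {real k * s..} \<theta> \<partial>G)"
    by (rule nn_integral_suminf) (simp add: G(2) cong: measurable_cong_sets)
  also have "\<dots> \<le> (\<Sum>k. ennreal (2 * exp (1 / 2) * r ^ k))"
  proof (intro suminf_le summableI)
    fix k
    have "(\<integral>\<^sup>+\<theta>. ennreal (exp ((real k + 1) / 2)) * indicator {real k * s..} \<theta> \<partial>G)
        = ennreal (exp ((real k + 1) / 2) * measure G {real k * s..})"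
      using G(2) by (simp add: nn_integral_cmult emeasure_eq_measure ennreal_mult')
    also have "\<dots> \<le> ennreal (exp ((real k + 1) / 2) * (2 * exp (- real k)))"
      by (intro ennreal_leI mult_left_mono tail) simp
    also have "exp ((real k + 1) / 2) * (2 * exp (- real k)) = 2 * exp (1 / 2) * r ^ k"
    proof -
      have "exp ((real k + 1) / 2) * exp (- real k) = exp (1 / 2) * exp (real k * (- 1 / 2))"
        unfolding exp_add[symmetric] by (rule arg_cong[of _ _ exp]) (simp add: field_simps)
      then show ?thesis unfolding r_def exp_of_nat_mult[symmetric] by simp
    qed
    finally show "(\<integral>\<^sup>+\<theta>. ennreal (exp ((real k + 1) / 2)) * indicator {real k * s..} \<theta> \<partial>G)
        \<le> ennreal (2 * exp (1 / 2) * r ^ k)" .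
  qed
  also have "\<dots> = ennreal SubE_moment"
  proof (rule suminf_ennreal_eq)
    show "(\<lambda>k. 2 * exp (1 / 2) * r ^ k) sums SubE_moment"
      using sums_mult[OF geometric_sums[of r], of "2 * exp (1 / 2)"] r by (simp add: SubE_moment_def r_def)
  qed (use r in auto)
  finally show "(\<integral>\<^sup>+\<theta>. ennreal (exp (\<theta> / (2 * s))) \<partial>G) \<le> ennreal SubE_moment" .
qed

lemma SubE_mmse_finite:
  assumes "G \<in> SubE s" "0 < s"
  shows "mmse G < \<top>"
proof -
  interpret poisson_prior G by (rule SubE_prior[OF assms])
  have "(\<integral>\<^sup>+\<theta>. ennreal (\<theta>\<^sup>2) \<partial>G) \<le> (\<integral>\<^sup>+\<theta>. ennreal (8 * s\<^sup>2) * ennreal (exp (\<theta> / (2 * s))) \<partial>G)"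
  proof (intro nn_integral_mono_AE eventually_mono[OF nonneg])
    fix \<theta> :: real assume "0 \<le> \<theta>"
    then have "(\<theta> / (2 * s)) ^ 2 / fact 2 \<le> exp (\<theta> / (2 * s))"
      using assms(2) by (intro power_over_fact_le_exp) auto
    then have "\<theta>\<^sup>2 \<le> 8 * s\<^sup>2 * exp (\<theta> / (2 * s))"
      using assms(2) by (simp add: power_divide power_mult_distrib pos_divide_le_eq fact_numeral mult_ac)
    then show "ennreal (\<theta>\<^sup>2) \<le> ennreal (8 * s\<^sup>2) * ennreal (exp (\<theta> / (2 * s)))"
      by (simp add: ennreal_mult'[symmetric] ennreal_leI)
  qed
  also have "\<dots> = ennreal (8 * s\<^sup>2) * (\<integral>\<^sup>+\<theta>. ennreal (exp (\<theta> / (2 * s))) \<partial>G)"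
    by (rule nn_integral_cmult) simp
  also have "\<dots> \<le> ennreal (8 * s\<^sup>2) * ennreal SubE_moment"
    by (intro mult_left_mono SubE_exp_moment assms) simp
  also have "\<dots> < \<top>" by (simp add: ennreal_mult_less_top)
  finally show ?thesis using mmse_le_second_moment by (rule le_less_trans[rotated])
qed

text \<open>
  Rates up to \<open>t\<close> contribute at most \<open>t\<close> times the mass of the cell. Larger rates are paid for by the exponential
  moment, of which half is spent on the factor \<open>exp (- a t / 2)\<close>.
\<close>

lemma (in poisson_prior) truncated_moments:
  assumes a: "0 < a" "0 \<le> t" and M: "(\<integral>\<^sup>+\<theta>. ennreal (exp (\<theta> * a)) \<partial>G) \<le> ennreal M" "0 \<le> M"
  shows "posterior_mean y * mixture y \<le> t * mixture y + 2 / a * M * exp (- (a * t / 2))"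
    and "(posterior_mean y)\<^sup>2 * mixture y \<le> t\<^sup>2 * mixture y + 8 / a\<^sup>2 * M * exp (- (a * t / 2))"
proof -
  let ?e = "exp (- (a * t / 2))"
  have pointwise: "\<theta> \<le> t + 2 / a * ?e * exp (\<theta> * a)" "\<theta>\<^sup>2 \<le> t\<^sup>2 + 8 / a\<^sup>2 * ?e * exp (\<theta> * a)" if "0 \<le> \<theta>" for \<theta>
  proof -
    define u where "u = a * \<theta> / 2"
    have u: "0 \<le> u" "\<theta> = 2 / a * u" using that a by (auto simp: u_def)
    have "\<theta> \<le> t + 2 / a * ?e * exp (\<theta> * a) \<and> \<theta>\<^sup>2 \<le> t\<^sup>2 + 8 / a\<^sup>2 * ?e * exp (\<theta> * a)"
    proof (cases "\<theta> \<le> t")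
      case True
      then have "\<theta>\<^sup>2 \<le> t\<^sup>2" using that by (intro power_mono)
      moreover have "0 \<le> 2 / a * ?e * exp (\<theta> * a)" "0 \<le> 8 / a\<^sup>2 * ?e * exp (\<theta> * a)" using a by auto
      ultimately show ?thesis using True by (intro conjI add_increasing2)
    next
      case False
      have "exp u \<le> ?e * exp (\<theta> * a)"
        unfolding exp_add[symmetric] exp_le_cancel_iff using False a by (simp add: u_def mult_ac)
      moreover have "u \<le> exp u" "u\<^sup>2 / 2 \<le> exp u"
        using power_over_fact_le_exp[OF u(1), of 1] power_over_fact_le_exp[OF u(1), of 2] by (auto simp: fact_numeral)
      ultimately have "u \<le> ?e * exp (\<theta> * a)" "u\<^sup>2 \<le> 2 * (?e * exp (\<theta> * a))"
        by auto
      from mult_left_mono[OF this(1), of "2 / a"] mult_left_mono[OF this(2), of "4 / a\<^sup>2"]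
      have "2 / a * u \<le> 2 / a * (?e * exp (\<theta> * a))" "4 / a\<^sup>2 * u\<^sup>2 \<le> 4 / a\<^sup>2 * (2 * (?e * exp (\<theta> * a)))"
        using a by simp_all
      moreover have "\<theta>\<^sup>2 = 4 / a\<^sup>2 * u\<^sup>2" unfolding u(2) by (simp add: power_mult_distrib power_divide)
      ultimately have "\<theta> \<le> 2 / a * ?e * exp (\<theta> * a)" "\<theta>\<^sup>2 \<le> 8 / a\<^sup>2 * ?e * exp (\<theta> * a)"
        using u(2) by (auto simp: mult_ac)
      then show ?thesis using a(2) by (intro conjI add_increasing) auto
    qed
    then show "\<theta> \<le> t + 2 / a * ?e * exp (\<theta> * a)" "\<theta>\<^sup>2 \<le> t\<^sup>2 + 8 / a\<^sup>2 * ?e * exp (\<theta> * a)" by auto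
  qed
  have int: "integrable G (\<lambda>\<theta>. exp (\<theta> * a))"
    using le_less_trans[OF M(1)] by (intro integrableI_nonneg) auto
  have int_le: "(\<integral>\<theta>. exp (\<theta> * a) \<partial>G) \<le> M"
    using M nn_integral_eq_integral[OF int] by (simp add: ennreal_le_iff)
  have trunc: "(\<integral>\<theta>. g \<theta> * likelihood \<theta> y \<partial>G) \<le> c * mixture y + d * M"
    if "integrable G (\<lambda>\<theta>. g \<theta> * likelihood \<theta> y)" "\<And>\<theta>. 0 \<le> \<theta> \<Longrightarrow> g \<theta> \<le> c + d * exp (\<theta> * a)" "0 \<le> d" for g c d
  proof -
    have "(\<integral>\<theta>. g \<theta> * likelihood \<theta> y \<partial>G) \<le> (\<integral>\<theta>. c * likelihood \<theta> y + d * exp (\<theta> * a) \<partial>G)"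
    proof (intro integral_mono_AE eventually_mono[OF nonneg] that(1))
      fix \<theta> :: real assume "0 \<le> \<theta>"
      then have "g \<theta> * likelihood \<theta> y \<le> (c + d * exp (\<theta> * a)) * likelihood \<theta> y"
        by (intro mult_right_mono that) auto
      moreover have "d * exp (\<theta> * a) * likelihood \<theta> y \<le> d * exp (\<theta> * a) * 1"
        using \<open>0 \<le> d\<close> by (intro mult_left_mono likelihood_le_1) auto
      ultimately show "g \<theta> * likelihood \<theta> y \<le> c * likelihood \<theta> y + d * exp (\<theta> * a)"
        by (simp add: distrib_right)
    qed (use int in simp)
    also have "\<dots> = c * mixture y + d * (\<integral>\<theta>. exp (\<theta> * a) \<partial>G)"
      using int by (simp add: mixture_def)
    also have "\<dots> \<le> c * mixture y + d * M"
      using int_le \<open>0 \<le> d\<close> by (intro add_left_mono mult_left_mono)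
    finally show ?thesis .
  qed
  have "posterior_mean y * mixture y = (\<integral>\<theta>. \<theta> * likelihood \<theta> y \<partial>G)"
    by (simp only: posterior_mean_mult integral_mult_likelihood)
  also have "\<dots> \<le> t * mixture y + (2 / a * ?e) * M"
    using a by (intro trunc pointwise) auto
  finally show "posterior_mean y * mixture y \<le> t * mixture y + 2 / a * M * ?e"
    by (simp add: mult_ac)
  have "(posterior_mean y)\<^sup>2 * mixture y \<le> (\<integral>\<theta>. \<theta>\<^sup>2 * likelihood \<theta> y \<partial>G)"
    by (rule posterior_mean_sq_le)
  also have "\<dots> \<le> t\<^sup>2 * mixture y + (8 / a\<^sup>2 * ?e) * M"
    using a by (intro trunc pointwise) auto
  finally show "(posterior_mean y)\<^sup>2 * mixture y \<le> t\<^sup>2 * mixture y + 8 / a\<^sup>2 * M * ?e"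
    by (simp add: mult_ac)
qed

text \<open>
  The posterior mean can be huge in cells of tiny mass, so the cells below \<open>y0\<close> are split at mass \<open>n\<^sup>-\<^sup>4\<close>. Above this
  threshold truncation at \<open>t\<close> of order \<open>log n\<close> bounds the posterior mean by \<open>u\<close>. Below it the crude cell bound
  wins, since \<open>n\<^sup>3\<close> times the mass is less than 1.
\<close>

lemma robbins_SubE:
  fixes s :: real and n y0 :: nat
  defines "a \<equiv> 1 / (2 * s)" and "M \<equiv> SubE_moment"
  defines "t \<equiv> 8 / a * ln (real n)" and "\<beta> \<equiv> sqrt (1 + a)"
  defines "u \<equiv> t + 2 / a * M"
  assumes s: "0 < s" and n: "3 \<le> n" and y0: "3 * ln (real n) + ln M \<le> real y0 * ln \<beta>"
    and G: "G \<in> SubE s"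
  shows "poisson_prior.regret G n (robbins n)
    \<le> ennreal (real y0 * (2 * (real y0 * u) + 5 * u\<^sup>2 + (real y0)\<^sup>2 + t\<^sup>2 + 8 / a\<^sup>2 * M)
        + 4 * \<beta>\<^sup>2 / (ln \<beta>)\<^sup>2 / (1 - 1 / \<beta>))"
proof -
  interpret poisson_prior G by (rule SubE_prior[OF G s])
  define N where "N = real n"
  have N: "3 \<le> N" using n by (simp add: N_def)
  have a: "0 < a" using s by (simp add: a_def)
  have M: "1 \<le> M" unfolding M_def by (rule SubE_moment_ge_1)
  have t: "0 \<le> t" using a n by (simp add: t_def)
  have u: "0 \<le> u" using a M t by (simp add: u_def)
  have \<beta>: "1 < \<beta>" "\<beta>\<^sup>2 = 1 + a" using a by (auto simp: \<beta>_def)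
  have moment: "(\<integral>\<^sup>+\<theta>. ennreal (exp (\<theta> * a)) \<partial>G) \<le> ennreal M"
    using SubE_exp_moment[OF G s] by (simp add: a_def M_def)
  have decay: "exp (- (a * t / 2)) = 1 / N ^ 4"
  proof -
    have "exp (- (a * t / 2)) = exp (- (real 4 * ln N))"
      using a by (simp add: t_def N_def)
    also have "\<dots> = 1 / N ^ 4"
      unfolding exp_minus exp_of_nat_mult using N by (simp add: inverse_eq_divide)
    finally show ?thesis .
  qed
  note trunc = truncated_moments[OF a t moment, unfolded decay]
  let ?B = "2 * (real y0 * u) + 5 * u\<^sup>2 + (real y0)\<^sup>2 + t\<^sup>2 + 8 / a\<^sup>2 * M"
  have "regret n (robbins n) \<le> ennreal (real y0 * ?B + 2 * (2 * \<beta>\<^sup>2 / (ln \<beta>)\<^sup>2) / (1 - 1 / \<beta>))"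
  proof (rule regret_robbins_le[where A = M and \<beta> = \<beta>])
    fix y assume y: "y < y0"
    show "real n * (mixture y * counts_expectation y (n - 1) (robbins_loss y)) \<le> ?B"
    proof (cases "1 / N ^ 4 \<le> mixture y")
      case True
      have pos: "0 < mixture y" using True N by (intro less_le_trans[OF _ True]) simp
      have "posterior_mean y * mixture y \<le> t * mixture y + 2 / a * M * (1 / N ^ 4)"
        using M by (intro trunc) auto
      also have "\<dots> \<le> t * mixture y + 2 / a * M * mixture y"
        using True a M by (intro add_left_mono mult_left_mono) auto
      also have "\<dots> = u * mixture y" by (simp add: u_def distrib_right)
      finally have pm: "posterior_mean y \<le> u" using pos by simp
      then have "real (Suc y) * posterior_mean y \<le> real y0 * u" "(posterior_mean y)\<^sup>2 \<le> u\<^sup>2"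
        using y by (auto intro!: mult_mono power_mono)
      moreover have "0 \<le> (real y0)\<^sup>2 + t\<^sup>2 + 8 / a\<^sup>2 * M"
        using a M by (intro add_nonneg_nonneg) auto
      ultimately show ?thesis
        using robbins_cell_le[OF n, of y] by linarith
    next
      case False
      then have f: "mixture y \<le> 1 / N ^ 4" by simp
      have N4: "N ^ 3 * (1 / N ^ 4) \<le> 1" "N * (1 / N ^ 4) \<le> 1"
      proof -
        have "N ^ 4 = N ^ 3 * N" "N ^ 4 = N * N ^ 3" by (simp_all add: power3_eq_cube power4_eq_xxxx)
        moreover have "1 \<le> N ^ 3" using N by (intro one_le_power) simp
        ultimately show "N ^ 3 * (1 / N ^ 4) \<le> 1" "N * (1 / N ^ 4) \<le> 1"
          using N by (auto simp: divide_simps)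
      qed
      have "N ^ 3 * ((real (Suc y))\<^sup>2 * (mixture (Suc y) * mixture y)) \<le> N ^ 3 * ((real y0)\<^sup>2 * (1 * (1 / N ^ 4)))"
        using y N f mixture_le_1 by (intro mult_left_mono mult_mono power_mono) auto
      also have "\<dots> = (real y0)\<^sup>2 * (N ^ 3 * (1 / N ^ 4))" by simp
      also have "\<dots> \<le> (real y0)\<^sup>2 * 1" by (intro mult_left_mono N4) simp
      finally have 1: "N ^ 3 * ((real (Suc y))\<^sup>2 * (mixture (Suc y) * mixture y)) \<le> (real y0)\<^sup>2" by simp
      have "(posterior_mean y)\<^sup>2 * mixture y \<le> t\<^sup>2 * mixture y + 8 / a\<^sup>2 * M * (1 / N ^ 4)"
        using M by (intro trunc) auto
      also have "\<dots> \<le> t\<^sup>2 * (1 / N ^ 4) + 8 / a\<^sup>2 * M * (1 / N ^ 4)"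
        using f by (intro add_right_mono mult_left_mono) auto
      finally have "N * ((posterior_mean y)\<^sup>2 * mixture y) \<le> N * ((t\<^sup>2 + 8 / a\<^sup>2 * M) * (1 / N ^ 4))"
        unfolding distrib_right using N by (intro mult_left_mono) auto
      also have "\<dots> = (t\<^sup>2 + 8 / a\<^sup>2 * M) * (N * (1 / N ^ 4))" by simp
      also have "\<dots> \<le> (t\<^sup>2 + 8 / a\<^sup>2 * M) * 1" using M a by (intro mult_left_mono N4) simp
      finally have 2: "N * ((posterior_mean y)\<^sup>2 * mixture y) \<le> t\<^sup>2 + 8 / a\<^sup>2 * M" by simp
      have "0 \<le> 2 * (real y0 * u) + 5 * u\<^sup>2" using u by simp
      then show ?thesis
        using robbins_cell_le_crude[of n y] 1 2 unfolding N_def by linarith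
    qed
  next
    show "mixture y \<le> M / \<beta> ^ (2 * y)" for y
      using mixture_chernoff[of "1 + a" M y] moment a M \<beta>(2) by (simp add: power_mult)
  next
    have "real n ^ 3 * M = exp (3 * ln N + ln M)"
      using N M unfolding exp_add by (simp add: N_def exp_of_nat_mult[of 3, simplified])
    also have "\<dots> \<le> exp (real y0 * ln \<beta>)"
      using y0 by (simp add: N_def)
    also have "\<dots> = \<beta> ^ y0"
      using \<beta> by (simp only: exp_of_nat_mult exp_ln)
    finally show "real n ^ 3 * M \<le> \<beta> ^ y0" .
  next
    show "(real (y + 2))\<^sup>2 \<le> 2 * \<beta>\<^sup>2 / (ln \<beta>)\<^sup>2 * \<beta> ^ y" for y
      by (rule square_le_exponential[OF \<beta>(1)])
  qed (use n \<beta> u M a in auto)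
  then show ?thesis by simp
qed

section \<open>Growth rates\<close>

lemma TotRegret_lower:
  assumes "2 \<le> m" "1 \<le> n" "0 < H" "6 * H \<le> real m" "0 < \<eta>" "\<eta> \<le> 1 / 2"
    and "8 * (real m)\<^sup>2 * exp H * (524288 * real m / H) ^ m \<le> \<eta> * sqrt (real n)"
    and "\<And>G. poisson_prior G \<Longrightarrow> measure G {0..H} = 1 \<Longrightarrow>
        (\<And>t. 0 < t \<Longrightarrow> measure G {t..} \<le> 2 * \<eta>) \<Longrightarrow> G \<in> \<G>"
  shows "ereal ((real m)\<^sup>2 * H / 1792) \<le> TotRegret n \<G>"
  unfolding TotRegret_def by (intro INF_greatest regret_lower_bound[OF assms])

text \<open>
  With \<open>H = h\<close> and \<open>m\<close> close to \<open>ln n / (8 ln (ln n))\<close>, the weights have size about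
  \<open>m\<^sup>m \<le> n\<^sup>1\<^sup>/\<^sup>8\<close>, well below \<open>sqrt n\<close>.
\<close>

lemma bounded_lower:
  assumes h: "0 < h"
  shows "\<exists>c>0. \<forall>\<^sub>F n in sequentially.
    ereal (c * (ln (real n) / ln (ln (real n)))\<^sup>2) \<le> TotRegret n (bounded_priors h)"
proof -
  define R where "R n = ln (real n) / (8 * ln (ln (real n)))" for n :: nat
  define D where "D = 524288 / h"
  define E where "E = exp h"
  have DE: "0 < D" "0 < E" using h by (auto simp: D_def E_def)
  have "filterlim R at_top sequentially"
    unfolding R_def by real_asymp
  then have e1: "\<forall>\<^sub>F n in sequentially. 6 * h + 1 / D + 3 \<le> R n"
    by (simp add: filterlim_at_top)
  have e2: "\<forall>\<^sub>F n in sequentially. 8 * (R n)\<^sup>2 * E * (D * R n) powr (R n) \<le> 1 / 2 * sqrt (real n)"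
    unfolding R_def using DE by real_asymp
  have "\<forall>\<^sub>F n in sequentially. ereal (h / 458752 * (ln (real n) / ln (ln (real n)))\<^sup>2) \<le> TotRegret n (bounded_priors h)"
    using e1 e2 eventually_ge_at_top[of 1]
  proof eventually_elim
    case (elim n)
    define m where "m = nat \<lfloor>R n\<rfloor>"
    have R: "3 \<le> R n" "6 * h + 3 \<le> R n" "1 / D \<le> R n" using elim(1) h DE by (auto intro: order_trans[rotated] add_nonneg_nonneg)
    have m: "real m \<le> R n" "R n - 1 \<le> real m"
      using R floor_correct[of "R n"] by (auto simp: m_def)
    have m2: "2 \<le> m" "6 * h \<le> real m" using m R by auto
    have low: "ereal ((real m)\<^sup>2 * h / 1792) \<le> TotRegret n (bounded_priors h)"
    proof (rule TotRegret_lower[where \<eta> = "1 / 2"])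
      have "(524288 * real m / h) ^ m = (D * real m) ^ m" by (simp add: D_def)
      also have "\<dots> \<le> (D * R n) ^ m"
        using DE m by (intro power_mono mult_left_mono) auto
      also have "\<dots> = (D * R n) powr real m"
        using DE R by (simp add: powr_realpow)
      also have "\<dots> \<le> (D * R n) powr R n"
      proof (rule powr_mono[OF m(1)])
        show "1 \<le> D * R n" using R(3) DE by (simp add: field_simps)
      qed
      finally have "8 * (real m)\<^sup>2 * E * (524288 * real m / h) ^ m \<le> 8 * (R n)\<^sup>2 * E * (D * R n) powr (R n)"
        using DE m h by (intro mult_mono power_mono) auto
      from order_trans[OF this elim(2)]
      show "8 * (real m)\<^sup>2 * exp h * (524288 * real m / h) ^ m \<le> 1 / 2 * sqrt (real n)"
        unfolding E_def .
      show "G \<in> bounded_priors h" if "poisson_prior G" "measure G {0..h} = 1" for G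
        using that by (simp add: bounded_priors_def poisson_prior_def poisson_prior_axioms_def)
    qed (use m2 h elim(3) in auto)
    have le: "h / 458752 * (ln (real n) / ln (ln (real n)))\<^sup>2 \<le> (real m)\<^sup>2 * h / 1792"
    proof -
      have "R n / 2 \<le> real m" using m R by simp
      then have "(R n / 2)\<^sup>2 \<le> (real m)\<^sup>2" using R by (intro power_mono) auto
      then have "(R n / 2)\<^sup>2 * h / 1792 \<le> (real m)\<^sup>2 * h / 1792"
        using h by (intro divide_right_mono mult_right_mono) auto
      moreover have "(ln (real n) / ln (ln (real n)))\<^sup>2 = 256 * (R n / 2)\<^sup>2"
        by (simp add: R_def power_divide power_mult_distrib)
      moreover have "h / 458752 * (256 * z) = z * h / 1792" for z by simp
      ultimately show ?thesis by presburger
    qed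
    show ?case
      by (rule order_trans[OF _ low], subst ereal_less_eq(3), rule le)
  qed
  then show ?thesis using h by (intro exI[of _ "h / 458752"]) simp
qed

lemma bounded_upper:
  assumes h: "0 < h"
  shows "\<exists>c>0. \<forall>\<^sub>F n in sequentially.
    max_regret n (bounded_priors h) (robbins n) \<le> ereal (c * (ln (real n) / ln (ln (real n)))\<^sup>2)"
proof -
  define r where "r n = ln (real n) / ln (ln (real n))" for n :: nat
  define k where "k = 2 * h + 7"
  define c where "c = k * (2 * (k * h) + 5 * h\<^sup>2) + 32 / (ln 2)\<^sup>2"
  have k: "0 < k" using h by (simp add: k_def)
  have c: "0 < c" using h k by (auto simp: c_def intro!: add_pos_pos mult_pos_pos)
  have e1: "\<forall>\<^sub>F n in sequentially. 1 \<le> r n" unfolding r_def by real_asymp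
  have e2: "\<forall>\<^sub>F n in sequentially. 4 \<le> ln (real n)" by real_asymp
  have e3: "\<forall>\<^sub>F n in sequentially. 0 < ln (ln (real n))" by real_asymp
  have "\<forall>\<^sub>F n in sequentially. max_regret n (bounded_priors h) (robbins n) \<le> ereal (c * (r n)\<^sup>2)"
    using e1 e2 e3 eventually_ge_at_top[of 3]
  proof eventually_elim
    case (elim n)
    define y0 where "y0 = nat \<lceil>2 * (h + 3) * r n\<rceil>"
    have pos: "0 \<le> 2 * (h + 3) * r n" using h elim(1) by simp
    have y0: "2 * (h + 3) * r n \<le> real y0" "real y0 \<le> 2 * (h + 3) * r n + 1"
      using pos ceiling_correct[of "2 * (h + 3) * r n"] by (auto simp: y0_def)
    have y0_le: "real y0 \<le> k * r n"
      using y0(2) elim(1) by (simp add: k_def algebra_simps)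
    have "2 * (h + 3) * ln (real n) = 2 * (h + 3) * r n * ln (ln (real n))"
      using elim(3) by (simp add: r_def)
    also have "\<dots> \<le> real y0 * ln (ln (real n))"
      using y0(1) elim(3) by (intro mult_right_mono) auto
    finally have y0_ge: "2 * (h + 3) * ln (real n) \<le> real y0 * ln (ln (real n))" .
    have "max_regret n (bounded_priors h) (robbins n)
        \<le> ereal (real y0 * (2 * (real y0 * h) + 5 * h\<^sup>2) + 32 / (ln 2)\<^sup>2)"
      using h by (intro max_regret_le robbins_in_estimators bounded_prior bounded_mmse_finite
          robbins_bounded elim y0_ge add_nonneg_nonneg mult_nonneg_nonneg) auto
    also have "\<dots> \<le> ereal (c * (r n)\<^sup>2)"
    proof -
      have r1: "1 \<le> (r n)\<^sup>2" using elim(1) by simp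
      have "5 * h\<^sup>2 \<le> 5 * h\<^sup>2 * r n" using mult_left_mono[OF elim(1), of "5 * h\<^sup>2"] by simp
      moreover have "2 * (real y0 * h) \<le> 2 * (k * r n * h)"
        using y0_le h by (intro mult_left_mono mult_right_mono) auto
      ultimately have "2 * (real y0 * h) + 5 * h\<^sup>2 \<le> (2 * (k * h) + 5 * h\<^sup>2) * r n"
        by (simp add: algebra_simps)
      then have 1: "real y0 * (2 * (real y0 * h) + 5 * h\<^sup>2) \<le> (k * r n) * ((2 * (k * h) + 5 * h\<^sup>2) * r n)"
        using y0_le h k elim(1) by (intro mult_mono) auto
      have 2: "32 / (ln 2)\<^sup>2 \<le> 32 / (ln 2)\<^sup>2 * (r n)\<^sup>2"
        using mult_left_mono[OF r1, of "32 / (ln 2)\<^sup>2"] by simp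
      have "c * (r n)\<^sup>2 = (k * r n) * ((2 * (k * h) + 5 * h\<^sup>2) * r n) + 32 / (ln 2)\<^sup>2 * (r n)\<^sup>2"
      proof -
        have "(k * b + d) * z\<^sup>2 = (k * z) * (b * z) + d * z\<^sup>2" for b d z :: real
          by (simp add: algebra_simps power2_eq_square)
        then show ?thesis unfolding c_def .
      qed
      with add_mono[OF 1 2] show ?thesis
        unfolding ereal_less_eq by (simp only:)
    qed
    finally show ?case .
  qed
  with c show ?thesis unfolding r_def by blast
qed

text \<open>
  With \<open>H = m / 6\<close> the ratio \<open>m / H\<close> is constant, so all requirements are exponential in \<open>m\<close> and a small multiple of
  \<open>ln n\<close> is admissible for \<open>m\<close>. The base weight \<open>\<eta> = exp (- H / s)\<close> away from \<open>0\<close> is at most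
  doubled by the perturbations, which is exactly what the tail condition allows at \<open>H\<close>.
\<close>

lemma SubE_lower:
  assumes s: "0 < s"
  shows "\<exists>c>0. \<forall>\<^sub>F n in sequentially. ereal (c * (ln (real n)) ^ 3) \<le> TotRegret n (SubE s)"
proof -
  define Q where "Q = 1 / 6 + 1 / (6 * s) + ln (3145728 :: real)"
  define \<kappa> where "\<kappa> = 1 / (4 * Q)"
  have Q: "0 < Q" using s by (auto simp: Q_def intro!: add_pos_pos)
  then have \<kappa>: "0 < \<kappa>" by (simp add: \<kappa>_def)
  have "filterlim (\<lambda>n. \<kappa> * ln (real n)) at_top sequentially"
    using \<kappa> by real_asymp
  then have e1: "\<forall>\<^sub>F n in sequentially. 6 * s + 3 \<le> \<kappa> * ln (real n)"
    by (simp add: filterlim_at_top)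
  have e2: "\<forall>\<^sub>F n in sequentially. 8 * (\<kappa> * ln (real n))\<^sup>2 * exp (ln (real n) / 4) \<le> sqrt (real n)"
    using \<kappa> by real_asymp
  have "\<forall>\<^sub>F n in sequentially. ereal (\<kappa> ^ 3 / 86016 * (ln (real n)) ^ 3) \<le> TotRegret n (SubE s)"
    using e1 e2 eventually_ge_at_top[of 1]
  proof eventually_elim
    case (elim n)
    define r where "r = \<kappa> * ln (real n)"
    define m where "m = nat \<lfloor>r\<rfloor>"
    define H where "H = real m / 6"
    have r: "6 * s + 3 \<le> r" using elim(1) by (simp add: r_def)
    then have r3: "3 \<le> r" using s by linarith
    have m: "real m \<le> r" "r - 1 \<le> real m"
      using r3 floor_correct[of r] by (auto simp: m_def)
    have m2: "2 \<le> m" "6 * s \<le> real m" using m r r3 by auto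
    have H: "0 < H" "s \<le> H" using m2 by (auto simp: H_def)
    define \<eta> where "\<eta> = exp (- H / s)"
    have "\<eta> \<le> exp (- 1)" using H s by (simp add: \<eta>_def)
    also have "\<dots> \<le> 1 / 2"
      using exp_ge_add_one_self[of "1 :: real"] by (simp add: exp_minus field_simps)
    finally have \<eta>: "0 < \<eta>" "\<eta> \<le> 1 / 2" by (simp_all add: \<eta>_def)
    have low: "ereal ((real m)\<^sup>2 * H / 1792) \<le> TotRegret n (SubE s)"
    proof (rule TotRegret_lower[OF m2(1) elim(3) H(1) _ \<eta>])
      define L where "L = ln (3145728 :: real)"
      have "524288 * real m / H = exp L" using m2 by (simp add: H_def L_def)
      then have "exp H * (524288 * real m / H) ^ m = exp (H + real m * L)"
        by (simp only: exp_add exp_of_nat_mult)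
      also have "H + real m * L = real m * Q + (- H / s)"
        using s by (simp add: H_def Q_def L_def[symmetric] field_simps)
      finally have eq: "exp H * (524288 * real m / H) ^ m = exp (real m * Q) * \<eta>"
        by (simp only: \<eta>_def exp_add)
      have "8 * (real m)\<^sup>2 * exp (real m * Q) \<le> sqrt (real n)"
      proof -
        have "real m * Q \<le> r * Q" using m Q by (intro mult_right_mono) auto
        also have "r * Q = ln (real n) / 4" using Q by (simp add: r_def \<kappa>_def)
        finally have "8 * (real m)\<^sup>2 * exp (real m * Q) \<le> 8 * r\<^sup>2 * exp (ln (real n) / 4)"
          using m by (intro mult_mono power_mono) auto
        then show ?thesis using elim(2) by (simp add: r_def)
      qed
      from mult_left_mono[OF this less_imp_le[OF \<eta>(1)]]
      show "8 * (real m)\<^sup>2 * exp H * (524288 * real m / H) ^ m \<le> \<eta> * sqrt (real n)"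
        unfolding mult.assoc eq by (simp only: mult_ac)
      show "G \<in> SubE s" if G: "poisson_prior G" "measure G {0..H} = 1" "\<And>t. 0 < t \<Longrightarrow> measure G {t..} \<le> 2 * \<eta>" for G
      proof -
        interpret poisson_prior G by (rule G(1))
        have "measure G {0..} = 1"
          using finite_measure_mono[of "{0..H}" "{0..}"] G(2) prob_le_1[of "{0..}"] by auto
        moreover have "measure G {t..} \<le> 2 * exp (- t / s)" if t: "0 < t" for t
        proof (cases "t \<le> H")
          case True
          then have "\<eta> \<le> exp (- t / s)" using s by (simp add: \<eta>_def divide_right_mono)
          with G(3)[OF t] show ?thesis by simp
        next
          case False
          then have "measure G ({0..H} \<union> {t..}) = measure G {0..H} + measure G {t..}"
            by (intro finite_measure_Union) auto
          then have "measure G {t..} \<le> 0" using G(2) prob_le_1[of "{0..H} \<union> {t..}"] by simp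
          then show ?thesis by (rule order_trans) simp
        qed
        ultimately show ?thesis
          using prob_space_axioms by (simp add: SubE_def)
      qed
    qed (simp add: H_def)
    have le: "\<kappa> ^ 3 / 86016 * (ln (real n)) ^ 3 \<le> (real m)\<^sup>2 * H / 1792"
    proof -
      have "r / 2 \<le> real m" using m r3 by simp
      then have "(r / 2) ^ 3 \<le> real m ^ 3" using r3 by (intro power_mono) auto
      then show ?thesis
        by (simp add: r_def H_def power_divide power_mult_distrib power2_eq_square power3_eq_cube mult_ac)
    qed
    show ?case
      by (rule order_trans[OF _ low], subst ereal_less_eq(3), rule le)
  qed
  then show ?thesis using \<kappa> by (intro exI[of _ "\<kappa> ^ 3 / 86016"]) simp
qed

text \<open>
  Each ingredient of \<open>robbins_SubE\<close> is at most a constant times \<open>ln n\<close>: \<open>y0 \<le> w ln n\<close> and \<open>u \<le> v ln n\<close>.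
\<close>

lemma SubE_upper:
  assumes s: "0 < s"
  shows "\<exists>c>0. \<forall>\<^sub>F n in sequentially. max_regret n (SubE s) (robbins n) \<le> ereal (c * (ln (real n)) ^ 3)"
proof -
  define a where "a = 1 / (2 * s)"
  define M where "M = SubE_moment"
  define \<beta> where "\<beta> = sqrt (1 + a)"
  define v where "v = 8 / a + 2 / a * M"
  define w where "w = (3 + ln M) / ln \<beta> + 1"
  define b where "b = 2 * (w * v) + 5 * v\<^sup>2 + w\<^sup>2 + (8 / a)\<^sup>2 + 8 / a\<^sup>2 * M"
  define d where "d = 4 * \<beta>\<^sup>2 / (ln \<beta>)\<^sup>2 / (1 - 1 / \<beta>)"
  have a: "0 < a" using s by (simp add: a_def)
  have M: "1 \<le> M" unfolding M_def by (rule SubE_moment_ge_1)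
  have \<beta>: "1 < \<beta>" "0 < ln \<beta>" using a by (auto simp: \<beta>_def)
  have v: "0 < v" using a M by (auto simp: v_def intro!: add_pos_pos)
  have w: "0 < w" using M \<beta> by (auto simp: w_def intro!: add_nonneg_pos)
  have b: "0 < b" using v w a M by (auto simp: b_def intro!: add_pos_pos)
  have d: "0 \<le> d" using \<beta> by (simp add: d_def)
  have e1: "\<forall>\<^sub>F n in sequentially. 1 \<le> ln (real n)" by real_asymp
  have "\<forall>\<^sub>F n in sequentially. max_regret n (SubE s) (robbins n) \<le> ereal ((w * b + d) * (ln (real n)) ^ 3)"
    using e1 eventually_ge_at_top[of 3]
  proof eventually_elim
    case (elim n)
    define x where "x = ln (real n)"
    define t where "t = 8 / a * x"
    define u where "u = t + 2 / a * M"
    define y0 where "y0 = nat \<lceil>(3 * x + ln M) / ln \<beta>\<rceil>"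
    have x: "1 \<le> x" using elim(1) by (simp add: x_def)
    have pos: "0 \<le> (3 * x + ln M) / ln \<beta>" using x M \<beta> by simp
    have y0: "(3 * x + ln M) / ln \<beta> \<le> real y0" "real y0 \<le> (3 * x + ln M) / ln \<beta> + 1"
      using pos ceiling_correct[of "(3 * x + ln M) / ln \<beta>"] by (auto simp: y0_def)
    have y0_ge: "3 * x + ln M \<le> real y0 * ln \<beta>"
      using y0(1) \<beta> by (simp add: pos_divide_le_eq)
    have y0_le: "real y0 \<le> w * x"
    proof -
      have "ln M * 1 \<le> ln M * x" using x M by (intro mult_left_mono) auto
      then have "(3 * x + ln M) / ln \<beta> \<le> (3 * x + ln M * x) / ln \<beta>"
        using \<beta> by (intro divide_right_mono) auto
      also have "\<dots> = (3 + ln M) / ln \<beta> * x" by (simp add: algebra_simps)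
      finally show ?thesis using y0(2) x by (simp add: w_def algebra_simps)
    qed
    have t_nonneg: "0 \<le> t" and u_nonneg: "0 \<le> u" using a M x by (auto simp: t_def u_def)
    have u_le: "u \<le> v * x"
    proof -
      have "2 / a * M * 1 \<le> 2 / a * M * x" using a M x by (intro mult_left_mono) auto
      then show ?thesis by (simp add: u_def t_def v_def distrib_right)
    qed
    let ?B = "2 * (real y0 * u) + 5 * u\<^sup>2 + (real y0)\<^sup>2 + t\<^sup>2 + 8 / a\<^sup>2 * M"
    have B_nonneg: "0 \<le> ?B" using u_nonneg a M by (intro add_nonneg_nonneg) auto
    have "max_regret n (SubE s) (robbins n) \<le> ereal (real y0 * ?B + d)"
    proof (intro max_regret_le robbins_in_estimators SubE_prior[OF _ s] SubE_mmse_finite[OF _ s])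
      show "poisson_prior.regret G n (robbins n) \<le> ennreal (real y0 * ?B + d)" if "G \<in> SubE s" for G
        using robbins_SubE[OF s elim(2) _ that, of y0] y0_ge
        by (simp add: a_def M_def \<beta>_def d_def u_def t_def x_def)
      show "0 \<le> real y0 * ?B + d" by (rule add_nonneg_nonneg[OF mult_nonneg_nonneg[OF _ B_nonneg] d]) simp
    qed
    also have "\<dots> \<le> ereal ((w * b + d) * x ^ 3)"
    proof -
      have x2: "1 \<le> x\<^sup>2" and x3: "1 \<le> x ^ 3" using x by (auto intro: one_le_power)
      have "real y0 * u \<le> (w * x) * (v * x)"
        using y0_le u_le u_nonneg w x by (intro mult_mono) auto
      moreover have "u\<^sup>2 \<le> (v * x)\<^sup>2" "(real y0)\<^sup>2 \<le> (w * x)\<^sup>2"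
        using y0_le u_le u_nonneg by (auto intro!: power_mono)
      moreover have "8 / a\<^sup>2 * M * 1 \<le> 8 / a\<^sup>2 * M * x\<^sup>2"
        using a M x2 by (intro mult_left_mono) auto
      moreover have "t\<^sup>2 = (8 / a)\<^sup>2 * x\<^sup>2" by (simp add: t_def power_mult_distrib power_divide)
      ultimately have "?B \<le> 2 * ((w * x) * (v * x)) + 5 * (v * x)\<^sup>2 + (w * x)\<^sup>2 + (8 / a)\<^sup>2 * x\<^sup>2 + 8 / a\<^sup>2 * M * x\<^sup>2"
        by linarith
      also have "\<dots> = b * x\<^sup>2"
        by (simp add: b_def power2_eq_square algebra_simps)
      finally have 1: "real y0 * ?B \<le> (w * x) * (b * x\<^sup>2)"
        using y0_le B_nonneg w x by (intro mult_mono) auto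
      have 2: "d \<le> d * x ^ 3" using mult_left_mono[OF x3 d] by simp
      have "(w * b + d) * x ^ 3 = (w * x) * (b * x\<^sup>2) + d * x ^ 3"
        by (simp add: algebra_simps power2_eq_square power3_eq_cube)
      with add_mono[OF 1 2] show ?thesis
        unfolding ereal_less_eq by (simp only:)
    qed
    finally show ?case by (simp add: x_def)
  qed
  moreover have "0 < w * b + d" using w b d by (intro add_pos_nonneg) auto
  ultimately show ?thesis by blast
qed

lemma two_sided:
  assumes lower: "\<exists>c>0. \<forall>\<^sub>F n in sequentially. ereal (c * \<phi> n) \<le> TotRegret n \<G>"
    and upper: "\<exists>c>0. \<forall>\<^sub>F n in sequentially. max_regret n \<G> (robbins n) \<le> ereal (c * \<phi> n)"
  shows "\<exists>c c' :: real. \<exists>n0 :: nat. c > 0 \<and> c' > 0 \<and>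
    (\<forall>n\<ge>n0. ereal (c * \<phi> n) \<le> TotRegret n \<G> \<and> TotRegret n \<G> \<le> ereal (c' * \<phi> n) \<and>
      max_regret n \<G> (robbins n) \<le> ereal (c' * \<phi> n))"
proof -
  obtain c c' where c: "0 < c" "0 < c'"
    and "\<forall>\<^sub>F n in sequentially. ereal (c * \<phi> n) \<le> TotRegret n \<G>"
    and "\<forall>\<^sub>F n in sequentially. max_regret n \<G> (robbins n) \<le> ereal (c' * \<phi> n)"
    using assms by blast
  from eventually_conj[OF this(3,4)] obtain n0 where
    "\<And>n. n0 \<le> n \<Longrightarrow> ereal (c * \<phi> n) \<le> TotRegret n \<G> \<and> max_regret n \<G> (robbins n) \<le> ereal (c' * \<phi> n)"
    unfolding eventually_sequentially by blast
  with c TotRegret_le_robbins show ?thesis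
    by (intro exI[of _ c] exI[of _ c'] exI[of _ n0]) (meson order_trans)
qed

theorem theorem2:
  shows "(\<forall>h::real. h > 0 \<longrightarrow>
      (\<exists>c1 c2 :: real. \<exists>n0 :: nat. c1 > 0 \<and> c2 > 0 \<and>
        (\<forall>n\<ge>n0.
          ereal (c1 * (ln (real n) / ln (ln (real n)))\<^sup>2) \<le> TotRegret n (bounded_priors h) \<and>
          TotRegret n (bounded_priors h) \<le> ereal (c2 * (ln (real n) / ln (ln (real n)))\<^sup>2) \<and>
          max_regret n (bounded_priors h) (robbins n)
            \<le> ereal (c2 * (ln (real n) / ln (ln (real n)))\<^sup>2))))
    \<and> (\<forall>s::real. s > 0 \<longrightarrow>
      (\<exists>c3 c4 :: real. \<exists>n0 :: nat. c3 > 0 \<and> c4 > 0 \<and>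
        (\<forall>n\<ge>n0.
          ereal (c3 * (ln (real n)) ^ 3) \<le> TotRegret n (SubE s) \<and>
          TotRegret n (SubE s) \<le> ereal (c4 * (ln (real n)) ^ 3) \<and>
          max_regret n (SubE s) (robbins n) \<le> ereal (c4 * (ln (real n)) ^ 3))))"
  by (intro conjI allI impI two_sided bounded_lower bounded_upper SubE_lower SubE_upper)

end
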